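(* Let $\Omega\subset\mathbb{R}^N$, $N\ge2$, be a bounded domain with boundary $\Gamma$ of class $C^2$ and let $z$ be any critical point in $\Omega$ of the solution $u$ of $\Delta u=N$ in $\Omega$, $u=0$ on $\Gamma$. Consider the function $h=q-u$, with $q(x)=\frac12(|x-z|^2-a)$, $a\in\mathbb{R}$, and let $\rho_i=\min_{x\in\Gamma}|x-z|$, $\rho_e=\max_{x\in\Gamma}|x-z|$. There exists a positive constant $C$ such that $$\rho_e-\rho_i\le C\,\big\|\delta_\Gamma^{1/2}\,\nabla^2h\big\|_{L^2(\Omega)}^{\tau_N},$$ with the following specifications: (i) $\tau_2=1$; (ii) $\tau_3$ is arbitrarily close to one, in the sense that for any $\theta>0$ there exists a positive constant $C$ such that the inequality holds with $\tau_3=1-\theta$; (iii) $\tau_N=2/(N-1)$ for $N\ge4$. The constant $C$ depends only on $N$, $r_i$, $r_e$, $d_\Omega$, $\delta_\Gamma(z)$, and $\theta$ (the latter only in the case $N=3$).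
   Context: A domain is a connected open set. $\delta_\Gamma(x)$ is the distance from $x$ to $\Gamma$ and $d_\Omega$ is the diameter of $\Omega$; $\|\delta_\Gamma^{1/2}\nabla^2h\|_{L^2(\Omega)}=\big(\sum_{i,j}\|\delta_\Gamma^{1/2}h_{ij}\|_{L^2(\Omega)}^2\big)^{1/2}$. Since $\Gamma$ is of class $C^2$, $\Omega$ satisfies uniform interior and exterior sphere conditions, whose radii are $r_i$ and $r_e$: for each $p\in\Gamma$ there is a ball of radius $r_i$ contained in $\Omega$ (respectively, a ball of radius $r_e$ contained in $\mathbb{R}^N\setminus\overline\Omega$) whose closure intersects $\Gamma$ only at $p$. *)

theory Defs
  imports "HOL-Analysis.Analysis"
begin

definition partial_deriv :: "'n::finite \<Rightarrow> (real^'n \<Rightarrow> real) \<Rightarrow> real^'n \<Rightarrow> real" where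
  "partial_deriv i f x = deriv (\<lambda>t. f (x + t *\<^sub>R axis i 1)) 0"

definition gradient :: "(real^'n::finite \<Rightarrow> real) \<Rightarrow> real^'n \<Rightarrow> real^'n" where
  "gradient f x = (\<chi> i. partial_deriv i f x)"

definition hessian :: "(real^'n::finite \<Rightarrow> real) \<Rightarrow> real^'n \<Rightarrow> real^'n^'n" where
  "hessian f x = (\<chi> i j. partial_deriv i (partial_deriv j f) x)"

definition laplacian :: "(real^'n::finite \<Rightarrow> real) \<Rightarrow> real^'n \<Rightarrow> real" where
  "laplacian f x = (\<Sum>i\<in>UNIV. partial_deriv i (partial_deriv i f) x)"

text \<open>The next two notions are meant for open sets \<open>S\<close>. The explicit differentiability
  clause is needed because \<^const>\<open>deriv\<close> is total.\<close>

definition C1_on :: "(real^'n::finite) set \<Rightarrow> (real^'n \<Rightarrow> real) \<Rightarrow> bool" where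
  "C1_on S f \<longleftrightarrow>
     (\<forall>i. (\<forall>x\<in>S. (\<lambda>t. f (x + t *\<^sub>R axis i 1)) differentiable (at 0)) \<and>
          continuous_on S (partial_deriv i f))"

definition C2_on :: "(real^'n::finite) set \<Rightarrow> (real^'n \<Rightarrow> real) \<Rightarrow> bool" where
  "C2_on S f \<longleftrightarrow> C1_on S f \<and> (\<forall>i. C1_on S (partial_deriv i f))"

text \<open>Near each boundary point, \<open>\<Omega>\<close> is the region above the graph of a \<open>C\<^sup>2\<close> function of
  \<open>N - 1\<close> variables in some rotated coordinate system whose last axis is \<open>e\<close>. The function
  of \<open>N - 1\<close> variables is encoded as a function \<open>g\<close> on the whole space that is constant in the
  direction \<open>e\<close>.\<close>

definition C2_boundary :: "(real^'n::finite) set \<Rightarrow> bool" where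
  "C2_boundary \<Omega> \<longleftrightarrow>
     (\<forall>p\<in>frontier \<Omega>. \<exists>r>0. \<exists>e g. norm e = 1 \<and> C2_on UNIV g \<and>
        (\<forall>x t. g (x + t *\<^sub>R e) = g x) \<and>
        \<Omega> \<inter> ball p r = {x \<in> ball p r. x \<bullet> e > g x})"

definition interior_sphere_condition :: "(real^'n::finite) set \<Rightarrow> real \<Rightarrow> bool" where
  "interior_sphere_condition \<Omega> r \<longleftrightarrow> r > 0 \<and>
     (\<forall>p\<in>frontier \<Omega>. \<exists>c. ball c r \<subseteq> \<Omega> \<and> closure (ball c r) \<inter> frontier \<Omega> = {p})"

definition exterior_sphere_condition :: "(real^'n::finite) set \<Rightarrow> real \<Rightarrow> bool" where
  "exterior_sphere_condition \<Omega> r \<longleftrightarrow> r > 0 \<and>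
     (\<forall>p\<in>frontier \<Omega>. \<exists>c. ball c r \<subseteq> - closure \<Omega> \<and> closure (ball c r) \<inter> frontier \<Omega> = {p})"

text \<open>Classical solutions: twice continuously differentiable inside, continuous up to the
  boundary.\<close>

definition torsion_solution :: "(real^'n::finite) set \<Rightarrow> (real^'n \<Rightarrow> real) \<Rightarrow> bool" where
  "torsion_solution \<Omega> u \<longleftrightarrow> C2_on \<Omega> u \<and> continuous_on (closure \<Omega>) u \<and>
     (\<forall>x\<in>\<Omega>. laplacian u x = real CARD('n)) \<and> (\<forall>x\<in>frontier \<Omega>. u x = 0)"

definition boundary_dist :: "(real^'n::finite) set \<Rightarrow> real^'n \<Rightarrow> real" where
  "boundary_dist \<Omega> x = infdist x (frontier \<Omega>)"

definition L2_norm_on :: "(real^'n::finite) set \<Rightarrow> (real^'n \<Rightarrow> real) \<Rightarrow> real" where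
  "L2_norm_on S f = sqrt (LINT x:S|lebesgue. (f x)\<^sup>2)"

definition weighted_hessian_norm :: "(real^'n::finite) set \<Rightarrow> (real^'n \<Rightarrow> real) \<Rightarrow> real" where
  "weighted_hessian_norm \<Omega> h =
     sqrt (\<Sum>i\<in>UNIV. \<Sum>j\<in>UNIV.
       (L2_norm_on \<Omega> (\<lambda>x. boundary_dist \<Omega> x powr (1/2) * hessian h x $ i $ j))\<^sup>2)"

text \<open>The frontier of a nonempty bounded open set is nonempty and compact, so for the domains
  considered the following infimum and supremum are attained.\<close>

definition inner_radius :: "(real^'n::finite) set \<Rightarrow> real^'n \<Rightarrow> real" where
  "inner_radius \<Omega> z = (INF x\<in>frontier \<Omega>. norm (x - z))"

definition outer_radius :: "(real^'n::finite) set \<Rightarrow> real^'n \<Rightarrow> real" where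
  "outer_radius \<Omega> z = (SUP x\<in>frontier \<Omega>. norm (x - z))"

text \<open>The exponents \<open>\<tau>\<^sub>N\<close>; in dimension three any \<open>1 - \<theta>\<close> with \<open>\<theta> > 0\<close>.\<close>

definition stability_exponent :: "nat \<Rightarrow> real \<Rightarrow> bool" where
  "stability_exponent N \<tau> \<longleftrightarrow>
     (N = 2 \<and> \<tau> = 1) \<or>
     (N = 3 \<and> (\<exists>\<theta>>0. \<tau> = 1 - \<theta>)) \<or>
     (N \<ge> 4 \<and> \<tau> = 2 / (real N - 1))"

end

theory Submission imports Defs begin

text \<open>The function \<open>h\<close> is harmonic, has gradient zero at \<open>z\<close>, and equals \<open>q\<close> on the boundary, so
  \<open>\<rho>\<^sub>e - \<rho>\<^sub>i\<close> is controlled by the oscillation of \<open>h\<close> on the boundary. No Sobolev or Poincare inequality is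
  needed: write \<open>E\<close> for the weighted Hessian norm and \<open>\<alpha> = (N - 1)/2\<close>. The mean value property gives
  \<open>\<bar>h\<^sub>i\<^sub>j\<bar> \<le> C E / dist\<^bsup>\<alpha>+1\<^esup>\<close>, where \<open>dist\<close> is the distance to the boundary. Integrating from \<open>z\<close> along a
  chain of boundedly many short steps to the center of an interior ball, and from there along the
  normal to the boundary, yields \<open>\<bar>grad h\<bar> \<le> C E / t\<^bsup>\<alpha>\<^esup>\<close> at depth \<open>t\<close>. For \<open>N = 2\<close> this is integrable down to
  \<open>t = 0\<close>. For \<open>N \<ge> 3\<close> one integrates down to depth \<open>\<epsilon>\<close>, uses a Lipschitz bound for \<open>h\<close> below \<open>\<epsilon>\<close>, and
  optimizes \<open>\<epsilon>\<close>; with \<open>\<alpha>\<close> replaced by a slightly larger exponent if \<open>N = 3\<close>, where a logarithm would appear.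

  The Lipschitz bound comes from a barrier at the exterior spheres. Finiteness of \<open>E\<close> comes from
  testing the subharmonic function \<open>\<bar>grad h\<bar>\<^sup>2\<close>, whose Laplacian is \<open>2 \<bar>Hess h\<bar>\<^sup>2\<close>, against
  convex cutoffs of \<open>-u\<close>, which is comparable to \<open>dist\<close> from below.\<close>

section \<open>Partial derivatives\<close>

text \<open>The constants must be uniform over all admissible domains, and this decides the form of
  the proof. Each is defined in a locale from the dimension, \<open>r\<^sub>i\<close>,
  \<open>r\<^sub>e\<close>, \<open>d\<close>, \<open>\<delta>\<close> and at most an exponent, so
  its exported form displays what it depends on. Bare connectedness gives no usable path from z: the
  depth of the path is controlled by a neck width computed from the two sphere radii, and its length
  by a covering number of a ball of radius d.

  The exponents: on a ball around x of radius comparable to dist, the weight is comparable to dist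
  and the volume to dist^N, whence dist^(N+1) * |h_ij(x)|^2 \<le> C * E^2. If \<alpha> > 1,
  balancing E * eps^(1-\<alpha>) against eps gives eps = E^(1/\<alpha>), the rate 2/(N-1).

  At the boundary u is known to be continuous and nothing more. Information there comes from
  comparison functions, from interior estimates in which the scale dist cancels, and from a limit
  along the normal.\<close>

definition has_partial_deriv ::
  "(real^'n::finite \<Rightarrow> real) \<Rightarrow> 'n \<Rightarrow> real^'n \<Rightarrow> real \<Rightarrow> bool" where
  "has_partial_deriv f i x D \<longleftrightarrow>
     ((\<lambda>t. f (x + t *\<^sub>R axis i 1)) has_real_derivative D) (at 0)"

lemma partial_deriv_eqI: "has_partial_deriv f i x D \<Longrightarrow> partial_deriv i f x = D"
  unfolding has_partial_deriv_def partial_deriv_def by (rule DERIV_imp_deriv)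

lemma has_partial_deriv_line:
  "has_partial_deriv f i (x + t *\<^sub>R axis i 1) D \<longleftrightarrow>
     ((\<lambda>s. f (x + s *\<^sub>R axis i 1)) has_real_derivative D) (at t)"
proof -
  have "(\<lambda>s. f (x + t *\<^sub>R axis i 1 + s *\<^sub>R axis i 1)) = (\<lambda>s. f (x + (s + t) *\<^sub>R axis i 1))"
    by (simp add: scaleR_add_left algebra_simps)
  then show ?thesis
    unfolding has_partial_deriv_def
    using DERIV_shift[of "\<lambda>s. f (x + s *\<^sub>R axis i 1)" D 0 t] by simp
qed

lemma eventually_axis_line:
  fixes x :: "real^'n::finite"
  assumes "open S" "x \<in> S"
  shows "\<forall>\<^sub>F t in nhds 0. x + t *\<^sub>R axis i 1 \<in> S"
proof -
  have "((\<lambda>t. x + t *\<^sub>R axis i 1) \<longlongrightarrow> x + 0 *\<^sub>R axis i 1) (nhds (0::real))"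
    by (intro tendsto_intros filterlim_ident)
  then show ?thesis using assms by (simp add: topological_tendstoD)
qed

lemma has_partial_deriv_cong:
  assumes "open S" "x \<in> S" "\<And>y. y \<in> S \<Longrightarrow> f y = g y" "has_partial_deriv g i x D"
  shows "has_partial_deriv f i x D"
proof -
  have "\<forall>\<^sub>F t in nhds 0. f (x + t *\<^sub>R axis i 1) = g (x + t *\<^sub>R axis i 1)"
    using eventually_axis_line[OF assms(1,2), of i] by eventually_elim (simp add: assms)
  then show ?thesis
    using assms(4) unfolding has_partial_deriv_def by (simp cong: DERIV_cong_ev)
qed

lemma has_partial_deriv_const: "has_partial_deriv (\<lambda>_. c) i x 0"
  unfolding has_partial_deriv_def by simp

lemma has_partial_deriv_add:
  "has_partial_deriv f i x D \<Longrightarrow> has_partial_deriv g i x E \<Longrightarrow>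
     has_partial_deriv (\<lambda>y. f y + g y) i x (D + E)"
  unfolding has_partial_deriv_def by (rule DERIV_add)

lemma has_partial_deriv_diff:
  "has_partial_deriv f i x D \<Longrightarrow> has_partial_deriv g i x E \<Longrightarrow>
     has_partial_deriv (\<lambda>y. f y - g y) i x (D - E)"
  unfolding has_partial_deriv_def by (rule DERIV_diff)

lemma has_partial_deriv_mult:
  "has_partial_deriv f i x D \<Longrightarrow> has_partial_deriv g i x E \<Longrightarrow>
     has_partial_deriv (\<lambda>y. f y * g y) i x (D * g x + E * f x)"
  unfolding has_partial_deriv_def by (drule (1) DERIV_mult) simp

lemma has_partial_deriv_cmult:
  "has_partial_deriv f i x D \<Longrightarrow> has_partial_deriv (\<lambda>y. c * f y) i x (c * D)"
  unfolding has_partial_deriv_def by (rule DERIV_cmult)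

lemma has_partial_deriv_sum:
  "(\<And>k. k \<in> A \<Longrightarrow> has_partial_deriv (f k) i x (D k)) \<Longrightarrow>
     has_partial_deriv (\<lambda>y. \<Sum>k\<in>A. f k y) i x (\<Sum>k\<in>A. D k)"
  unfolding has_partial_deriv_def by (rule DERIV_sum)

lemma has_partial_deriv_compose:
  assumes "(g has_real_derivative E) (at (f x))" "has_partial_deriv f i x D"
  shows "has_partial_deriv (\<lambda>y. g (f y)) i x (E * D)"
  using assms DERIV_chain2[of g E "\<lambda>t. f (x + t *\<^sub>R axis i 1)" 0 D UNIV]
  unfolding has_partial_deriv_def by simp

lemma has_partial_deriv_nth: "has_partial_deriv (\<lambda>y. y $ j) i x (if i = j then 1 else 0)"
  unfolding has_partial_deriv_def by (auto intro!: derivative_eq_intros simp: axis_def)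

lemma has_partial_deriv_dist2: 
  "has_partial_deriv (\<lambda>y. (norm (y - c))\<^sup>2) i x (2 * (x $ i - c $ i))"
proof -
  have "has_partial_deriv (\<lambda>y. (norm (y - c))\<^sup>2) i x
      (\<Sum>k\<in>UNIV. if i = k then 2 * (x $ k - c $ k) else 0)"
    unfolding power2_norm_eq_inner inner_vec_def has_partial_deriv_def
    by (rule DERIV_sum) (auto intro!: derivative_eq_intros simp: axis_def)
  then show ?thesis by simp
qed

lemma has_partial_deriv_affine:
  assumes "has_partial_deriv f i (x + s *\<^sub>R y) D"
  shows "has_partial_deriv (\<lambda>y. f (x + s *\<^sub>R y)) i y (s * D)"
proof -
  have "((\<lambda>t. f ((x + s *\<^sub>R y) + (s * t) *\<^sub>R axis i 1)) has_real_derivative D * s) (at 0)"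
    using assms unfolding has_partial_deriv_def
    by (intro DERIV_chain2[where f="\<lambda>t. f ((x + s *\<^sub>R y) + t *\<^sub>R axis i 1)"])
      (auto intro!: derivative_eq_intros)
  then show ?thesis unfolding has_partial_deriv_def by (simp add: algebra_simps)
qed

lemma C1_onI:
  assumes "open S" "\<And>i x. x \<in> S \<Longrightarrow> has_partial_deriv f i x (g i x)" "\<And>i. continuous_on S (g i)"
  shows "C1_on S f"
proof -
  have "continuous_on S (partial_deriv i f)" for i
    using assms(3)[of i] by (rule continuous_on_eq) (metis partial_deriv_eqI assms(2))
  then show ?thesis
    using assms(2) unfolding C1_on_def has_partial_deriv_def
    by (metis real_differentiable_def)
qed

lemma C1_on_has_partial_deriv:
  assumes "C1_on S f" "x \<in> S"
  shows "has_partial_deriv f i x (partial_deriv i f x)"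
proof -
  have "(\<lambda>t. f (x + t *\<^sub>R axis i 1)) differentiable (at 0)" using assms unfolding C1_on_def by blast
  then show ?thesis
    unfolding has_partial_deriv_def partial_deriv_def
    using DERIV_deriv_iff_real_differentiable by blast
qed

lemma C1_on_continuous_partial: "C1_on S f \<Longrightarrow> continuous_on S (partial_deriv i f)"
  unfolding C1_on_def by blast

lemma C1_on_subset: "C1_on S f \<Longrightarrow> T \<subseteq> S \<Longrightarrow> C1_on T f"
  unfolding C1_on_def by (meson continuous_on_subset subsetD)

lemma C2_on_subset: "C2_on S f \<Longrightarrow> T \<subseteq> S \<Longrightarrow> C2_on T f"
  unfolding C2_on_def by (meson C1_on_subset)

lemma C2_on_C1: "C2_on S f \<Longrightarrow> C1_on S f" "C2_on S f \<Longrightarrow> C1_on S (partial_deriv i f)"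
  unfolding C2_on_def by blast+

text \<open>With explicit candidates for the derivatives, one application yields both the regularity
  and the values of the second derivatives. \<open>partial_deriv i f\<close> agrees with
  \<open>g i\<close> on \<open>S\<close> only; openness of \<open>S\<close> is what allows it to be
  differentiated there.\<close>

lemma C2_onI:
  assumes S: "open S" and f: "\<And>i x. x \<in> S \<Longrightarrow> has_partial_deriv f i x (g i x)"
    and g: "\<And>i j x. x \<in> S \<Longrightarrow> has_partial_deriv (g i) j x (h i j x)"
    and c: "\<And>i. continuous_on S (g i)" "\<And>i j. continuous_on S (h i j)"
  shows "C2_on S f" "x \<in> S \<Longrightarrow> partial_deriv j (partial_deriv i f) x = h i j x"
proof -
  have eq: "partial_deriv i f x = g i x" if "x \<in> S" for i x
    by (rule partial_deriv_eqI[OF f[OF that]])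
  have pd: "has_partial_deriv (partial_deriv i f) j x (h i j x)" if "x \<in> S" for i j x
    using has_partial_deriv_cong[OF S that eq g[OF that]] .
  show "C2_on S f"
    unfolding C2_on_def using C1_onI[OF S f c(1)] C1_onI[OF S pd c(2)] by blast
  show "x \<in> S \<Longrightarrow> partial_deriv j (partial_deriv i f) x = h i j x"
    by (rule partial_deriv_eqI[OF pd])
qed

text \<open>The increment is split into moves along single axes, and the mean value theorem is
  applied to each move.\<close>

lemma C1_on_has_derivative:
  fixes f :: "real^'n::finite \<Rightarrow> real"
  assumes f: "C1_on S f" and S: "open S" "x \<in> S"
  shows "(f has_derivative (\<lambda>v. \<Sum>i\<in>UNIV. v $ i * partial_deriv i f x)) (at x)"
proof (rule has_derivativeI[OF _ _])
  show "bounded_linear (\<lambda>v. \<Sum>i\<in>UNIV. v $ i * partial_deriv i f x)"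
    by (intro bounded_linear_sum bounded_linear_mult_const bounded_linear_vec_nth)
  \<comment> \<open>Adding one index to \<open>A\<close> moves \<open>x + rest A v\<close> along one
    axis. Since \<open>rest\<close> never increases the norm, the point stays in the ball where the
    partial derivatives are close to their values at \<open>x\<close>.\<close>
  define rest where "rest A v = (\<chi> i. if i \<in> A then v $ i else 0)" for A and v :: "real^'n"
  have norm_rest: "norm (rest A v) \<le> norm v" for A v
    unfolding rest_def by (rule norm_le_componentwise_cart) auto
  have "\<exists>d>0. \<forall>v. norm v < d \<longrightarrow>
      \<bar>f (x + v) - f x - (\<Sum>i\<in>UNIV. v $ i * partial_deriv i f x)\<bar> \<le> e * norm v"
    if "e > 0" for e
  proof -
    define e' where "e' = e / real CARD('n)"
    have e': "e' > 0" using that unfolding e'_def by simp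
    have "\<forall>\<^sub>F y in nhds x. y \<in> S \<and> (\<forall>i\<in>UNIV. dist (partial_deriv i f y) (partial_deriv i f x) < e')"
    proof (intro eventually_conj eventually_ball_finite ballI)
      show "\<forall>\<^sub>F y in nhds x. y \<in> S" using S eventually_nhds by blast
      fix i
      have "isCont (partial_deriv i f) x"
        using C1_on_continuous_partial[OF f] S continuous_on_eq_continuous_at by blast
      then have "(partial_deriv i f \<longlongrightarrow> partial_deriv i f x) (nhds x)"
        using tendsto_at_iff_tendsto_nhds[of "partial_deriv i f" x] by (simp add: isCont_def)
      then show "\<forall>\<^sub>F y in nhds x. dist (partial_deriv i f y) (partial_deriv i f x) < e'"
        using e' by (rule tendstoD)
    qed simp
    then obtain d where d: "d > 0" and
      dS: "\<And>y. dist y x < d \<Longrightarrow> y \<in> S" and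
      de: "\<And>y i. dist y x < d \<Longrightarrow> \<bar>partial_deriv i f y - partial_deriv i f x\<bar> < e'"
      unfolding eventually_nhds_metric by (auto simp: dist_real_def)
    have main: "\<bar>f (x + rest A v) - f x - (\<Sum>i\<in>A. v $ i * partial_deriv i f x)\<bar>
        \<le> real (card A) * (e' * norm v)" if v: "norm v < d" for A v
    proof (induction A rule: finite_induct[OF finite])
      case 1
      have "rest {} v = 0" unfolding rest_def by (simp add: vec_eq_iff)
      then show ?case by simp
    next
      case (2 j A)
      define y where "y = x + rest A v"
      have ins: "x + rest (insert j A) v = y + (v $ j) *\<^sub>R axis j 1"
        using 2 unfolding y_def rest_def by (auto simp: vec_eq_iff axis_def)
      have line: "dist (y + t *\<^sub>R axis j 1) x < d" if "\<bar>t\<bar> \<le> \<bar>v $ j\<bar>" for t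
      proof -
        have "norm (rest A v + t *\<^sub>R axis j 1) \<le> norm v"
          using that 2 unfolding rest_def
          by (intro norm_le_componentwise_cart) (auto simp: axis_def)
        then show ?thesis using v unfolding y_def dist_norm by (simp add: add.assoc)
      qed
      have D: "((\<lambda>t. f (y + t *\<^sub>R axis j 1)) has_real_derivative
          partial_deriv j f (y + t *\<^sub>R axis j 1)) (at t)" if "\<bar>t\<bar> \<le> \<bar>v $ j\<bar>" for t
        using C1_on_has_partial_deriv[OF f dS[OF line[OF that]]] has_partial_deriv_line by blast
      \<comment> \<open>After subtraction of the linear term, the derivative in the one remaining
        variable is at most \<open>e'\<close>.\<close>
      have "\<bar>(f (y + (v $ j) *\<^sub>R axis j 1) - (v $ j) * partial_deriv j f x) - (f (y + 0 *\<^sub>R axis j 1) - 0 * partial_deriv j f x)\<bar>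
          \<le> e' * \<bar>v $ j - 0\<bar>"
      proof (rule field_differentiable_bound[of "{-\<bar>v $ j\<bar>..\<bar>v $ j\<bar>}", where f'="\<lambda>t. partial_deriv j f (y + t *\<^sub>R axis j 1) - partial_deriv j f x", unfolded real_norm_def])
        fix t assume "t \<in> {-\<bar>v $ j\<bar>..\<bar>v $ j\<bar>}"
        then have t: "\<bar>t\<bar> \<le> \<bar>v $ j\<bar>" by auto
        show "((\<lambda>t. f (y + t *\<^sub>R axis j 1) - t * partial_deriv j f x) has_real_derivative
            partial_deriv j f (y + t *\<^sub>R axis j 1) - partial_deriv j f x) (at t within {-\<bar>v $ j\<bar>..\<bar>v $ j\<bar>})"
          by (rule DERIV_subset[OF _ subset_UNIV]) (auto intro!: derivative_eq_intros D[OF t])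
        show "\<bar>partial_deriv j f (y + t *\<^sub>R axis j 1) - partial_deriv j f x\<bar> \<le> e'"
          using de[OF line[OF t]] less_imp_le by blast
      qed auto
      also have "\<dots> \<le> e' * norm v" using e' component_le_norm_cart[of v j] by simp
      finally show ?case
        using 2 unfolding ins by (simp add: algebra_simps y_def)
    qed
    have "rest UNIV v = v" for v unfolding rest_def by (simp add: vec_eq_iff)
    then have "\<bar>f (x + v) - f x - (\<Sum>i\<in>UNIV. v $ i * partial_deriv i f x)\<bar> \<le> e * norm v"
      if "norm v < d" for v
      using main[OF that, of UNIV] unfolding e'_def by simp
    then show ?thesis using d by blast
  qed note * = this
  show "((\<lambda>y. ((f y - f x) - (\<Sum>i\<in>UNIV. (y - x) $ i * partial_deriv i f x)) /\<^sub>R norm (y - x)) \<longlongrightarrow> 0) (at x)"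
  proof (rule tendstoI)
    fix e :: real assume "e > 0"
    then obtain d where d: "d > 0" "\<forall>v. norm v < d \<longrightarrow>
      \<bar>f (x + v) - f x - (\<Sum>i\<in>UNIV. v $ i * partial_deriv i f x)\<bar> \<le> (e/2) * norm v"
      using *[of "e/2"] by auto
    have "dist (((f y - f x) - (\<Sum>i\<in>UNIV. (y - x) $ i * partial_deriv i f x)) /\<^sub>R norm (y - x)) 0 < e"
      if "y \<noteq> x" "dist y x < d" for y
    proof -
      have "\<bar>f y - f x - (\<Sum>i\<in>UNIV. (y - x) $ i * partial_deriv i f x)\<bar> \<le> (e/2) * norm (y - x)"
        using d(2)[rule_format, of "y - x"] that by (simp add: dist_norm)
      also have "\<dots> < e * norm (y - x)" using \<open>e > 0\<close> that by simp
      finally show ?thesis using that by (simp add: field_simps)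
    qed
    then show "\<forall>\<^sub>F y in at x. dist (((f y - f x) - (\<Sum>i\<in>UNIV. (y - x) $ i * partial_deriv i f x)) /\<^sub>R norm (y - x)) 0 < e"
      unfolding eventually_at using d(1) by blast
  qed
qed

lemma C1_on_continuous: "C1_on S f \<Longrightarrow> open S \<Longrightarrow> continuous_on S f"
  by (meson C1_on_has_derivative continuous_at_imp_continuous_on has_derivative_continuous)

lemma C1_on_line_derivative:
  assumes f: "C1_on S f" and S: "open S" "x + s *\<^sub>R v \<in> S"
  shows "((\<lambda>s. f (x + s *\<^sub>R v)) has_real_derivative
    (\<Sum>i\<in>UNIV. v $ i * partial_deriv i f (x + s *\<^sub>R v))) (at s)"
proof -
  have "((\<lambda>s. x + s *\<^sub>R v) has_derivative (\<lambda>t. t *\<^sub>R v)) (at s)"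
    by (auto intro!: derivative_eq_intros)
  from has_derivative_compose[OF this C1_on_has_derivative[OF f S]]
  show ?thesis unfolding has_field_derivative_def
    by (rule has_derivative_eq_rhs) (simp add: fun_eq_iff sum_distrib_left sum_distrib_right mult_ac)
qed

section \<open>Harmonic functions\<close>

lemma lborel_integral_translation:
  fixes f :: "'a::euclidean_space \<Rightarrow> real"
  assumes [measurable]: "f \<in> borel_measurable borel"
  shows "(LINT x|lborel. f (v + x)) = (LINT x|lborel. f x)"
proof -
  have "(LINT x|lborel. f x) = (LINT x|density (distr lborel borel (\<lambda>x. v + 1 *\<^sub>R x)) (\<lambda>_. \<bar>1::real\<bar>^DIM('a)). f x)"
    by (rule arg_cong2[where f="integral\<^sup>L"]) (rule lborel_affine, simp_all)
  also have "\<dots> = (LINT x|distr lborel borel (\<lambda>x. v + x). f x)"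
    by (simp add: density_1)
  also have "\<dots> = (LINT x|lborel. f (v + x))"
    by (subst integral_distr) auto
  finally show ?thesis by simp
qed

lemma continuous_on_extend_zero:
  fixes f :: "'a::topological_space \<Rightarrow> 'b::{topological_space,zero}"
  assumes "open S" "closed K" "K \<subseteq> S" "continuous_on S f" "\<And>x. x \<notin> K \<Longrightarrow> f x = 0"
  shows "continuous_on UNIV f"
proof -
  have "continuous_on (- K) f"
    by (rule continuous_on_eq[of _ "\<lambda>_. 0"]) (auto simp: assms)
  then have "continuous_on (S \<union> - K) f"
    using assms by (intro continuous_on_open_Un) auto
  then show ?thesis using \<open>K \<subseteq> S\<close> by (metis Compl_partition2 Un_UNIV_right sup.order_iff sup_assoc Un_commute)
qed

text \<open>Difference quotients of a compactly supported function have integral zero by translation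
  invariance, and dominated convergence hands this on to the derivative.\<close>

proposition integral_partial_deriv_eq_zero:
  fixes f :: "real^'n::finite \<Rightarrow> real"
  assumes S: "open S" "compact K" "K \<subseteq> S"
    and f: "continuous_on S f" and g: "continuous_on S g"
    and fg: "\<And>x. x \<in> S \<Longrightarrow> has_partial_deriv f i x (g x)"
    and f0: "\<And>x. x \<notin> K \<Longrightarrow> f x = 0" and g0: "\<And>x. x \<notin> K \<Longrightarrow> g x = 0"
  shows "integrable lborel g" "integral\<^sup>L lborel g = 0"
proof -
  have clK: "closed K" using S compact_imp_closed by blast
  have contf: "continuous_on UNIV f" and contg: "continuous_on UNIV g"
    using continuous_on_extend_zero[OF S(1) clK S(3)] f g f0 g0 by blast+
  have [measurable]: "f \<in> borel_measurable borel" "g \<in> borel_measurable borel"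
    using contf contg by (auto intro: borel_measurable_continuous_onI)
  have fg': "has_partial_deriv f i x (g x)" for x
  proof (cases "x \<in> S")
    case False
    then have "x \<in> - K" using S by auto
    then show ?thesis
      using has_partial_deriv_cong[OF _ \<open>x \<in> - K\<close>, of f "\<lambda>_. 0" i 0]
        has_partial_deriv_const[of 0 i x] clK f0 g0 by (simp add: open_Compl)
  qed (rule fg)
  obtain M where M: "M > 0" "\<And>x. x \<in> K \<Longrightarrow> norm (g x) \<le> M"
    using compact_imp_bounded[OF compact_continuous_image[OF continuous_on_subset[OF g S(3)] S(2)]]
    unfolding bounded_pos by auto
  have M': "\<bar>g x\<bar> \<le> M" for x using M g0[of x] by (cases "x \<in> K") auto
  obtain R where R: "K \<subseteq> cball 0 R"
    using compact_imp_bounded[OF S(2)] unfolding bounded_iff by (auto simp: subset_iff)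
  \<comment> \<open>The dominating function: the mean value theorem bounds every quotient by
    \<open>M\<close>, and shifts by at most 1 enlarge the support by at most 1.\<close>
  define w where "w x = M * indicator (cball 0 (R+1)) x" for x :: "real^'n"
  have w: "integrable lborel w"
    unfolding w_def using emeasure_bounded_finite[of "cball (0::real^'n) (R+1)"]
    by (intro integrable_mult_right integrable_real_indicator) auto
  define h where "h n = inverse (real (Suc n))" for n
  have h: "h n > 0" "h n \<le> 1" for n unfolding h_def by (auto simp: field_simps)
  define s where "s n x = (f (h n *\<^sub>R axis i 1 + x) - f x) / h n" for n x
  have [measurable]: "s n \<in> borel_measurable borel" for n
    unfolding s_def by (intro borel_measurable_divide borel_measurable_diff) 
      (auto intro!: borel_measurable_continuous_onI continuous_on_compose2[OF contf] continuous_intros)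
  have lim: "(\<lambda>n. s n x) \<longlonglongrightarrow> g x" for x
  proof -
    have "(\<lambda>t. (f (x + t *\<^sub>R axis i 1) - f x) / t) \<midarrow>0\<rightarrow> g x"
      using fg'[of x] unfolding has_partial_deriv_def DERIV_def by simp
    moreover have "filterlim h (at 0) sequentially"
      unfolding filterlim_at h_def using LIMSEQ_inverse_real_of_nat by auto
    ultimately have "(\<lambda>n. (f (x + h n *\<^sub>R axis i 1) - f x) / h n) \<longlonglongrightarrow> g x"
      by (rule filterlim_compose)
    then show ?thesis unfolding s_def by (simp add: add.commute)
  qed
  have bound: "norm (s n x) \<le> w x" for n x
  proof (cases "x \<in> K \<or> x + h n *\<^sub>R axis i 1 \<in> K")
    case True
    have "norm x \<le> R + 1"
    proof (rule disjE[OF True])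
      assume "x + h n *\<^sub>R axis i 1 \<in> K"
      then have "norm (x + h n *\<^sub>R axis i 1) \<le> R" using R by auto
      moreover have "norm (h n *\<^sub>R (axis i 1 :: real^'n)) \<le> 1" using h[of n] by simp
      ultimately show ?thesis
        using norm_triangle_ineq4[of "x + h n *\<^sub>R axis i 1" "h n *\<^sub>R axis i 1"] by simp
    qed (use R in auto)
    have "\<bar>f (x + h n *\<^sub>R axis i 1) - f (x + 0 *\<^sub>R axis i 1)\<bar> \<le> M * \<bar>h n - 0\<bar>"
      by (rule field_differentiable_bound[where S=UNIV and f'="\<lambda>t. g (x + t *\<^sub>R axis i 1)", unfolded real_norm_def])
        (use fg'[unfolded has_partial_deriv_line] fg' M' in \<open>auto simp: has_partial_deriv_line[symmetric]\<close>)
    then have "norm (s n x) \<le> M"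
      using h[of n] unfolding s_def by (simp add: add.commute pos_divide_le_eq)
    then show ?thesis using \<open>norm x \<le> R + 1\<close> unfolding w_def by simp
  next
    case False
    then have "s n x = 0" unfolding s_def by (simp add: f0 add.commute)
    then show ?thesis using M unfolding w_def by simp
  qed
  have s0: "integral\<^sup>L lborel (s n) = 0" for n
  proof -
    have intf: "integrable lborel f"
    proof -
      obtain B where B: "\<And>x. x \<in> K \<Longrightarrow> norm (f x) \<le> B"
        using compact_imp_bounded[OF compact_continuous_image[OF continuous_on_subset[OF f S(3)] S(2)]]
        unfolding bounded_pos by auto
      have "integrable lborel (\<lambda>x. B * indicator K x)"
        using emeasure_compact_finite[OF S(2)] clK by (intro integrable_mult_right integrable_real_indicator) auto
      then show ?thesis
        by (rule Bochner_Integration.integrable_bound) (auto simp: indicator_def f0 intro!: AE_I2 order_trans[OF B[unfolded real_norm_def]])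
    qed
    have intf': "integrable lborel (\<lambda>x. f (h n *\<^sub>R axis i 1 + x))"
    proof -
      have "integrable (density (distr lborel borel (\<lambda>x. h n *\<^sub>R axis i 1 + 1 *\<^sub>R x)) (\<lambda>_. \<bar>1::real\<bar>^DIM(real^'n))) f"
        using intf by (subst lborel_affine[symmetric]) auto
      then show ?thesis by (simp add: density_1 integrable_distr_eq)
    qed
    have "integral\<^sup>L lborel (s n) = ((LINT x|lborel. f (h n *\<^sub>R axis i 1 + x)) - (LINT x|lborel. f x)) / h n"
      unfolding s_def using intf intf' by simp
    then show ?thesis by (simp add: lborel_integral_translation)
  qed
  note dc = integral_dominated_convergence[of g lborel s w, OF _ _ w AE_I2[OF lim] AE_I2[OF bound]]
  have "(\<lambda>n. integral\<^sup>L lborel (s n)) \<longlonglongrightarrow> integral\<^sup>L lborel g" using dc by auto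
  then show "integral\<^sup>L lborel g = 0" using s0 by (simp add: LIMSEQ_const_iff)
  show "integrable lborel g"
    using integrable_dominated_convergence[of g lborel s w, OF _ _ w AE_I2[OF lim] AE_I2[OF bound]] by auto
qed

lemma integral_cbox_partial_deriv_eq_zero:
  fixes f :: "real^'n::finite \<Rightarrow> real"
  assumes "open S" "compact K" "K \<subseteq> S" "K \<subseteq> cbox a b"
    and "continuous_on S f" "continuous_on S g"
    and "\<And>x. x \<in> S \<Longrightarrow> has_partial_deriv f i x (g x)"
    and f0: "\<And>x. x \<notin> K \<Longrightarrow> f x = 0" and g0: "\<And>x. x \<notin> K \<Longrightarrow> g x = 0"
  shows "integral (cbox a b) g = 0"
proof -
  have "(g has_integral 0) UNIV"
    using integral_partial_deriv_eq_zero[OF assms(1-3,5-9)] has_integral_integral_lborel by force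
  moreover have "(\<lambda>x. if x \<in> cbox a b then g x else 0) = g"
    using g0 assms(4) by (auto simp: fun_eq_iff)
  ultimately have "(g has_integral 0) (cbox a b)"
    using has_integral_restrict_UNIV[of "cbox a b" g 0] by simp
  then show ?thesis by (rule integral_unique)
qed

section \<open>Polynomial weights and the mean value property\<close>

definition bump :: "real^'n::finite \<Rightarrow> real" where
  "bump y = max 0 (1 - (norm y)\<^sup>2)"

text \<open>Averages run over a cube, so that differentiation under the integral and affine
  substitution can use the rules for boxes. The radii \<open>\<rho> * real CARD('n)\<close> below
  come from the crude l1 bound on the norm in this cube.\<close>

abbreviation unit_cube :: "(real^'n::finite) set" where
  "unit_cube \<equiv> cbox (- One) One"

lemma DERIV_max_zero_power:
  "((\<lambda>t::real. max 0 t ^ Suc (Suc k)) has_real_derivative real (Suc (Suc k)) * max 0 t ^ Suc k) (at t)"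
proof -
  consider "t > 0" | "t < 0" | "t = 0" by linarith
  then show ?thesis
  proof cases
    case 1
    have "((\<lambda>t::real. t ^ Suc (Suc k)) has_real_derivative real (Suc (Suc k)) * t ^ Suc k) (at t)"
      by (rule DERIV_cong[OF DERIV_pow]) simp
    then have "((\<lambda>t::real. t ^ Suc (Suc k)) has_real_derivative real (Suc (Suc k)) * max 0 t ^ Suc k) (at t)"
      using 1 by (simp add: max_def)
    then show ?thesis
      by (rule has_field_derivative_transform_within_open[where S="{0<..}"]) (use 1 in auto)
  next
    case 2
    have "((\<lambda>t::real. 0) has_real_derivative real (Suc (Suc k)) * max 0 t ^ Suc k) (at t)"
      using 2 by (simp add: max_def)
    then show ?thesis
      by (rule has_field_derivative_transform_within_open[where S="{..<0}"]) (use 2 in auto)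
  next
    case 3
    have "((\<lambda>h::real. max 0 h ^ Suc k) \<longlongrightarrow> max 0 0 ^ Suc k) (at 0)"
      by (intro tendsto_intros)
    moreover have "\<forall>\<^sub>F h in at (0::real). max 0 h ^ Suc k = max 0 h ^ Suc (Suc k) / h"
      by (rule eventually_at_filter[THEN iffD2, OF always_eventually]) (auto simp: max_def)
    ultimately have "((\<lambda>h::real. max 0 h ^ Suc (Suc k) / h) \<longlongrightarrow> 0) (at 0)"
      by (simp add: tendsto_cong)
    then show ?thesis using 3 unfolding DERIV_def by simp
  qed
qed

lemma continuous_on_bump [continuous_intros]:
  "continuous_on A f \<Longrightarrow> continuous_on A (\<lambda>x. bump (f x))"
  unfolding bump_def by (intro continuous_intros)

lemma bump_bounds: "0 \<le> bump y" "bump y \<le> 1"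
  unfolding bump_def by auto

lemma bump_outside: "y \<notin> cball 0 1 \<Longrightarrow> bump y = 0"
proof -
  assume "y \<notin> cball 0 1"
  then have "1\<^sup>2 \<le> (norm y)\<^sup>2" by (intro power_mono) auto
  then show ?thesis unfolding bump_def by simp
qed

text \<open>Each differentiation yields y times the previous power, so y * bump and y * bump^2 are
  gradients up to a factor. This makes the integrations by parts below explicit.\<close>

lemma has_partial_deriv_bump_power:
  "has_partial_deriv (\<lambda>y. bump y ^ Suc (Suc k)) i y (- 2 * real (Suc (Suc k)) * y $ i * bump y ^ Suc k)"
proof -
  have "has_partial_deriv (\<lambda>y. 1 - (norm (y - 0))\<^sup>2) i y (0 - 2 * (y $ i - 0 $ i))"
    by (intro has_partial_deriv_diff has_partial_deriv_const has_partial_deriv_dist2)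
  from has_partial_deriv_compose[OF DERIV_max_zero_power this, of k]
  show ?thesis unfolding bump_def by (simp add: algebra_simps)
qed

lemma norm_unit_cube:
  assumes "y \<in> (unit_cube :: (real^'n::finite) set)"
  shows "norm y \<le> real CARD('n)"
proof -
  have "norm y \<le> (\<Sum>b\<in>Basis. \<bar>y \<bullet> b\<bar>)" by (rule norm_le_l1)
  also have "\<dots> \<le> (\<Sum>b\<in>(Basis::(real^'n) set). 1)"
    using assms by (intro sum_mono) (auto simp: mem_box abs_le_iff)
  finally show ?thesis by simp
qed

lemma cball_subset_unit_cube: "cball 0 1 \<subseteq> (unit_cube :: (real^'n::finite) set)"
proof
  fix y :: "real^'n" assume "y \<in> cball 0 1"
  then have "\<bar>y \<bullet> b\<bar> \<le> 1" if "b \<in> Basis" for b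
    using Basis_le_norm[OF that, of y] by auto
  then show "y \<in> unit_cube" by (force simp: mem_box abs_le_iff)
qed

lemma scaled_cube_subset:
  fixes x :: "real^'n::finite"
  assumes "cball x (\<rho> * real CARD('n)) \<subseteq> S" "\<bar>s\<bar> \<le> \<rho>" "y \<in> unit_cube"
  shows "x + s *\<^sub>R y \<in> S"
proof -
  have "norm (s *\<^sub>R y) \<le> \<rho> * real CARD('n)"
    using norm_unit_cube[OF assms(3)] assms(2) by (auto intro: mult_mono)
  then show ?thesis using assms(1) by (auto simp: subset_iff dist_norm)
qed

text \<open>The normalization of the weight \<open>bump\<^sup>2\<close>; the type argument records
  that it depends on the dimension alone.\<close>

definition bump_mass :: "'n::finite itself \<Rightarrow> real" where
  "bump_mass _ = integral (unit_cube :: (real^'n) set) (\<lambda>y. (bump y)\<^sup>2)"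

lemma bump_mass_pos: "bump_mass TYPE('n::finite) > 0"
proof -
  have 0: "((\<lambda>y. (bump y)\<^sup>2) has_integral bump_mass TYPE('n)) (unit_cube :: (real^'n) set)"
    unfolding bump_mass_def
    by (intro integrable_integral integrable_continuous continuous_intros)
  then have "bump_mass TYPE('n) \<ge> 0" by (rule has_integral_nonneg) auto
  moreover have "bump_mass TYPE('n) \<noteq> 0"
  proof
    assume "bump_mass TYPE('n) = 0"
    with 0 have "((\<lambda>y. (bump y)\<^sup>2) has_integral 0) (unit_cube :: (real^'n) set)" by simp
    then have "(bump (0::real^'n))\<^sup>2 = 0"
      by (rule has_integral_0_cbox_imp_0[rotated 2]) (auto intro!: continuous_intros simp: mem_box box_ne_empty)
    then show False unfolding bump_def by simp
  qed
  ultimately show ?thesis by simp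
qed

text \<open>The mean \<open>M s\<close> over the ball of radius \<open>s\<close> with weight \<open>bump\<^sup>2\<close> is constant in \<open>s\<close>, because
  \<open>y * bump\<^sup>2\<close> is a gradient and an integration by parts turns \<open>M'\<close> into an integral of the Laplacian.\<close>

proposition harmonic_mean_value:
  fixes f :: "real^'n::finite \<Rightarrow> real"
  assumes S: "open S" and f: "C2_on S f" and harm: "\<And>x. x \<in> S \<Longrightarrow> laplacian f x = 0"
    and \<rho>: "\<rho> \<ge> 0" "cball x (\<rho> * real CARD('n)) \<subseteq> S"
  shows "integral unit_cube (\<lambda>y. f (x + \<rho> *\<^sub>R y) * (bump y)\<^sup>2) = bump_mass TYPE('n) * f x"
proof -
  define Q where "Q = (unit_cube :: (real^'n) set)"
  define M where "M s = integral Q (\<lambda>y. f (x + s *\<^sub>R y) * (bump y)\<^sup>2)" for s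
  define DM where "DM s y = (\<Sum>i\<in>UNIV. y $ i * partial_deriv i f (x + s *\<^sub>R y)) * (bump y)\<^sup>2" for s y
  have inS: "x + s *\<^sub>R y \<in> S" if "s \<in> {0..\<rho>}" "y \<in> Q" for s y
    using scaled_cube_subset[OF \<rho>(2), of s y] that unfolding Q_def by auto
  have contf: "continuous_on S f" and contp: "continuous_on S (partial_deriv i f)"
    and contpp: "continuous_on S (partial_deriv j (partial_deriv i f))" for i j
    using C1_on_continuous[OF _ S] C2_on_C1[OF f] C1_on_continuous_partial by blast+
  have "(M has_real_derivative integral Q (DM s)) (at s within {0..\<rho>})" if s: "s \<in> {0..\<rho>}" for s
    unfolding M_def Q_def
  proof (rule leibniz_rule_field_derivative)
    fix t y assume ty: "t \<in> {0..\<rho>}" "y \<in> (unit_cube :: (real^'n) set)"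
    then have "x + t *\<^sub>R y \<in> S" using inS Q_def by blast
    from DERIV_cmult_right[OF C1_on_line_derivative[OF C2_on_C1(1)[OF f] S this], of "(bump y)\<^sup>2"]
    show "((\<lambda>s. f (x + s *\<^sub>R y) * (bump y)\<^sup>2) has_real_derivative DM t y) (at t within {0..\<rho>})"
      unfolding DM_def by (rule has_field_derivative_at_within)
  next
    fix t assume t: "t \<in> {0..\<rho>}"
    show "(\<lambda>y. f (x + t *\<^sub>R y) * (bump y)\<^sup>2) integrable_on (unit_cube :: (real^'n) set)"
      using inS[OF t] unfolding Q_def
      by (intro integrable_continuous continuous_intros continuous_on_compose2[OF contf]) auto
  next
    show "continuous_on ({0..\<rho>} \<times> unit_cube) (\<lambda>(t, y). DM t y)"
      unfolding DM_def split_beta using inS unfolding Q_def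
      by (intro continuous_intros continuous_on_compose2[OF contp]) auto
  qed (use s in auto)
  moreover have "integral Q (DM s) = 0" if s: "s \<in> {0..\<rho>}" for s
  proof -
    \<comment> \<open>The i-th derivative of bump^3 is -6 * y_i * bump^2. The \<open>G i\<close>
      therefore sum to s * bump^3 times the Laplacian minus 6 * \<open>DM s\<close>, and harmonicity
      leaves only the last term.\<close>
    define F where "F i y = partial_deriv i f (x + s *\<^sub>R y) * bump y ^ 3" for i y
    define G where "G i y = s * partial_deriv i (partial_deriv i f) (x + s *\<^sub>R y) * bump y ^ 3 +
      (- 6 * y $ i * bump y ^ 2) * partial_deriv i f (x + s *\<^sub>R y)" for i y
    define U where "U = (\<lambda>y. x + s *\<^sub>R y) -` S"
    have U: "open U" unfolding U_def
      by (rule open_vimage[OF S]) (intro continuous_intros)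
    have KU: "cball 0 1 \<subseteq> U" using inS[OF s] cball_subset_unit_cube unfolding U_def Q_def by auto
    have contG: "continuous_on U (G i)" for i
      unfolding G_def U_def
      by (intro continuous_intros continuous_on_compose2[OF contp] continuous_on_compose2[OF contpp]) auto
    have G0: "integral Q (G i) = 0" for i
      unfolding Q_def
    proof (rule integral_cbox_partial_deriv_eq_zero[OF U compact_cball KU cball_subset_unit_cube _ contG])
      show "continuous_on U (F i)"
        unfolding F_def U_def by (intro continuous_intros continuous_on_compose2[OF contp]) auto
      show "has_partial_deriv (F i) i y (G i y)" if "y \<in> U" for y
      proof -
        have "has_partial_deriv (\<lambda>y. partial_deriv i f (x + s *\<^sub>R y)) i y
            (s * partial_deriv i (partial_deriv i f) (x + s *\<^sub>R y))"
          by (rule has_partial_deriv_affine, rule C1_on_has_partial_deriv[OF C2_on_C1(2)[OF f]])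
            (use that U_def in auto)
        moreover have "has_partial_deriv (\<lambda>y. bump y ^ 3) i y (- 6 * y $ i * bump y ^ 2)"
          using has_partial_deriv_bump_power[of 1 i y] by (simp add: numeral_eq_Suc)
        ultimately show ?thesis unfolding F_def G_def by (rule has_partial_deriv_mult)
      qed
    qed (auto simp: F_def G_def bump_outside)
    have GI: "G i integrable_on Q" for i
      unfolding Q_def by (rule integrable_continuous, rule continuous_on_subset[OF contG])
        (use inS[OF s] in \<open>auto simp: U_def Q_def\<close>)
    have "DM s y = - (1/6) * (\<Sum>i\<in>UNIV. G i y)" if "y \<in> Q" for y
    proof -
      have "(\<Sum>i\<in>UNIV. G i y) = s * bump y ^ 3 * laplacian f (x + s *\<^sub>R y) +
        (-6) * (\<Sum>i\<in>UNIV. y $ i * partial_deriv i f (x + s *\<^sub>R y)) * bump y ^ 2"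
        unfolding G_def sum.distrib laplacian_def by (simp add: sum_distrib_left sum_distrib_right mult_ac)
      then show ?thesis using harm[OF inS[OF s that]] unfolding DM_def by simp
    qed
    then have "integral Q (DM s) = integral Q (\<lambda>y. - (1/6) * (\<Sum>i\<in>UNIV. G i y))"
      by (rule integral_cong)
    also have "\<dots> = - (1/6) * (\<Sum>i\<in>UNIV. integral Q (G i))"
      by (simp add: integral_sum GI)
    finally show ?thesis using G0 by simp
  qed
  ultimately have "(M has_real_derivative 0) (at s within {0..\<rho>})" if "s \<in> {0..\<rho>}" for s
    using that by metis
  then obtain c where "\<And>s. s \<in> {0..\<rho>} \<Longrightarrow> M s = c"
    using has_field_derivative_zero_constant[of "{0..\<rho>}" M] by auto
  then have "M \<rho> = M 0" using \<rho>(1) by auto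
  then show ?thesis unfolding M_def Q_def bump_mass_def by (simp add: mult.commute)
qed

section \<open>Smoothness and interior estimates of harmonic functions\<close>

lemma unit_cube_convolution:
  fixes f :: "real^'n::finite \<Rightarrow> real"
  assumes S: "open S" and f: "C1_on S f" and U: "open U"
    and US: "\<And>x y. x \<in> U \<Longrightarrow> y \<in> unit_cube \<Longrightarrow> x + \<rho> *\<^sub>R y \<in> S"
    and \<omega>: "continuous_on unit_cube \<omega>"
  shows "x \<in> U \<Longrightarrow> has_partial_deriv (\<lambda>x. integral unit_cube (\<lambda>y. f (x + \<rho> *\<^sub>R y) * \<omega> y)) i x
      (integral unit_cube (\<lambda>y. partial_deriv i f (x + \<rho> *\<^sub>R y) * \<omega> y))"
    and "continuous_on U (\<lambda>x. integral unit_cube (\<lambda>y. f (x + \<rho> *\<^sub>R y) * \<omega> y))"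
proof -
  have contf: "continuous_on S f" and contp: "continuous_on S (partial_deriv i f)" for i
    using C1_on_continuous[OF f S] C1_on_continuous_partial[OF f] by blast+
  show "continuous_on U (\<lambda>x. integral unit_cube (\<lambda>y. f (x + \<rho> *\<^sub>R y) * \<omega> y))"
    by (rule integral_continuous_on_param, unfold split_beta)
      (intro continuous_intros continuous_on_compose2[OF contf] continuous_on_compose2[OF \<omega>];
        use US in auto)
  assume "x \<in> U"
  have "\<forall>\<^sub>F t in nhds 0. x + t *\<^sub>R axis i 1 \<in> U"
    by (rule eventually_axis_line[OF U \<open>x \<in> U\<close>])
  then obtain e where e: "e > 0" "\<And>t. dist t 0 < e \<Longrightarrow> x + t *\<^sub>R axis i 1 \<in> U"
    unfolding eventually_nhds_metric by blast
  define I where "I = {-e/2..e/2}"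
  have I: "x + t *\<^sub>R axis i 1 \<in> U" if "t \<in> I" for t
    using that e unfolding I_def by (intro e(2)) auto
  have "((\<lambda>t. integral unit_cube (\<lambda>y. f (x + t *\<^sub>R axis i 1 + \<rho> *\<^sub>R y) * \<omega> y)) has_real_derivative
      integral unit_cube (\<lambda>y. partial_deriv i f (x + 0 *\<^sub>R axis i 1 + \<rho> *\<^sub>R y) * \<omega> y)) (at 0 within I)"
  proof (rule leibniz_rule_field_derivative)
    fix t y assume ty: "t \<in> I" "y \<in> (unit_cube :: (real^'n) set)"
    have "has_partial_deriv f i ((x + \<rho> *\<^sub>R y) + t *\<^sub>R axis i 1) (partial_deriv i f (x + t *\<^sub>R axis i 1 + \<rho> *\<^sub>R y))"
      using C1_on_has_partial_deriv[OF f US[OF I[OF ty(1)] ty(2)]] by (simp add: algebra_simps)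
    then have "((\<lambda>t. f (x + t *\<^sub>R axis i 1 + \<rho> *\<^sub>R y)) has_real_derivative
        partial_deriv i f (x + t *\<^sub>R axis i 1 + \<rho> *\<^sub>R y)) (at t)"
      unfolding has_partial_deriv_line by (simp add: algebra_simps)
    then show "((\<lambda>t. f (x + t *\<^sub>R axis i 1 + \<rho> *\<^sub>R y) * \<omega> y) has_real_derivative
        partial_deriv i f (x + t *\<^sub>R axis i 1 + \<rho> *\<^sub>R y) * \<omega> y) (at t within I)"
      by (rule has_field_derivative_at_within[OF DERIV_cmult_right])
  next
    fix t assume "t \<in> I"
    then show "(\<lambda>y. f (x + t *\<^sub>R axis i 1 + \<rho> *\<^sub>R y) * \<omega> y) integrable_on unit_cube"
      by (intro integrable_continuous continuous_intros continuous_on_compose2[OF contf] \<omega>)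
        (use US I in auto)
  next
    show "continuous_on (I \<times> unit_cube) (\<lambda>(t, y). partial_deriv i f (x + t *\<^sub>R axis i 1 + \<rho> *\<^sub>R y) * \<omega> y)"
      unfolding split_beta
      by (intro continuous_intros continuous_on_compose2[OF contp] continuous_on_compose2[OF \<omega>])
        (use US I in auto)
  qed (use e in \<open>auto simp: I_def\<close>)
  moreover have "at 0 within I = at 0"
    using e by (intro at_within_interior) (auto simp: I_def)
  ultimately show "has_partial_deriv (\<lambda>x. integral unit_cube (\<lambda>y. f (x + \<rho> *\<^sub>R y) * \<omega> y)) i x
      (integral unit_cube (\<lambda>y. partial_deriv i f (x + \<rho> *\<^sub>R y) * \<omega> y))"
    unfolding has_partial_deriv_def by simp
qed

text \<open>The mean value formula is differentiated, and the derivative is then moved from f to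
  bump^2, whose i-th derivative is -4 * y_i * bump. Only values of f remain on the right. The
  formula holds on a whole neighbourhood of \<open>x\<close> with the same \<open>\<rho>\<close>, so
  it can be differentiated again.\<close>

lemma harmonic_partial_deriv_formula:
  fixes f :: "real^'n::finite \<Rightarrow> real"
  assumes S: "open S" and f: "C2_on S f" and harm: "\<And>x. x \<in> S \<Longrightarrow> laplacian f x = 0"
    and \<rho>: "\<rho> > 0" "cball x (2 * \<rho> * real CARD('n)) \<subseteq> S" and x': "x' \<in> ball x (\<rho> * real CARD('n))"
  shows "partial_deriv i f x' =
    4 / (\<rho> * bump_mass TYPE('n)) * integral unit_cube (\<lambda>y. f (x' + \<rho> *\<^sub>R y) * (y $ i * bump y))"
proof -
  define U where "U = ball x (\<rho> * real CARD('n))"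
  have cb: "cball w (\<rho> * real CARD('n)) \<subseteq> S" if "w \<in> U" for w
  proof -
    have "dist x y \<le> 2 * \<rho> * real CARD('n)" if "dist w y \<le> \<rho> * real CARD('n)" for y
      using that \<open>w \<in> U\<close> dist_triangle[of x y w] unfolding U_def by (simp add: algebra_simps)
    then have "cball w (\<rho> * real CARD('n)) \<subseteq> cball x (2 * \<rho> * real CARD('n))" by auto
    then show ?thesis using \<rho> by blast
  qed
  have US: "w + \<rho> *\<^sub>R y \<in> S" if "w \<in> U" "y \<in> unit_cube" for w y
    using scaled_cube_subset[OF cb[OF that(1)] _ that(2)] \<rho> by auto
  have mv: "integral unit_cube (\<lambda>y. f (w + \<rho> *\<^sub>R y) * (bump y)\<^sup>2) = bump_mass TYPE('n) * f w" if "w \<in> U" for w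
    using harmonic_mean_value[OF S f harm _ cb[OF that]] \<rho> by auto
  have contp: "continuous_on S (partial_deriv j f)" and contf: "continuous_on S f"
    and contpp: "continuous_on S (partial_deriv k (partial_deriv j f))" for j k
    using C1_on_continuous[OF _ S] C2_on_C1[OF f] C1_on_continuous_partial by blast+
  have x'U: "x' \<in> U" using x' U_def by blast
  have pd1: "has_partial_deriv (\<lambda>x. integral unit_cube (\<lambda>y. f (x + \<rho> *\<^sub>R y) * (bump y)\<^sup>2)) i x'
      (integral unit_cube (\<lambda>y. partial_deriv i f (x' + \<rho> *\<^sub>R y) * (bump y)\<^sup>2))"
    by (rule unit_cube_convolution(1)[OF S C2_on_C1(1)[OF f] _ US _ x'U])
      (auto simp: U_def intro!: continuous_intros)
  have pd2: "has_partial_deriv (\<lambda>x. integral unit_cube (\<lambda>y. f (x + \<rho> *\<^sub>R y) * (bump y)\<^sup>2)) i x'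
      (bump_mass TYPE('n) * partial_deriv i f x')"
    by (rule has_partial_deriv_cong[of U, OF _ x'U mv])
      (use cb[OF x'U] x'U \<rho> in \<open>auto simp: U_def intro!: has_partial_deriv_cmult C1_on_has_partial_deriv[OF C2_on_C1(1)[OF f]]\<close>)
  have 1: "integral unit_cube (\<lambda>y. partial_deriv i f (x' + \<rho> *\<^sub>R y) * (bump y)\<^sup>2) =
      bump_mass TYPE('n) * partial_deriv i f x'"
    using partial_deriv_eqI[OF pd1] partial_deriv_eqI[OF pd2] by simp
  define V where "V = (\<lambda>y. x' + \<rho> *\<^sub>R y) -` S"
  define g1 where "g1 y = partial_deriv i f (x' + \<rho> *\<^sub>R y) * (bump y)\<^sup>2" for y
  define g2 where "g2 y = f (x' + \<rho> *\<^sub>R y) * (y $ i * bump y)" for y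
  have V: "open V" unfolding V_def
    by (rule open_vimage[OF S]) (intro continuous_intros)
  have QV: "unit_cube \<subseteq> V" using US[OF x'U] unfolding V_def by auto
  have cont: "continuous_on V g1" "continuous_on V g2"
    unfolding g1_def g2_def V_def
    by (intro continuous_intros continuous_on_compose2[OF contp] continuous_on_compose2[OF contf]; auto)+
  have I0: "integral unit_cube (\<lambda>y. \<rho> * g1 y - 4 * g2 y) = 0"
  proof (rule integral_cbox_partial_deriv_eq_zero[OF V compact_cball order_trans[OF cball_subset_unit_cube QV] cball_subset_unit_cube])
    show "continuous_on V (\<lambda>y. f (x' + \<rho> *\<^sub>R y) * (bump y)\<^sup>2)"
      unfolding V_def by (intro continuous_intros continuous_on_compose2[OF contf]) auto
    show "continuous_on V (\<lambda>y. \<rho> * g1 y - 4 * g2 y)"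
      by (intro continuous_intros cont)
    fix y assume y: "y \<in> V"
    have 2: "has_partial_deriv (\<lambda>y. f (x' + \<rho> *\<^sub>R y)) i y (\<rho> * partial_deriv i f (x' + \<rho> *\<^sub>R y))"
      by (rule has_partial_deriv_affine, rule C1_on_has_partial_deriv[OF C2_on_C1(1)[OF f]])
        (use y V_def in auto)
    have 3: "has_partial_deriv (\<lambda>y. bump y ^ 2) i y (- 4 * y $ i * bump y)"
      using has_partial_deriv_bump_power[of 0 i y] by (simp add: numeral_eq_Suc)
    show "has_partial_deriv (\<lambda>y. f (x' + \<rho> *\<^sub>R y) * (bump y)\<^sup>2) i y (\<rho> * g1 y - 4 * g2 y)"
      using has_partial_deriv_mult[OF 2 3] unfolding g1_def g2_def by (simp add: mult_ac)
  qed (auto simp: g1_def g2_def bump_outside)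
  have "g1 integrable_on unit_cube" "g2 integrable_on unit_cube"
    using cont[THEN continuous_on_subset, OF QV] by (blast intro: integrable_continuous)+
  then have "((\<lambda>y. \<rho> * g1 y - 4 * g2 y) has_integral (\<rho> * integral unit_cube g1 - 4 * integral unit_cube g2)) unit_cube"
    by (intro has_integral_diff has_integral_mult_right integrable_integral)
  then have "\<rho> * integral unit_cube g1 - 4 * integral unit_cube g2 = 0"
    using I0 by (simp add: integral_unique)
  then have "\<rho> * (bump_mass TYPE('n) * partial_deriv i f x') = 4 * integral unit_cube g2"
    using 1 unfolding g1_def by simp
  then show ?thesis
    using \<rho> bump_mass_pos[where ?'n='n] unfolding g2_def by (simp add: field_simps)
qed

lemma C1_on_local:
  assumes "\<And>x. x \<in> S \<Longrightarrow> \<exists>U. open U \<and> x \<in> U \<and> C1_on U f"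
  shows "C1_on S f"
  unfolding C1_on_def
proof (intro allI conjI ballI)
  fix i x assume "x \<in> S"
  then show "(\<lambda>t. f (x + t *\<^sub>R axis i 1)) differentiable at 0"
    using assms[OF \<open>x \<in> S\<close>] unfolding C1_on_def by blast
next
  fix i
  show "continuous_on S (partial_deriv i f)"
  proof (rule continuous_at_imp_continuous_on, rule ballI)
    fix x assume "x \<in> S"
    then obtain U where "open U" "x \<in> U" "continuous_on U (partial_deriv i f)"
      using assms[OF \<open>x \<in> S\<close>] C1_on_continuous_partial by blast
    then show "isCont (partial_deriv i f) x" using continuous_on_eq_continuous_at by blast
  qed
qed

lemma C2_on_local:
  assumes "\<And>x. x \<in> S \<Longrightarrow> \<exists>U. open U \<and> x \<in> U \<and> C2_on U f"
  shows "C2_on S f"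
proof -
  have "C1_on S f" by (rule C1_on_local) (use assms C2_on_C1(1) in blast)
  moreover have "C1_on S (partial_deriv i f)" for i
    by (rule C1_on_local) (use assms C2_on_C1(2) in blast)
  ultimately show ?thesis unfolding C2_on_def by blast
qed

lemma open_scaled_cball:
  assumes "open (S :: (real^'n::finite) set)" "x \<in> S"
  obtains \<rho> where "\<rho> > 0" "cball x (2 * \<rho> * real CARD('n)) \<subseteq> S"
proof -
  obtain e where e: "e > 0" "cball x e \<subseteq> S" using assms open_contains_cball by blast
  show thesis using e by (intro that[of "e / (2 * real CARD('n))"]) auto
qed

text \<open>A bootstrap from two derivatives to three: locally the first derivative is a weighted
  average of translates of f, so two further derivatives can fall on f under the integral, and the
  Laplacian passes under it as well.\<close>

proposition harmonic_partial_deriv: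
  fixes f :: "real^'n::finite \<Rightarrow> real"
  assumes S: "open S" and f: "C2_on S f" and harm: "\<And>x. x \<in> S \<Longrightarrow> laplacian f x = 0"
  shows "C2_on S (partial_deriv i f)" "x \<in> S \<Longrightarrow> laplacian (partial_deriv i f) x = 0"
proof -
  have *: "\<exists>U. open U \<and> x \<in> U \<and> C2_on U (partial_deriv i f) \<and> laplacian (partial_deriv i f) x = 0"
    if x: "x \<in> S" for x
  proof -
    obtain \<rho> where \<rho>: "\<rho> > 0" "cball x (2 * \<rho> * real CARD('n)) \<subseteq> S"
      using open_scaled_cball[OF S x] .
    define U where "U = ball x (\<rho> * real CARD('n))"
    define k where "k = 4 / (\<rho> * bump_mass TYPE('n))"
    define \<omega> where "\<omega> y = y $ i * bump y" for y :: "real^'n"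
    define F where "F g w = integral unit_cube (\<lambda>y. g (w + \<rho> *\<^sub>R y) * \<omega> y)" for g w
    have xU: "x \<in> U" using \<rho> unfolding U_def by simp
    have US: "w + \<rho> *\<^sub>R y \<in> S" if "w \<in> U" "y \<in> unit_cube" for w y
    proof -
      have "norm (\<rho> *\<^sub>R y) \<le> \<rho> * real CARD('n)" using \<rho> norm_unit_cube[OF that(2)] by simp
      moreover have "dist x (w + \<rho> *\<^sub>R y) \<le> dist x w + norm (\<rho> *\<^sub>R y)"
        by (metis dist_triangle dist_norm add_diff_cancel_left' norm_minus_commute)
      ultimately have "dist x (w + \<rho> *\<^sub>R y) \<le> 2 * \<rho> * real CARD('n)" using that(1) unfolding U_def by simp
      then show ?thesis using \<rho> by auto
    qed
    have \<omega>: "continuous_on unit_cube \<omega>" unfolding \<omega>_def by (intro continuous_intros)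
    have oU: "open U" unfolding U_def by simp
    have eq: "partial_deriv i f w = k * F f w" if "w \<in> U" for w
      using harmonic_partial_deriv_formula[OF S f harm \<rho> that[unfolded U_def]] unfolding k_def F_def \<omega>_def .
    have D: "has_partial_deriv (\<lambda>w. k * F g w) j w (k * F (partial_deriv j g) w)"
      if "C1_on S g" "w \<in> U" for g j w
      unfolding F_def by (rule has_partial_deriv_cmult, rule unit_cube_convolution(1)[OF S that(1) oU US \<omega> that(2)])
    have C: "continuous_on U (\<lambda>w. k * F (partial_deriv j g) w)" if "C1_on S g" for g j
      unfolding F_def
      by (rule continuous_on_mult_left, rule integral_continuous_on_param, unfold split_beta)
        (intro continuous_intros continuous_on_compose2[OF C1_on_continuous_partial[OF that]] continuous_on_compose2[OF \<omega>];
        use US in auto)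
    note C2 = C2_onI[OF oU has_partial_deriv_cong[OF oU _ eq D[OF C2_on_C1(1)[OF f]]]
        D[OF C2_on_C1(2)[OF f]] C[OF C2_on_C1(1)[OF f]] C[OF C2_on_C1(2)[OF f]]]
    have "laplacian (partial_deriv i f) x = (\<Sum>j\<in>UNIV. k * F (partial_deriv j (partial_deriv j f)) x)"
      unfolding laplacian_def using xU by (intro sum.cong refl C2(2))
    also have "\<dots> = k * integral unit_cube (\<lambda>y. \<Sum>j\<in>UNIV. partial_deriv j (partial_deriv j f) (x + \<rho> *\<^sub>R y) * \<omega> y)"
      unfolding F_def sum_distrib_left[symmetric]
      by (subst integral_sum)
       (auto intro!: integrable_continuous continuous_intros \<omega> continuous_on_compose2[OF C1_on_continuous_partial[OF C2_on_C1(2)[OF f]]] US xU)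
    also have "integral unit_cube (\<lambda>y. \<Sum>j\<in>UNIV. partial_deriv j (partial_deriv j f) (x + \<rho> *\<^sub>R y) * \<omega> y) =
        integral unit_cube (\<lambda>y::real^'n. 0)"
      using harm[OF US[OF xU]] unfolding laplacian_def sum_distrib_right[symmetric]
      by (intro integral_cong) simp
    finally have "laplacian (partial_deriv i f) x = 0" by simp
    then show ?thesis by (intro exI[of _ U] conjI oU xU C2(1))
  qed
  show "C2_on S (partial_deriv i f)" by (rule C2_on_local) (use * in blast)
  assume "x \<in> S"
  then show "laplacian (partial_deriv i f) x = 0" using *[of x] by blast
qed

text \<open>The factor 4 and the mass come from \<open>harmonic_partial_deriv_formula\<close>. The
  weight there is at most 1 in absolute value on the cube, which leaves the content.\<close>

definition gradient_const :: "'n::finite itself \<Rightarrow> real" where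
  "gradient_const _ = 4 * Henstock_Kurzweil_Integration.content (unit_cube :: (real^'n) set) / bump_mass TYPE('n)"

lemma gradient_const_nonneg: "gradient_const TYPE('n::finite) \<ge> 0"
  unfolding gradient_const_def
  by (rule divide_nonneg_nonneg[OF mult_nonneg_nonneg[OF _ content_pos_le] less_imp_le[OF bump_mass_pos]]) simp

lemma harmonic_gradient_bound:
  fixes f :: "real^'n::finite \<Rightarrow> real"
  assumes S: "open S" and f: "C2_on S f" and harm: "\<And>x. x \<in> S \<Longrightarrow> laplacian f x = 0"
    and \<rho>: "\<rho> > 0" "cball x (2 * \<rho> * real CARD('n)) \<subseteq> S"
    and B: "\<And>y. y \<in> cball x (2 * \<rho> * real CARD('n)) \<Longrightarrow> \<bar>f y\<bar> \<le> B"
  shows "\<bar>partial_deriv i f x\<bar> \<le> gradient_const TYPE('n) * B / \<rho>"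
proof -
  define F where "F = (\<lambda>y. f (x + \<rho> *\<^sub>R y) * (y $ i * bump y))"
  have "B \<ge> 0" using B[of x] \<rho> by auto
  have inB: "x + \<rho> *\<^sub>R y \<in> cball x (2 * \<rho> * real CARD('n))" if "y \<in> unit_cube" for y
    using norm_unit_cube[OF that] \<rho> by (simp add: dist_norm)
  have contf: "continuous_on S f" using C1_on_continuous[OF C2_on_C1(1)[OF f] S] .
  have "norm (F y) \<le> B" if y: "y \<in> unit_cube" for y
  proof -
    have "(axis i 1 :: real^'n) \<in> Basis" by (simp add: axis_in_Basis_iff)
    then have "-1 \<le> y \<bullet> axis i 1 \<and> y \<bullet> axis i 1 \<le> 1" using y by (auto simp: mem_box)
    then have "\<bar>y $ i\<bar> \<le> 1" by (auto simp: inner_axis)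
    then have "\<bar>y $ i * bump y\<bar> \<le> 1" using bump_bounds[of y] by (simp add: abs_mult mult_le_one)
    then show ?thesis
      unfolding F_def using B[OF inB[OF y]] \<open>B \<ge> 0\<close> mult_mono[of "\<bar>f (x + \<rho> *\<^sub>R y)\<bar>" B "\<bar>y $ i * bump y\<bar>" 1]
      by (simp add: abs_mult)
  qed
  moreover have "F integrable_on unit_cube"
    unfolding F_def using inB \<rho> by (intro integrable_continuous continuous_intros continuous_on_compose2[OF contf]) auto
  ultimately have "norm (integral unit_cube F) \<le> B * Henstock_Kurzweil_Integration.content (unit_cube :: (real^'n) set)"
    using has_integral_bound[OF \<open>B \<ge> 0\<close> integrable_integral] by blast
  moreover have "\<bar>partial_deriv i f x\<bar> = 4 / (\<rho> * bump_mass TYPE('n)) * \<bar>integral unit_cube F\<bar>"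
    using harmonic_partial_deriv_formula[OF S f harm \<rho>, of x i] \<rho> bump_mass_pos[where ?'n='n]
    unfolding F_def by (simp add: abs_mult)
  ultimately show ?thesis
    using \<rho> bump_mass_pos[where ?'n='n] unfolding gradient_const_def by (simp add: field_simps)
qed

text \<open>Jensen's inequality, obtained by expanding the integral of (f(x + rho * y) - f(x))^2 *
  bump^2 \<ge> 0. The weight is then dropped because bump is at most 1.\<close>

lemma harmonic_square_bound:
  fixes f :: "real^'n::finite \<Rightarrow> real"
  assumes S: "open S" and f: "C2_on S f" and harm: "\<And>x. x \<in> S \<Longrightarrow> laplacian f x = 0"
    and \<rho>: "\<rho> > 0" "cball x (\<rho> * real CARD('n)) \<subseteq> S"
  shows "bump_mass TYPE('n) * (f x)\<^sup>2 \<le> integral unit_cube (\<lambda>y. (f (x + \<rho> *\<^sub>R y))\<^sup>2)"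
proof -
  have inS: "x + \<rho> *\<^sub>R y \<in> S" if "y \<in> unit_cube" for y
    using scaled_cube_subset[OF \<rho>(2) _ that] \<rho> by auto
  have contf: "continuous_on S f" using C1_on_continuous[OF C2_on_C1(1)[OF f] S] .
  have int: "(\<lambda>y. f (x + \<rho> *\<^sub>R y) * (bump y)\<^sup>2) integrable_on unit_cube"
    "(\<lambda>y. (f (x + \<rho> *\<^sub>R y))\<^sup>2 * (bump y)\<^sup>2) integrable_on unit_cube"
    "(\<lambda>y. (f (x + \<rho> *\<^sub>R y))\<^sup>2) integrable_on unit_cube"
    "(\<lambda>y. (bump y)\<^sup>2) integrable_on unit_cube"
    using inS by (auto intro!: integrable_continuous continuous_intros continuous_on_compose2[OF contf])
  define J where "J = integral unit_cube (\<lambda>y. (f (x + \<rho> *\<^sub>R y))\<^sup>2 * (bump y)\<^sup>2)"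
  have mv: "integral unit_cube (\<lambda>y. f (x + \<rho> *\<^sub>R y) * (bump y)\<^sup>2) = bump_mass TYPE('n) * f x"
    using harmonic_mean_value[OF S f harm _ \<rho>(2)] \<rho> by auto
  have H: "((\<lambda>y. (f (x + \<rho> *\<^sub>R y))\<^sup>2 * (bump y)\<^sup>2 - (2 * f x) * (f (x + \<rho> *\<^sub>R y) * (bump y)\<^sup>2) + (f x)\<^sup>2 * (bump y)\<^sup>2)
      has_integral (J - (2 * f x) * (bump_mass TYPE('n) * f x) + (f x)\<^sup>2 * bump_mass TYPE('n))) unit_cube"
  proof (intro has_integral_add has_integral_diff has_integral_mult_right)
    show "((\<lambda>y. (f (x + \<rho> *\<^sub>R y))\<^sup>2 * (bump y)\<^sup>2) has_integral J) unit_cube"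
      unfolding J_def by (rule integrable_integral[OF int(2)])
    show "((\<lambda>y. f (x + \<rho> *\<^sub>R y) * (bump y)\<^sup>2) has_integral bump_mass TYPE('n) * f x) unit_cube"
      using integrable_integral[OF int(1)] unfolding mv .
    show "((\<lambda>y. (bump y)\<^sup>2) has_integral bump_mass TYPE('n)) (unit_cube :: (real^'n) set)"
      unfolding bump_mass_def by (rule integrable_integral[OF int(4)])
  qed
  have eq: "(f (x + \<rho> *\<^sub>R y))\<^sup>2 * (bump y)\<^sup>2 - (2 * f x) * (f (x + \<rho> *\<^sub>R y) * (bump y)\<^sup>2) + (f x)\<^sup>2 * (bump y)\<^sup>2
      = (f (x + \<rho> *\<^sub>R y) - f x)\<^sup>2 * (bump y)\<^sup>2" for y
    by (simp add: algebra_simps power2_eq_square)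
  have "0 \<le> J - (2 * f x) * (bump_mass TYPE('n) * f x) + (f x)\<^sup>2 * bump_mass TYPE('n)"
    using has_integral_nonneg[OF H] unfolding eq by simp
  then have "bump_mass TYPE('n) * (f x)\<^sup>2 \<le> J" by (simp add: power2_eq_square algebra_simps)
  also have "J \<le> integral unit_cube (\<lambda>y. (f (x + \<rho> *\<^sub>R y))\<^sup>2)"
    unfolding J_def
    by (rule integral_le[OF int(2,3)]) (auto intro!: mult_left_le power_le_one bump_bounds)
  finally show ?thesis .
qed

text \<open>Rescaling the preceding inequality to the true scale produces the power of
  \<open>\<rho>\<close>; the lower bound \<open>\<eta>\<close> on the weight inserts the weight into
  the integral.\<close>

proposition harmonic_weighted_L2_bound:
  fixes f :: "real^'n::finite \<Rightarrow> real"
  assumes S: "open S" and f: "C2_on S f" and harm: "\<And>x. x \<in> S \<Longrightarrow> laplacian f x = 0"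
    and \<rho>: "\<rho> > 0" "cball x (\<rho> * real CARD('n)) \<subseteq> S"
    and w: "\<And>y. y \<in> S \<Longrightarrow> 0 \<le> w y" "\<And>y. y \<in> cball x (\<rho> * real CARD('n)) \<Longrightarrow> \<eta> \<le> w y" "\<eta> > 0"
    and int: "set_integrable lebesgue S (\<lambda>y. w y * (f y)\<^sup>2)"
  shows "bump_mass TYPE('n) * \<rho> ^ CARD('n) * \<eta> * (f x)\<^sup>2 \<le> (LINT y:S|lebesgue. w y * (f y)\<^sup>2)"
proof -
  define A where "A = (\<lambda>y. x + \<rho> *\<^sub>R y) ` (unit_cube :: (real^'n) set)"
  have inA: "A \<subseteq> cball x (\<rho> * real CARD('n))" "A \<subseteq> S"
    using scaled_cube_subset[OF order_refl, of \<rho> \<rho> _ x] \<rho> unfolding A_def by auto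
  obtain a b where "(\<lambda>y. \<rho> *\<^sub>R y + x) ` (unit_cube :: (real^'n) set) = cbox a b"
    using interval_image_affinity_interval by blast
  then have ab: "A = cbox a b" unfolding A_def by (simp add: add.commute)
  have contf: "continuous_on S f" using C1_on_continuous[OF C2_on_C1(1)[OF f] S] .
  have intA: "(\<lambda>y. (f y)\<^sup>2) integrable_on A"
    unfolding ab using inA ab by (intro integrable_continuous continuous_intros continuous_on_subset[OF contf]) auto
  have abs: "(\<lambda>y. (f y)\<^sup>2) absolutely_integrable_on A"
    using intA by (intro nonnegative_absolutely_integrable_1) auto
  have "((\<lambda>y. (f (\<rho> *\<^sub>R y + x))\<^sup>2) has_integral (1 / (\<bar>\<rho>\<bar> ^ DIM(real^'n))) *\<^sub>R integral A (\<lambda>y. (f y)\<^sup>2))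
      ((\<lambda>y. (1 / \<rho>) *\<^sub>R y + -((1 / \<rho>) *\<^sub>R x)) ` cbox a b)"
    using has_integral_affinity[OF integrable_integral[OF intA[unfolded ab]], of \<rho> x] \<rho> ab by simp
  moreover have "(\<lambda>y. (1 / \<rho>) *\<^sub>R y + -((1 / \<rho>) *\<^sub>R x)) ` cbox a b = unit_cube"
    unfolding ab[symmetric] A_def image_image using \<rho> by (simp add: scaleR_add_right)
  ultimately have "integral unit_cube (\<lambda>y. (f (x + \<rho> *\<^sub>R y))\<^sup>2) = integral A (\<lambda>y. (f y)\<^sup>2) / \<rho> ^ CARD('n)"
    using \<rho> by (auto simp: add.commute dest!: integral_unique)
  then have "bump_mass TYPE('n) * \<rho> ^ CARD('n) * (f x)\<^sup>2 \<le> integral A (\<lambda>y. (f y)\<^sup>2)"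
    using mult_left_mono[OF harmonic_square_bound[OF S f harm \<rho>], of "\<rho> ^ CARD('n)"] \<rho> by (simp add: mult_ac)
  also have "\<dots> = (LINT y:A|lebesgue. (f y)\<^sup>2)"
    using set_lebesgue_integral_eq_integral(2)[OF abs] by simp
  finally have "\<eta> * (bump_mass TYPE('n) * \<rho> ^ CARD('n) * (f x)\<^sup>2) \<le> \<eta> * (LINT y:A|lebesgue. (f y)\<^sup>2)"
    using w by (intro mult_left_mono) auto
  also have "\<dots> = (LINT y:A|lebesgue. \<eta> * (f y)\<^sup>2)" by simp
  also have "\<dots> \<le> (LINT y:S|lebesgue. w y * (f y)\<^sup>2)"
    unfolding set_lebesgue_integral_def
  proof (rule integral_mono)
    show "integrable lebesgue (\<lambda>y. indicat_real A y *\<^sub>R (\<eta> * (f y)\<^sup>2))"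
      using abs set_integrable_mult_right[of \<eta> lebesgue A "\<lambda>y. (f y)\<^sup>2"] unfolding set_integrable_def by blast
    show "integrable lebesgue (\<lambda>y. indicat_real S y *\<^sub>R (w y * (f y)\<^sup>2))"
      using int unfolding set_integrable_def .
    fix y
    show "indicat_real A y *\<^sub>R (\<eta> * (f y)\<^sup>2) \<le> indicat_real S y *\<^sub>R (w y * (f y)\<^sup>2)"
      using w inA by (auto simp: indicator_def intro!: mult_right_mono)
  qed
  finally show ?thesis by (simp add: mult_ac)
qed

section \<open>The maximum principle\<close>

lemma partial_deriv_diff:
  assumes "C1_on S f" "C1_on S g" "x \<in> S"
  shows "partial_deriv i (\<lambda>y. f y - g y) x = partial_deriv i f x - partial_deriv i g x"
  by (rule partial_deriv_eqI) (intro has_partial_deriv_diff C1_on_has_partial_deriv[OF _ assms(3)] assms)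

lemma C2_on_diff:
  assumes S: "open S" and f: "C2_on S f" "C2_on S g"
  shows "C2_on S (\<lambda>y. f y - g y)"
    and "x \<in> S \<Longrightarrow> partial_deriv j (partial_deriv i (\<lambda>y. f y - g y)) x =
      partial_deriv j (partial_deriv i f) x - partial_deriv j (partial_deriv i g) x"
    and "x \<in> S \<Longrightarrow> laplacian (\<lambda>y. f y - g y) x = laplacian f x - laplacian g x"
proof -
  note C1 = C2_on_C1[OF f(1)] C2_on_C1[OF f(2)]
  note D = has_partial_deriv_diff[OF C1(1)[THEN C1_on_has_partial_deriv] C1(3)[THEN C1_on_has_partial_deriv]]
    has_partial_deriv_diff[OF C1(2)[THEN C1_on_has_partial_deriv] C1(4)[THEN C1_on_has_partial_deriv]]
  note C = continuous_on_diff[OF C1(1)[THEN C1_on_continuous_partial] C1(3)[THEN C1_on_continuous_partial]]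
    continuous_on_diff[OF C1(2)[THEN C1_on_continuous_partial] C1(4)[THEN C1_on_continuous_partial]]
  note C2 = C2_onI[OF S D C]
  show "C2_on S (\<lambda>y. f y - g y)" by (rule C2(1))
  show 2: "partial_deriv j (partial_deriv i (\<lambda>y. f y - g y)) x =
      partial_deriv j (partial_deriv i f) x - partial_deriv j (partial_deriv i g) x" if "x \<in> S" for i j x
    by (rule C2(2)[OF _ _ _ _ that])
  show "x \<in> S \<Longrightarrow> laplacian (\<lambda>y. f y - g y) x = laplacian f x - laplacian g x"
    unfolding laplacian_def using 2 by (simp add: sum_subtractf)
qed

lemma C2_on_quadratic:
  fixes c :: "real^'n::finite" and a k :: real
  defines "q \<equiv> (\<lambda>x. k * ((norm (x - c))\<^sup>2 - a))"
  shows "C2_on UNIV q" "partial_deriv i q x = 2 * k * (x $ i - c $ i)"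
    "laplacian q x = 2 * k * real CARD('n)"
proof -
  have D: "has_partial_deriv q i x (k * (2 * (x $ i - c $ i) - 0))" for i x
    unfolding q_def by (intro has_partial_deriv_cmult has_partial_deriv_diff has_partial_deriv_dist2 has_partial_deriv_const)
  have DD: "has_partial_deriv (\<lambda>x. k * (2 * (x $ i - c $ i) - 0)) j x
      (k * (2 * ((if j = i then 1 else 0) - 0) - 0))" for i j x
    by (intro has_partial_deriv_cmult has_partial_deriv_diff has_partial_deriv_nth has_partial_deriv_const)
  note C2 = C2_onI[OF open_UNIV D DD]
  show "C2_on UNIV q" by (rule C2(1)) (intro continuous_intros)+
  have "partial_deriv i (partial_deriv i q) x = 2 * k" for i
    using C2(2)[of x i i] by (simp add: continuous_intros)
  then show "laplacian q x = 2 * k * real CARD('n)" unfolding laplacian_def by simp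
  show "partial_deriv i q x = 2 * k * (x $ i - c $ i)"
    using partial_deriv_eqI[OF D, of i x] by simp
qed

text \<open>The comparison function for the exterior spheres. For K, b > 0 it increases with |x -
  c|, and its Laplacian is negative where 2 * b * |x - c|^2 > N.\<close>

lemma C2_on_gaussian:
  fixes c :: "real^'n::finite" and A K b :: real
  defines "E \<equiv> (\<lambda>x. K * (A - exp (- b * (norm (x - c))\<^sup>2)))"
  shows "C2_on UNIV E"
    "laplacian E x = - K * (4 * b\<^sup>2 * (norm (x - c))\<^sup>2 - 2 * b * real CARD('n)) * exp (- b * (norm (x - c))\<^sup>2)"
proof -
  define e where "e x = exp (- b * (norm (x - c))\<^sup>2)" for x
  have e: "has_partial_deriv e i x (e x * (- b * (2 * (x $ i - c $ i))))" for i x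
    unfolding e_def
    by (intro has_partial_deriv_compose[where g=exp] DERIV_exp has_partial_deriv_cmult has_partial_deriv_dist2)
  have D: "has_partial_deriv E i x (K * (0 - e x * (- b * (2 * (x $ i - c $ i)))))" for i x
    unfolding E_def e_def[symmetric]
    by (intro has_partial_deriv_cmult has_partial_deriv_diff e has_partial_deriv_const)
  have DD: "has_partial_deriv (\<lambda>x. K * (0 - e x * (- b * (2 * (x $ i - c $ i))))) j x
      (K * (0 - ((e x * (- b * (2 * (x $ j - c $ j)))) * (- b * (2 * (x $ i - c $ i))) +
        (- b * (2 * ((if j = i then 1 else 0) - 0))) * e x)))" for i j x
    by (intro has_partial_deriv_cmult has_partial_deriv_diff has_partial_deriv_mult e has_partial_deriv_nth has_partial_deriv_const)
  note C2 = C2_onI[OF open_UNIV D DD]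
  have cont: "continuous_on UNIV e" unfolding e_def by (intro continuous_intros)
  show "C2_on UNIV E" by (rule C2(1)) (intro continuous_intros cont)+
  have "partial_deriv i (partial_deriv i E) x = - K * e x * (4 * b\<^sup>2 * (x $ i - c $ i)\<^sup>2 - 2 * b)" for i
    using C2(2)[of x i i] by (simp add: continuous_intros cont) (simp add: algebra_simps power2_eq_square)
  then have "laplacian E x = - K * e x * (4 * b\<^sup>2 * (\<Sum>i\<in>UNIV. (x $ i - c $ i)\<^sup>2) - 2 * b * real CARD('n))"
    unfolding laplacian_def by (simp add: sum_distrib_left sum_subtractf right_diff_distrib sum_negf mult_ac)
  also have "(\<Sum>i\<in>UNIV. (x $ i - c $ i)\<^sup>2) = (norm (x - c))\<^sup>2"
    unfolding power2_norm_eq_inner inner_vec_def by (simp add: power2_eq_square)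
  finally show "laplacian E x = - K * (4 * b\<^sup>2 * (norm (x - c))\<^sup>2 - 2 * b * real CARD('n)) * exp (- b * (norm (x - c))\<^sup>2)"
    unfolding e_def by simp
qed

text \<open>At an interior maximum a positive Laplacian forces some pure second derivative to be
  positive while the first derivative vanishes, so the function would grow along that axis.
  Strictness costs only constants: the comparison functions below leave a margin in their
  Laplacians.\<close>

proposition maximum_principle:
  fixes v :: "real^'n::finite \<Rightarrow> real"
  assumes S: "open S" "bounded S" and v: "C2_on S v" "continuous_on (closure S) v"
    and lap: "\<And>x. x \<in> S \<Longrightarrow> laplacian v x > 0"
    and bdry: "\<And>x. x \<in> frontier S \<Longrightarrow> v x \<le> 0" and x: "x \<in> closure S"
  shows "v x \<le> 0"
proof (rule ccontr)
  assume "\<not> v x \<le> 0"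
  moreover obtain y where y: "y \<in> closure S" "\<And>w. w \<in> closure S \<Longrightarrow> v w \<le> v y"
    using continuous_attains_sup[of "closure S" v] S v x by (metis compact_closure empty_iff)
  ultimately have "v y > 0" using x by (meson not_le_imp_less order_less_le_trans)
  then have yS: "y \<in> S"
    using bdry[of y] y(1) S(1) by (force simp: frontier_def interior_open)
  then have "(\<Sum>i\<in>UNIV. partial_deriv i (partial_deriv i v) y) > 0"
    using lap unfolding laplacian_def by blast
  then obtain i where i: "partial_deriv i (partial_deriv i v) y > 0"
    by (metis not_less sum_nonpos)
  define g where "g t = v (y + t *\<^sub>R axis i 1)" for t
  define g' where "g' t = partial_deriv i v (y + t *\<^sub>R axis i 1)" for t
  have "\<forall>\<^sub>F t in nhds 0. y + t *\<^sub>R axis i 1 \<in> S"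
    by (rule eventually_axis_line[OF S(1) yS])
  then obtain e where e: "e > 0" "\<And>t. dist t 0 < e \<Longrightarrow> y + t *\<^sub>R axis i 1 \<in> S"
    unfolding eventually_nhds_metric by blast
  have g: "(g has_real_derivative g' t) (at t)" if "\<bar>t\<bar> < e" for t
    using C1_on_has_partial_deriv[OF C2_on_C1(1)[OF v(1)], of "y + t *\<^sub>R axis i 1" i] e(2)[of t] that
    unfolding g_def g'_def has_partial_deriv_line by auto
  have "g' 0 = 0"
  proof (rule DERIV_local_max[OF g \<open>e > 0\<close>])
    show "\<forall>t. \<bar>0 - t\<bar> < e \<longrightarrow> g t \<le> g 0"
      using e(2) y(2) closure_subset unfolding g_def by force
  qed (use e in auto)
  have "(g' has_real_derivative partial_deriv i (partial_deriv i v) y) (at 0)"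
    using C1_on_has_partial_deriv[OF C2_on_C1(2)[OF v(1)] yS, of i i]
    unfolding g'_def has_partial_deriv_def .
  from DERIV_pos_inc_right[OF this i] obtain d where
    d: "d > 0" "\<And>h. 0 < h \<Longrightarrow> h < d \<Longrightarrow> g' 0 < g' h" by auto
  define s where "s = min d e / 2"
  have s: "0 < s" "s < d" "s < e" using d e unfolding s_def by auto
  have "g 0 < g s"
  proof (rule DERIV_pos_imp_increasing_open[OF s(1)])
    fix t assume "0 < t" "t < s"
    then show "\<exists>y. DERIV g t :> y \<and> y > 0"
      using g[of t] d(2)[of t] s \<open>g' 0 = 0\<close> by auto
  next
    show "continuous_on {0..s} g"
      by (rule continuous_at_imp_continuous_on) (use g[THEN DERIV_isCont] s in auto)
  qed
  moreover have "g s \<le> g 0"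
    using y(2) e(2)[of s] s closure_subset unfolding g_def by force
  ultimately show False by simp
qed

section \<open>Domains with interior and exterior spheres\<close>

lemma boundary_dist_triangle: "boundary_dist \<Omega> x \<le> boundary_dist \<Omega> y + dist x y"
  unfolding boundary_dist_def by (rule infdist_triangle)

locale regular_domain =
  fixes \<Omega> :: "(real^'n::finite) set" and r\<^sub>i r\<^sub>e d :: real
  assumes open_dom: "open \<Omega>" and connected_dom: "connected \<Omega>" and bounded_dom: "bounded \<Omega>"
    and nonempty_dom: "\<Omega> \<noteq> {}"
    and interior_sphere: "interior_sphere_condition \<Omega> r\<^sub>i"
    and exterior_sphere: "exterior_sphere_condition \<Omega> r\<^sub>e"
    and diameter_dom: "diameter \<Omega> = d"
begin

lemma radii_pos: "r\<^sub>i > 0" "r\<^sub>e > 0"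
  using interior_sphere exterior_sphere
  unfolding interior_sphere_condition_def exterior_sphere_condition_def by auto

lemma frontier_nonempty: "frontier \<Omega> \<noteq> {}"
  using frontier_not_empty[OF nonempty_dom] bounded_dom not_bounded_UNIV by metis

lemma dist_le_diameter: "x \<in> closure \<Omega> \<Longrightarrow> y \<in> closure \<Omega> \<Longrightarrow> dist x y \<le> d"
  using diameter_bounded_bound[of "closure \<Omega>" x y] bounded_dom diameter_closure[OF bounded_dom] diameter_dom
  by (simp add: bounded_closure)

lemma frontier_subset_closure: "frontier \<Omega> \<subseteq> closure \<Omega>"
  unfolding frontier_def by auto

lemma nearest_boundary_point:
  obtains p where "p \<in> frontier \<Omega>" "dist x p = boundary_dist \<Omega> x"
  using infdist_attains_inf[OF frontier_closed frontier_nonempty, of x]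
  unfolding boundary_dist_def by metis

lemma boundary_dist_le: "p \<in> frontier \<Omega> \<Longrightarrow> boundary_dist \<Omega> x \<le> dist x p"
  unfolding boundary_dist_def by (rule infdist_le)

lemma boundary_dist_nonneg: "boundary_dist \<Omega> x \<ge> 0"
  unfolding boundary_dist_def by (rule infdist_nonneg)

lemma boundary_dist_pos: "x \<in> \<Omega> \<Longrightarrow> boundary_dist \<Omega> x > 0"
proof -
  assume x: "x \<in> \<Omega>"
  obtain p where "p \<in> frontier \<Omega>" "dist x p = boundary_dist \<Omega> x" by (rule nearest_boundary_point)
  moreover have "x \<noteq> p" using x calculation open_dom by (auto simp: frontier_def interior_open)
  ultimately show ?thesis by (metis zero_less_dist_iff)
qed

lemma boundary_dist_le_diameter: "x \<in> \<Omega> \<Longrightarrow> boundary_dist \<Omega> x \<le> d"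
  using nearest_boundary_point dist_le_diameter frontier_subset_closure closure_subset
  by (metis subsetD)

text \<open>A ball is connected, so it would have to meet the frontier on its way out of
  \<open>\<Omega>\<close>.\<close>

lemma ball_boundary_dist: "x \<in> \<Omega> \<Longrightarrow> ball x (boundary_dist \<Omega> x) \<subseteq> \<Omega>"
proof (rule ccontr)
  assume x: "x \<in> \<Omega>" and "\<not> ball x (boundary_dist \<Omega> x) \<subseteq> \<Omega>"
  then have "ball x (boundary_dist \<Omega> x) \<inter> frontier \<Omega> \<noteq> {}"
    using boundary_dist_pos[OF x] centre_in_ball[of x "boundary_dist \<Omega> x"]
    by (intro connected_Int_frontier connected_ball) blast+
  then obtain p where "p \<in> frontier \<Omega>" "dist x p < boundary_dist \<Omega> x" by auto
  then show False using boundary_dist_le[of p x] by auto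
qed

lemma cball_boundary_dist: "x \<in> \<Omega> \<Longrightarrow> s < boundary_dist \<Omega> x \<Longrightarrow> cball x s \<subseteq> \<Omega>"
  using ball_boundary_dist[of x] by (auto simp: subset_iff)

lemma boundary_dist_ge_of_ball:
  assumes "ball c s \<subseteq> \<Omega>"
  shows "s \<le> boundary_dist \<Omega> c"
proof -
  obtain p where p: "p \<in> frontier \<Omega>" "dist c p = boundary_dist \<Omega> c" by (rule nearest_boundary_point)
  then have "p \<notin> \<Omega>" using open_dom by (auto simp: frontier_def interior_open)
  then show ?thesis using p assms by (metis mem_ball not_le_imp_less subsetD)
qed

lemma exterior_center:
  assumes "p \<in> frontier \<Omega>"
  obtains c where "dist p c = r\<^sub>e" "\<And>x. x \<in> closure \<Omega> \<Longrightarrow> r\<^sub>e \<le> dist x c"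
proof -
  obtain c where c: "ball c r\<^sub>e \<subseteq> - closure \<Omega>" "closure (ball c r\<^sub>e) \<inter> frontier \<Omega> = {p}"
    using exterior_sphere assms unfolding exterior_sphere_condition_def by blast
  have far: "r\<^sub>e \<le> dist x c" if "x \<in> closure \<Omega>" for x
  proof (rule ccontr)
    assume "\<not> r\<^sub>e \<le> dist x c"
    then have "x \<in> ball c r\<^sub>e" by (simp add: dist_commute)
    then show False using c that by auto
  qed
  moreover have "dist p c \<le> r\<^sub>e"
    using c(2) radii_pos by (auto simp: dist_commute)
  ultimately show thesis
    using that[of c] assms frontier_subset_closure by (meson antisym subsetD)
qed

lemma exterior_dist_ball:
  assumes e: "\<And>x. x \<in> closure \<Omega> \<Longrightarrow> r\<^sub>e \<le> dist x e" and s: "0 < s" and b: "ball x s \<subseteq> \<Omega>"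
  shows "s + r\<^sub>e \<le> dist x e"
proof -
  have disj: "ball x s \<inter> ball e r\<^sub>e = {}"
  proof -
    have "y \<notin> ball e r\<^sub>e" if "y \<in> ball x s" for y
    proof -
      have "y \<in> closure \<Omega>" using that b closure_subset by blast
      then show ?thesis using e[of y] by (simp add: dist_commute)
    qed
    then show ?thesis by blast
  qed
  show ?thesis
  proof (rule ccontr)
    assume lt: "\<not> s + r\<^sub>e \<le> dist x e"
    define D where "D = dist x e"
    \<comment> \<open>\<open>y\<close> divides the segment from \<open>x\<close> to \<open>e\<close>
      in the ratio of the two radii. If the centers were closer than the sum of the radii,
      \<open>y\<close> would lie in both balls.\<close>
    define y where "y = x + (s / (s + r\<^sub>e)) *\<^sub>R (e - x)"
    have D: "D < s + r\<^sub>e" using lt D_def by simp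
    have "dist x y = s / (s + r\<^sub>e) * D"
      unfolding y_def D_def dist_norm using s radii_pos by (simp add: norm_minus_commute)
    also have "\<dots> < s"
      using mult_strict_right_mono[OF D s] s radii_pos by (simp add: field_simps)
    finally have 1: "dist x y < s" .
    have "e - y = (1 - s / (s + r\<^sub>e)) *\<^sub>R (e - x)" unfolding y_def by (simp add: algebra_simps)
    then have "e - y = (r\<^sub>e / (s + r\<^sub>e)) *\<^sub>R (e - x)" using s radii_pos by (simp add: field_simps)
    then have "dist e y = r\<^sub>e / (s + r\<^sub>e) * D"
      unfolding D_def dist_norm using s radii_pos by (simp add: norm_minus_commute)
    also have "\<dots> < r\<^sub>e"
      using mult_strict_right_mono[OF D radii_pos(2)] s radii_pos by (simp add: field_simps)
    finally show False using 1 disj by auto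
  qed
qed

text \<open>An interior ball at \<open>p\<close> and the exterior ball at \<open>p\<close> are disjoint and touch at \<open>p\<close>, so equality
  holds in the triangle inequality and the center of the interior ball lies on the normal.\<close>

lemma interior_normal:
  assumes "p \<in> frontier \<Omega>"
  obtains \<nu> where "norm \<nu> = 1" "ball (p + r\<^sub>i *\<^sub>R \<nu>) r\<^sub>i \<subseteq> \<Omega>"
    "\<And>x s. 0 < s \<Longrightarrow> ball x s \<subseteq> \<Omega> \<Longrightarrow> dist x p = s \<Longrightarrow> x = p + s *\<^sub>R \<nu>"
proof -
  obtain e where e: "dist p e = r\<^sub>e" "\<And>x. x \<in> closure \<Omega> \<Longrightarrow> r\<^sub>e \<le> dist x e"
    using exterior_center[OF assms] by metis
  define \<nu> where "\<nu> = (1 / r\<^sub>e) *\<^sub>R (p - e)"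
  have pe: "norm (p - e) = r\<^sub>e" using e(1) by (simp add: dist_norm)
  have normal: "norm \<nu> = 1" unfolding \<nu>_def using pe radii_pos by simp
  have *: "x = p + s *\<^sub>R \<nu>" if s: "0 < s" and b: "ball x s \<subseteq> \<Omega>" and xp: "dist x p = s" for x s
  proof -
    have "s + r\<^sub>e \<le> dist x e" by (rule exterior_dist_ball[OF e(2) s b])
    moreover have "dist x e \<le> dist x p + dist p e" by (rule dist_triangle)
    ultimately have "norm ((x - p) + (p - e)) = norm (x - p) + norm (p - e)"
      using xp e(1) by (simp add: dist_norm)
    then have "norm (x - p) *\<^sub>R (p - e) = norm (p - e) *\<^sub>R (x - p)"
      using norm_triangle_eq by blast
    then have "s *\<^sub>R (p - e) = r\<^sub>e *\<^sub>R (x - p)" using pe xp by (simp add: dist_norm)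
    then have "(1 / r\<^sub>e) *\<^sub>R (s *\<^sub>R (p - e)) = x - p" using radii_pos by simp
    then show ?thesis unfolding \<nu>_def by (simp add: algebra_simps)
  qed
  obtain c where c: "ball c r\<^sub>i \<subseteq> \<Omega>" "closure (ball c r\<^sub>i) \<inter> frontier \<Omega> = {p}"
    using interior_sphere assms unfolding interior_sphere_condition_def by blast
  have "p \<in> cball c r\<^sub>i" using c(2) radii_pos by auto
  moreover have "p \<notin> \<Omega>" using assms open_dom by (auto simp: frontier_def interior_open)
  ultimately have "dist c p = r\<^sub>i" using c(1) by (force simp: subset_iff)
  then have "c = p + r\<^sub>i *\<^sub>R \<nu>" using * c radii_pos by blast
  then show thesis using that[OF normal _ *] c by blast
qed

lemma normal_point_in_domain:
  assumes "norm \<nu> = 1" "ball (p + r *\<^sub>R \<nu>) r \<subseteq> \<Omega>" "0 < t" "t \<le> r"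
  shows "ball (p + t *\<^sub>R \<nu>) t \<subseteq> \<Omega>"
proof -
  have "ball (p + t *\<^sub>R \<nu>) t \<subseteq> ball (p + r *\<^sub>R \<nu>) r"
  proof
    fix y assume y: "y \<in> ball (p + t *\<^sub>R \<nu>) t"
    have "dist (p + r *\<^sub>R \<nu>) (p + t *\<^sub>R \<nu>) = norm ((r - t) *\<^sub>R \<nu>)"
      unfolding dist_norm by (simp add: algebra_simps)
    then have "dist (p + r *\<^sub>R \<nu>) (p + t *\<^sub>R \<nu>) = r - t" using assms by simp
    then show "y \<in> ball (p + r *\<^sub>R \<nu>) r"
      using y dist_triangle[of "p + r *\<^sub>R \<nu>" y "p + t *\<^sub>R \<nu>"] by simp
  qed
  then show ?thesis using assms by blast
qed

text \<open>The largest ball around \<open>x\<close> inside \<open>\<Omega>\<close> touches the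
  frontier at a nearest point p. By the uniqueness in \<open>interior_normal\<close>,
  \<open>x\<close> lies on the normal at p, and \<open>c\<close> is the point of that normal at
  depth \<open>r\<close>.\<close>

lemma near_boundary_point:
  assumes "x \<in> \<Omega>" "boundary_dist \<Omega> x < r" "r \<le> r\<^sub>i"
  obtains c where "ball c r \<subseteq> \<Omega>" "dist x c = r - boundary_dist \<Omega> x"
proof -
  define s where "s = boundary_dist \<Omega> x"
  obtain p where p: "p \<in> frontier \<Omega>" "dist x p = s"
    unfolding s_def by (rule nearest_boundary_point)
  obtain \<nu> where \<nu>: "norm \<nu> = 1" "ball (p + r\<^sub>i *\<^sub>R \<nu>) r\<^sub>i \<subseteq> \<Omega>"
    "\<And>x s. 0 < s \<Longrightarrow> ball x s \<subseteq> \<Omega> \<Longrightarrow> dist x p = s \<Longrightarrow> x = p + s *\<^sub>R \<nu>"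
    using interior_normal[OF p(1)] by metis
  have s: "0 < s" "s < r" using assms boundary_dist_pos unfolding s_def by auto
  have x: "x = p + s *\<^sub>R \<nu>"
    using \<nu>(3)[OF s(1) _ p(2)] ball_boundary_dist[OF assms(1)] unfolding s_def by blast
  have "ball (p + r *\<^sub>R \<nu>) r \<subseteq> \<Omega>"
    using normal_point_in_domain[OF \<nu>(1,2)] s assms by auto
  moreover have "dist x (p + r *\<^sub>R \<nu>) = norm ((r - s) *\<^sub>R \<nu>)"
    unfolding x dist_norm by (simp add: algebra_simps norm_minus_commute)
  ultimately show thesis using that s \<nu>(1) unfolding s_def by force
qed

end

section \<open>The torsion function near the boundary\<close>

locale torsion_domain = regular_domain +
  fixes u :: "real^'n::finite \<Rightarrow> real"
  assumes torsion: "torsion_solution \<Omega> u"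
begin

lemma C2_u: "C2_on \<Omega> u" and continuous_u: "continuous_on (closure \<Omega>) u"
  and laplacian_u: "x \<in> \<Omega> \<Longrightarrow> laplacian u x = real CARD('n)"
  and u_frontier: "x \<in> frontier \<Omega> \<Longrightarrow> u x = 0"
  using torsion unfolding torsion_solution_def by auto

lemma u_nonpos: "x \<in> closure \<Omega> \<Longrightarrow> u x \<le> 0"
  by (rule maximum_principle[OF open_dom bounded_dom C2_u continuous_u])
    (auto simp: laplacian_u u_frontier)

text \<open>The comparison quadratic has Laplacian N/2, half of that of u, which gives the maximum
  principle its strict inequality. The bound is linear in the distance to the sphere because s^2 -
  t^2 \<ge> s * (s - t) for 0 \<le> t \<le> s.\<close>

lemma u_upper_ball:
  assumes "ball c s \<subseteq> \<Omega>" "x \<in> ball c s"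
  shows "s * (s - dist x c) / 4 \<le> - u x"
proof -
  have s: "s > 0" using assms(2) by (metis ball_eq_empty empty_iff not_le)
  define q where "q = (\<lambda>x. (1/4) * ((norm (x - c))\<^sup>2 - s\<^sup>2))"
  note q = C2_on_quadratic[where k="1/4" and c=c and a="s\<^sup>2", folded q_def]
  have clo: "closure (ball c s) \<subseteq> closure \<Omega>" using assms(1) by (rule closure_mono)
  have "u x - q x \<le> 0"
  proof (rule maximum_principle[OF open_ball bounded_ball])
    show "C2_on (ball c s) (\<lambda>x. u x - q x)"
      by (rule C2_on_diff(1)[OF open_ball C2_on_subset[OF C2_u assms(1)] C2_on_subset[OF q(1) subset_UNIV]])
    show "continuous_on (closure (ball c s)) (\<lambda>x. u x - q x)"
      unfolding q_def by (intro continuous_intros continuous_on_subset[OF continuous_u clo])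
    show "x \<in> closure (ball c s)" using assms(2) closure_subset by blast
  next
    fix y assume y: "y \<in> ball c s"
    have "laplacian (\<lambda>x. u x - q x) y = laplacian u y - laplacian q y"
      by (rule C2_on_diff(3)[OF open_ball C2_on_subset[OF C2_u assms(1)] C2_on_subset[OF q(1) subset_UNIV] y])
    then show "laplacian (\<lambda>x. u x - q x) y > 0" using laplacian_u assms(1) y q(3) by auto
  next
    fix y assume y: "y \<in> frontier (ball c s)"
    then have "norm (y - c) = s" using s by (simp add: dist_norm norm_minus_commute)
    then show "u y - q y \<le> 0"
      using u_nonpos[of y] y clo unfolding q_def by (auto simp: frontier_def)
  qed
  moreover have "s * (s - dist x c) \<le> s\<^sup>2 - (norm (x - c))\<^sup>2"
  proof -
    have "0 \<le> norm (x - c) * (s - norm (x - c))"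
      using assms(2) by (intro mult_nonneg_nonneg) (auto simp: dist_norm norm_minus_commute)
    then show ?thesis by (simp add: dist_norm algebra_simps power2_eq_square)
  qed
  ultimately show ?thesis unfolding q_def by simp
qed

text \<open>A Hopf-type bound. Near the boundary, \<open>x\<close> has distance
  \<open>boundary_dist \<Omega> x\<close> from the sphere of the ball given by
  \<open>near_boundary_point\<close>. Elsewhere the largest ball around \<open>x\<close> serves, its
  radius being at least \<open>r\<^sub>i\<close>.\<close>

lemma boundary_dist_le_u:
  assumes "x \<in> \<Omega>"
  shows "r\<^sub>i / 4 * boundary_dist \<Omega> x \<le> - u x"
proof (cases "boundary_dist \<Omega> x < r\<^sub>i")
  case True
  obtain c where c: "ball c r\<^sub>i \<subseteq> \<Omega>" "dist x c = r\<^sub>i - boundary_dist \<Omega> x"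
    by (rule near_boundary_point[OF assms True order_refl])
  then have "x \<in> ball c r\<^sub>i" using boundary_dist_pos[OF assms] by (simp add: dist_commute)
  from u_upper_ball[OF c(1) this] show ?thesis using c(2) by simp
next
  case False
  have 1: "boundary_dist \<Omega> x * r\<^sub>i \<le> boundary_dist \<Omega> x * boundary_dist \<Omega> x"
    using False boundary_dist_nonneg by (intro mult_left_mono) auto
  have "boundary_dist \<Omega> x * boundary_dist \<Omega> x / 4 \<le> - u x"
    using u_upper_ball[OF ball_boundary_dist[OF assms], of x] boundary_dist_pos[OF assms] by simp
  moreover have "r\<^sub>i / 4 * boundary_dist \<Omega> x = boundary_dist \<Omega> x * r\<^sub>i / 4" by (simp add: mult.commute)
  ultimately show ?thesis using 1 by linarith
qed

text \<open>The slope bound exp(b * R^2) * 2 * R of the barrier in \<open>u_lower\<close>, where R =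
  \<open>r\<^sub>e + d\<close> and b = N / \<open>r\<^sub>e\<^sup>2\<close>.\<close>

definition barrier_const :: real where
  "barrier_const = 2 * (r\<^sub>e + d) * exp (real CARD('n) / r\<^sub>e\<^sup>2 * (r\<^sub>e + d)\<^sup>2)"

lemma diameter_nonneg: "d \<ge> 0"
  using diameter_ge_0[OF bounded_dom] diameter_dom by simp

lemma barrier_const_pos: "barrier_const > 0"
  unfolding barrier_const_def using diameter_nonneg radii_pos by (intro mult_pos_pos) auto

text \<open>The barrier vanishes on the exterior sphere at a nearest point p and is nonnegative on
  the rest of the closure, so it dominates -u. Its value at \<open>x\<close> is controlled by the
  distance of \<open>x\<close> to that sphere, which is at most the distance to p.\<close>

lemma u_lower:
  assumes "x \<in> \<Omega>"
  shows "- u x \<le> barrier_const * boundary_dist \<Omega> x"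
proof -
  obtain p where p: "p \<in> frontier \<Omega>" "dist x p = boundary_dist \<Omega> x"
    by (rule nearest_boundary_point)
  obtain c where c: "dist p c = r\<^sub>e" "\<And>x. x \<in> closure \<Omega> \<Longrightarrow> r\<^sub>e \<le> dist x c"
    using exterior_center[OF p(1)] by metis
  define N where "N = real CARD('n)"
  \<comment> \<open>Outside the exterior ball this gives b * |y - c|^2 \<ge> N, so the Laplacian of
    the Gaussian has a definite sign on all of \<open>\<Omega>\<close>.\<close>
  define b where "b = N / r\<^sub>e\<^sup>2"
  define R where "R = r\<^sub>e + d"
  have N: "N > 0" unfolding N_def by simp
  have b: "b > 0" unfolding b_def using N radii_pos by simp
  have R: "R > 0" unfolding R_def using diameter_nonneg radii_pos by simp
  \<comment> \<open>Normalized so that the Laplacian of the barrier is at most -2 * N, strictly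
    below the value -N for -u.\<close>
  define K where "K = exp (b * R\<^sup>2) / b"
  have K: "K > 0" unfolding K_def using b by simp
  define w where "w = (\<lambda>x. K * (exp (- b * r\<^sub>e\<^sup>2) - exp (- b * (norm (x - c))\<^sup>2)))"
  note w = C2_on_gaussian[of K "exp (- b * r\<^sub>e\<^sup>2)" b c, folded w_def N_def]
  have near: "norm (y - c) \<le> R" if "y \<in> closure \<Omega>" for y
  proof -
    have "dist y p \<le> d" using that p(1) frontier_subset_closure by (intro dist_le_diameter) auto
    then show ?thesis using c(1) dist_triangle[of y c p] unfolding R_def by (simp add: dist_norm)
  qed
  have far: "r\<^sub>e\<^sup>2 \<le> (norm (y - c))\<^sup>2" if "y \<in> closure \<Omega>" for y
    using c(2)[OF that] radii_pos by (intro power_mono) (auto simp: dist_norm)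
  have bN: "b * r\<^sub>e\<^sup>2 = N" unfolding b_def using radii_pos by simp
  have "(0 - u x) - w x \<le> 0"
  proof (rule maximum_principle[OF open_dom bounded_dom])
    have C0: "C2_on \<Omega> (\<lambda>x::real^'n. 0::real)"
      by (rule C2_onI(1)[OF open_dom has_partial_deriv_const has_partial_deriv_const]) auto
    have C1: "C2_on \<Omega> (\<lambda>x. 0 - u x)" by (rule C2_on_diff(1)[OF open_dom C0 C2_u])
    have Cw: "C2_on \<Omega> w" by (rule C2_on_subset[OF w(1) subset_UNIV])
    show "C2_on \<Omega> (\<lambda>x. (0 - u x) - w x)" by (rule C2_on_diff(1)[OF open_dom C1 Cw])
    show "continuous_on (closure \<Omega>) (\<lambda>x. (0 - u x) - w x)"
      unfolding w_def by (intro continuous_intros continuous_u)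
    show "x \<in> closure \<Omega>" using assms closure_subset by blast
    fix y assume y: "y \<in> \<Omega>"
    then have ycl: "y \<in> closure \<Omega>" using closure_subset by blast
    have "laplacian (\<lambda>x. (0 - u x) - w x) y = (laplacian (\<lambda>x. 0) y - laplacian u y) - laplacian w y"
      using C2_on_diff(3)[OF open_dom C1 Cw y] C2_on_diff(3)[OF open_dom C0 C2_u y] by simp
    moreover have "laplacian (\<lambda>x::real^'n. 0::real) y = 0"
      unfolding laplacian_def partial_deriv_def by simp
    moreover have "laplacian w y \<le> - 2 * N"
    proof -
      have "b * N = b * (b * r\<^sub>e\<^sup>2)" using bN by simp
      also have "\<dots> \<le> b * (b * (norm (y - c))\<^sup>2)" using far[OF ycl] b by (intro mult_left_mono) auto
      finally have 1: "2 * b * N \<le> 4 * b\<^sup>2 * (norm (y - c))\<^sup>2 - 2 * b * N"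
        by (simp add: power2_eq_square algebra_simps)
      have "exp (b * R\<^sup>2) * exp (- b * (norm (y - c))\<^sup>2) \<ge> 1"
      proof -
        have "(norm (y - c))\<^sup>2 \<le> R\<^sup>2" using near[OF ycl] by (intro power_mono) auto
        then have "b * (norm (y - c))\<^sup>2 \<le> b * R\<^sup>2" using b by (intro mult_left_mono) auto
        then show ?thesis unfolding exp_add[symmetric] by simp
      qed
      then have 2: "1 \<le> K * b * exp (- b * (norm (y - c))\<^sup>2)" unfolding K_def using b by simp
      have "2 * N * 1 \<le> 2 * N * (K * b * exp (- b * (norm (y - c))\<^sup>2))"
        using 2 N by (intro mult_left_mono) auto
      also have "\<dots> = K * (2 * b * N) * exp (- b * (norm (y - c))\<^sup>2)" by (simp add: mult_ac)
      also have "\<dots> \<le> K * (4 * b\<^sup>2 * (norm (y - c))\<^sup>2 - 2 * b * N) * exp (- b * (norm (y - c))\<^sup>2)"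
        using 1 K by (intro mult_right_mono mult_left_mono) auto
      finally show ?thesis unfolding w(2) by simp
    qed
    ultimately show "laplacian (\<lambda>x. (0 - u x) - w x) y > 0" using laplacian_u[OF y] N unfolding N_def by linarith
  next
    fix y assume y: "y \<in> frontier \<Omega>"
    then have "b * r\<^sub>e\<^sup>2 \<le> b * (norm (y - c))\<^sup>2"
      using far frontier_subset_closure b by (intro mult_left_mono) auto
    then show "0 - u y - w y \<le> 0" unfolding w_def using K u_frontier[OF y] by simp
  qed
  then have "- u x \<le> w x" by simp
  also have "w x \<le> K * (b * ((norm (x - c))\<^sup>2 - r\<^sub>e\<^sup>2))"
    unfolding w_def
  proof (rule mult_left_mono)
    define s where "s = b * ((norm (x - c))\<^sup>2 - r\<^sub>e\<^sup>2)"
    have s: "s \<ge> 0" 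
      unfolding s_def using b far[of x] assms closure_subset[of \<Omega>] by (intro mult_nonneg_nonneg) auto
    have "exp (- b * (norm (x - c))\<^sup>2) = exp (- b * r\<^sub>e\<^sup>2) * exp (- s)"
      unfolding s_def exp_add[symmetric] by (simp add: algebra_simps)
    then have "exp (- b * r\<^sub>e\<^sup>2) - exp (- b * (norm (x - c))\<^sup>2) = exp (- b * r\<^sub>e\<^sup>2) * (1 - exp (- s))"
      by (simp add: algebra_simps)
    also have "\<dots> \<le> 1 * s"
      using exp_ge_add_one_self[of "-s"] s b by (intro mult_mono) auto
    finally show "exp (- b * r\<^sub>e\<^sup>2) - exp (- b * (norm (x - c))\<^sup>2) \<le> b * ((norm (x - c))\<^sup>2 - r\<^sub>e\<^sup>2)"
      unfolding s_def by simp
  qed (use K in auto)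
  also have "\<dots> = exp (b * R\<^sup>2) * ((norm (x - c) + r\<^sub>e) * (norm (x - c) - r\<^sub>e))"
    unfolding K_def using b by (simp add: power2_eq_square algebra_simps)
  also have "\<dots> \<le> exp (b * R\<^sup>2) * ((2 * R) * boundary_dist \<Omega> x)"
  proof (intro mult_left_mono mult_mono)
    have xcl: "x \<in> closure \<Omega>" using assms closure_subset by blast
    show "norm (x - c) + r\<^sub>e \<le> 2 * R" using near[OF xcl] diameter_nonneg unfolding R_def by simp
    show "norm (x - c) - r\<^sub>e \<le> boundary_dist \<Omega> x"
      using dist_triangle[of x c p] p(2) c(1) by (simp add: dist_norm)
    show "0 \<le> norm (x - c) - r\<^sub>e" using c(2)[OF xcl] by (simp add: dist_norm)
  qed (use R in auto)
  finally show ?thesis unfolding barrier_const_def b_def R_def N_def by (simp add: mult_ac)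
qed

definition lipschitz_const :: real where
  "lipschitz_const = gradient_const TYPE('n) * (4 * real CARD('n) * (3 / 2 * barrier_const + d))"

lemma lipschitz_const_nonneg: "lipschitz_const \<ge> 0"
  unfolding lipschitz_const_def
  using gradient_const_nonneg[where ?'n='n] barrier_const_pos diameter_nonneg by (intro mult_nonneg_nonneg) auto

text \<open>Subtracting |y - x|^2 / 2 produces a harmonic function with the same gradient at
  \<open>x\<close>. On the ball of radius D / 2 it is bounded by a constant times D, and the
  interior gradient bound divides by a multiple of D, so the bound does not degenerate at the
  boundary.\<close>

lemma gradient_u_bound:
  assumes x: "x \<in> \<Omega>"
  shows "\<bar>partial_deriv i u x\<bar> \<le> lipschitz_const"
proof -
  define D where "D = boundary_dist \<Omega> x"
  define \<rho> where "\<rho> = D / (4 * real CARD('n))"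
  have D: "0 < D" "D \<le> d" unfolding D_def using boundary_dist_pos[OF x] boundary_dist_le_diameter[OF x] by auto
  have \<rho>: "\<rho> > 0" "2 * \<rho> * real CARD('n) = D / 2" unfolding \<rho>_def using D by auto
  define q where "q = (\<lambda>y. (1/2) * ((norm (y - x))\<^sup>2 - 0))"
  note q = C2_on_quadratic[where k="1/2" and c=x and a=0, folded q_def]
  have Cq: "C2_on \<Omega> q" by (rule C2_on_subset[OF q(1) subset_UNIV])
  have cb: "cball x (D / 2) \<subseteq> \<Omega>" by (rule cball_boundary_dist[OF x]) (use D in \<open>auto simp: D_def\<close>)
  have "\<bar>partial_deriv i (\<lambda>y. u y - q y) x\<bar>
      \<le> gradient_const TYPE('n) * (D * (3 / 2 * barrier_const + d)) / \<rho>"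
  proof (rule harmonic_gradient_bound[OF open_dom C2_on_diff(1)[OF open_dom C2_u Cq] _ \<rho>(1)], unfold \<rho>(2))
    show "laplacian (\<lambda>y. u y - q y) y = 0" if "y \<in> \<Omega>" for y
      using C2_on_diff(3)[OF open_dom C2_u Cq that] laplacian_u[OF that] q(3) by simp
    show "cball x (D / 2) \<subseteq> \<Omega>" by (rule cb)
    fix y assume y: "y \<in> cball x (D / 2)"
    then have y\<Omega>: "y \<in> \<Omega>" using cb by blast
    have dxy: "dist x y \<le> D / 2" using y by simp
    have "boundary_dist \<Omega> y \<le> 3 / 2 * D"
      using boundary_dist_triangle[of \<Omega> y x] dxy unfolding D_def by (simp add: dist_commute)
    then have "barrier_const * boundary_dist \<Omega> y \<le> barrier_const * (3 / 2 * D)"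
      using barrier_const_pos by (intro mult_left_mono) auto
    then have "- u y \<le> 3 / 2 * barrier_const * D" using u_lower[OF y\<Omega>] by simp
    moreover have "u y \<le> 0" using u_nonpos y\<Omega> closure_subset by blast
    moreover have "0 \<le> q y" unfolding q_def by simp
    moreover have "q y \<le> D * d"
    proof -
      have "(norm (y - x))\<^sup>2 \<le> (D / 2)\<^sup>2" using dxy by (intro power_mono) (auto simp: dist_norm norm_minus_commute)
      also have "\<dots> \<le> D * d" using D mult_mono[of "D/2" D "D/2" d] by (simp add: power2_eq_square)
      finally have "(norm (y - x))\<^sup>2 \<le> D * d" .
      moreover have "0 \<le> D * d" using D by simp
      ultimately show ?thesis unfolding q_def by simp
    qed
    ultimately show "\<bar>u y - q y\<bar> \<le> D * (3 / 2 * barrier_const + d)"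
      by (simp add: algebra_simps abs_if)
  qed
  also have "\<dots> = lipschitz_const" unfolding lipschitz_const_def \<rho>_def using D by (simp add: field_simps)
  also have "partial_deriv i (\<lambda>y. u y - q y) x = partial_deriv i u x"
    using partial_deriv_diff[OF C2_on_C1(1)[OF C2_u] C2_on_C1(1)[OF Cq] x] q(2)[of i x] by simp
  finally show ?thesis .
qed

end

section \<open>The weighted Hessian norm\<close>

text \<open>The divergence of f * grad g - g * grad f: the products of first derivatives cancel, and
  the field vanishes off \<open>K\<close> because f does.\<close>

proposition green_identity:
  fixes f g :: "real^'n::finite \<Rightarrow> real"
  assumes S: "open S" "compact K" "K \<subseteq> S" and f: "C2_on S f" and g: "C2_on S g"
    and f0: "\<And>x. x \<notin> K \<Longrightarrow> f x = 0"
  defines "Z \<equiv> (\<lambda>x. f x * laplacian g x - g x * laplacian f x)"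
  shows "integrable lborel Z" "integral\<^sup>L lborel Z = 0" "x \<notin> K \<Longrightarrow> laplacian f x = 0"
proof -
  have oK: "open (- K)" using S by (simp add: compact_imp_closed open_Compl)
  have p0: "partial_deriv i f x = 0" if "x \<notin> K" for i x
    by (rule partial_deriv_eqI, rule has_partial_deriv_cong[OF oK _ _ has_partial_deriv_const])
      (use that f0 in auto)
  have pp0: "partial_deriv j (partial_deriv i f) x = 0" if "x \<notin> K" for i j x
    by (rule partial_deriv_eqI, rule has_partial_deriv_cong[OF oK _ _ has_partial_deriv_const])
      (use that p0 in auto)
  show "x \<notin> K \<Longrightarrow> laplacian f x = 0" unfolding laplacian_def using pp0 by simp
  define F where "F i x = f x * partial_deriv i g x - g x * partial_deriv i f x" for i x
  define G where "G i x = f x * partial_deriv i (partial_deriv i g) x - g x * partial_deriv i (partial_deriv i f) x" for i x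
  note C = C1_on_continuous[OF C2_on_C1(1)[OF f] S(1)] C1_on_continuous[OF C2_on_C1(1)[OF g] S(1)]
    C1_on_continuous_partial[OF C2_on_C1(1)[OF f]] C1_on_continuous_partial[OF C2_on_C1(1)[OF g]]
    C1_on_continuous_partial[OF C2_on_C1(2)[OF f]] C1_on_continuous_partial[OF C2_on_C1(2)[OF g]]
  have *: "integrable lborel (G i) \<and> integral\<^sup>L lborel (G i) = 0" for i
  proof -
    have cF: "continuous_on S (F i)" and cG: "continuous_on S (G i)"
      unfolding F_def G_def by (intro continuous_intros C)+
    have FG: "has_partial_deriv (F i) i x (G i x)" if "x \<in> S" for x
    proof -
      note D = C1_on_has_partial_deriv[OF C2_on_C1(1)[OF f] that] C1_on_has_partial_deriv[OF C2_on_C1(1)[OF g] that]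
        C1_on_has_partial_deriv[OF C2_on_C1(2)[OF f] that] C1_on_has_partial_deriv[OF C2_on_C1(2)[OF g] that]
      show ?thesis
        using has_partial_deriv_diff[OF has_partial_deriv_mult[OF D(1,4)] has_partial_deriv_mult[OF D(2,3)], of i i i]
        unfolding F_def G_def by (simp add: mult_ac)
    qed
    have "F i x = 0" "G i x = 0" if "x \<notin> K" for x
      using that by (auto simp: F_def G_def f0 p0 pp0)
    then show ?thesis using integral_partial_deriv_eq_zero[OF S cF cG FG] by blast
  qed
  have Z: "Z = (\<lambda>x. \<Sum>i\<in>UNIV. G i x)"
    unfolding Z_def G_def laplacian_def by (auto simp: sum_subtractf sum_distrib_left)
  show "integrable lborel Z" "integral\<^sup>L lborel Z = 0"
    unfolding Z using * by (auto simp: Bochner_Integration.integral_sum)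
qed

text \<open>Bochner's identity; harmonicity removes the terms v_i times Laplacian of v_i. The
  constant \<open>B\<close> is there to make the function nonpositive later.\<close>

lemma laplacian_sum_squares:
  fixes v :: "'n::finite \<Rightarrow> real^'n \<Rightarrow> real"
  assumes S: "open S" and v: "\<And>i. C2_on S (v i)" "\<And>i x. x \<in> S \<Longrightarrow> laplacian (v i) x = 0"
  shows "C2_on S (\<lambda>x. (\<Sum>i\<in>UNIV. (v i x)\<^sup>2) - B)"
    and "x \<in> S \<Longrightarrow> laplacian (\<lambda>x. (\<Sum>i\<in>UNIV. (v i x)\<^sup>2) - B) x =
      2 * (\<Sum>i\<in>UNIV. \<Sum>j\<in>UNIV. (partial_deriv j (v i) x)\<^sup>2)"
proof -
  define w where "w = (\<lambda>x. (\<Sum>i\<in>UNIV. v i x * v i x) - B)"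
  note C = C1_on_continuous[OF C2_on_C1(1)[OF v(1)] S]
    C1_on_continuous_partial[OF C2_on_C1(1)[OF v(1)]] C1_on_continuous_partial[OF C2_on_C1(2)[OF v(1)]]
  have D: "has_partial_deriv w j x
      ((\<Sum>i\<in>UNIV. partial_deriv j (v i) x * v i x + partial_deriv j (v i) x * v i x) - 0)" if "x \<in> S" for j x
    unfolding w_def
    by (intro has_partial_deriv_diff has_partial_deriv_sum has_partial_deriv_mult has_partial_deriv_const
      C1_on_has_partial_deriv[OF C2_on_C1(1)[OF v(1)] that])
  have DD: "has_partial_deriv (\<lambda>x. (\<Sum>i\<in>UNIV. partial_deriv j (v i) x * v i x + partial_deriv j (v i) x * v i x) - 0) k x
      ((\<Sum>i\<in>UNIV. (partial_deriv k (partial_deriv j (v i)) x * v i x + partial_deriv k (v i) x * partial_deriv j (v i) x) +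
        (partial_deriv k (partial_deriv j (v i)) x * v i x + partial_deriv k (v i) x * partial_deriv j (v i) x)) - 0)"
    if "x \<in> S" for j k x
    by (intro has_partial_deriv_diff has_partial_deriv_sum has_partial_deriv_add has_partial_deriv_mult has_partial_deriv_const
      C1_on_has_partial_deriv[OF C2_on_C1(1)[OF v(1)] that] C1_on_has_partial_deriv[OF C2_on_C1(2)[OF v(1)] that])
  note C2 = C2_onI[OF S D DD]
  have w: "(\<lambda>x. (\<Sum>i\<in>UNIV. (v i x)\<^sup>2) - B) = w" unfolding w_def power2_eq_square ..
  show "C2_on S (\<lambda>x. (\<Sum>i\<in>UNIV. (v i x)\<^sup>2) - B)"
    unfolding w by (rule C2(1)) (intro continuous_intros C | assumption)+
  assume x: "x \<in> S"
  have "partial_deriv j (partial_deriv j w) x = 2 * (\<Sum>i\<in>UNIV. (partial_deriv j (v i) x)\<^sup>2) +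
      2 * (\<Sum>i\<in>UNIV. v i x * partial_deriv j (partial_deriv j (v i)) x)" for j
    by (subst C2(2)[OF _ _ _ _ x])
      ((intro continuous_intros C | assumption)+, simp add: sum_distrib_left sum.distrib[symmetric] power2_eq_square algebra_simps)
  then have "laplacian w x = 2 * (\<Sum>j\<in>UNIV. \<Sum>i\<in>UNIV. (partial_deriv j (v i) x)\<^sup>2) +
      2 * (\<Sum>j\<in>UNIV. \<Sum>i\<in>UNIV. v i x * partial_deriv j (partial_deriv j (v i)) x)"
    unfolding laplacian_def by (simp add: sum.distrib flip: sum_distrib_left)
  also have "(\<Sum>j\<in>UNIV. \<Sum>i\<in>UNIV. v i x * partial_deriv j (partial_deriv j (v i)) x) =
      (\<Sum>i\<in>UNIV. v i x * laplacian (v i) x)"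
    unfolding laplacian_def sum_distrib_left by (rule sum.swap)
  also have "\<dots> = 0" using v(2)[OF x] by simp
  also have "(\<Sum>j\<in>UNIV. \<Sum>i\<in>UNIV. (partial_deriv j (v i) x)\<^sup>2) = (\<Sum>i\<in>UNIV. \<Sum>j\<in>UNIV. (partial_deriv j (v i) x)\<^sup>2)"
    by (rule sum.swap)
  finally show "laplacian (\<lambda>x. (\<Sum>i\<in>UNIV. (v i x)\<^sup>2) - B) x =
      2 * (\<Sum>i\<in>UNIV. \<Sum>j\<in>UNIV. (partial_deriv j (v i) x)\<^sup>2)"
    unfolding w by simp
qed

text \<open>A convex \<open>C\<^sup>2\<close> approximation of \<open>t \<mapsto> t\<close> on the positive half-line that vanishes for \<open>t \<le> \<epsilon>\<close>
  and has slope at most one.\<close>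

definition cutoff :: "real \<Rightarrow> real \<Rightarrow> real" where
  "cutoff \<epsilon> t = (max 0 (t - \<epsilon>)) ^ 3 / t\<^sup>2"

definition cutoff' :: "real \<Rightarrow> real \<Rightarrow> real" where
  "cutoff' \<epsilon> t = 3 * (max 0 (t - \<epsilon>))\<^sup>2 / t\<^sup>2 - 2 * (max 0 (t - \<epsilon>)) ^ 3 / t ^ 3"

definition cutoff'' :: "real \<Rightarrow> real \<Rightarrow> real" where
  "cutoff'' \<epsilon> t = 6 * max 0 (t - \<epsilon>) / t\<^sup>2 - 12 * (max 0 (t - \<epsilon>))\<^sup>2 / t ^ 3 + 6 * (max 0 (t - \<epsilon>)) ^ 3 / t ^ 4"

lemma cutoff_derivs:
  assumes t: "t > 0"
  shows "(cutoff \<epsilon> has_real_derivative cutoff' \<epsilon> t) (at t)"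
    and "(cutoff' \<epsilon> has_real_derivative cutoff'' \<epsilon> t) (at t)"
proof -
  have m: "((\<lambda>t. max 0 (t - \<epsilon>) ^ Suc (Suc k)) has_real_derivative
      (real (Suc (Suc k)) * max 0 (t - \<epsilon>) ^ Suc k) * (1 - 0)) (at t)" for k
    by (rule DERIV_chain2[OF DERIV_max_zero_power]) (intro DERIV_diff DERIV_ident DERIV_const)
  have m2: "((\<lambda>t. (max 0 (t - \<epsilon>))\<^sup>2) has_real_derivative 2 * max 0 (t - \<epsilon>)) (at t)"
    using m[of 0] by (simp add: numeral_eq_Suc)
  have m3: "((\<lambda>t. max 0 (t - \<epsilon>) ^ 3) has_real_derivative 3 * (max 0 (t - \<epsilon>))\<^sup>2) (at t)"
    using m[of 1] by (simp add: numeral_eq_Suc)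
  show "(cutoff \<epsilon> has_real_derivative cutoff' \<epsilon> t) (at t)"
    unfolding cutoff_def cutoff'_def
    by (rule derivative_eq_intros m3 refl | use t in \<open>simp add: field_simps power_numeral_reduce\<close>)+
  show "(cutoff' \<epsilon> has_real_derivative cutoff'' \<epsilon> t) (at t)"
    unfolding cutoff'_def cutoff''_def
    by (rule derivative_eq_intros m2 m3 refl | use t in \<open>simp add: field_simps power_numeral_reduce\<close>)+
qed

lemma cutoff_bounds:
  assumes "t > 0" "\<epsilon> > 0"
  shows "0 \<le> cutoff \<epsilon> t" "0 \<le> cutoff'' \<epsilon> t" "cutoff' \<epsilon> t \<le> 1"
proof -
  define m where "m = max 0 (t - \<epsilon>)"
  have m: "0 \<le> m" "m \<le> t" unfolding m_def using assms by auto
  show "0 \<le> cutoff \<epsilon> t" unfolding cutoff_def m_def[symmetric] using m by simp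
  \<comment> \<open>The bounds on both derivatives become visible from factorizations containing the
    square (t - m)^2.\<close>
  have "cutoff'' \<epsilon> t = 6 * m * (t - m)\<^sup>2 / t ^ 4"
    unfolding cutoff''_def m_def[symmetric] using assms
    by (simp add: field_simps power_numeral_reduce)
  then show "0 \<le> cutoff'' \<epsilon> t" using m by simp
  have "1 - cutoff' \<epsilon> t = (t - m)\<^sup>2 * (t + 2 * m) / t ^ 3"
    unfolding cutoff'_def m_def[symmetric] using assms
    by (simp add: field_simps power_numeral_reduce)
  moreover have "0 \<le> (t - m)\<^sup>2 * (t + 2 * m) / t ^ 3" using m assms by simp
  ultimately show "cutoff' \<epsilon> t \<le> 1" by linarith
qed

lemma cutoff_tendsto:
  assumes "t > 0"
  shows "(\<lambda>n. cutoff (inverse (real (Suc n))) t) \<longlonglongrightarrow> t"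
proof -
  have "(\<lambda>n. cutoff (inverse (real (Suc n))) t) \<longlonglongrightarrow> (max 0 (t - 0)) ^ 3 / t\<^sup>2"
    unfolding cutoff_def by (intro tendsto_intros LIMSEQ_inverse_real_of_nat) (use assms in simp)
  then show ?thesis using assms by (simp add: field_simps power_numeral_reduce)
qed

section \<open>Finiteness of the weighted Hessian norm\<close>

locale torsion_problem = torsion_domain +
  fixes z :: "real^'n" and \<delta> a :: real and h :: "real^'n \<Rightarrow> real"
  assumes z: "z \<in> \<Omega>" and dist_z: "boundary_dist \<Omega> z = \<delta>" and critical: "gradient u z = 0"
    and h_def: "h = (\<lambda>x. ((norm (x - z))\<^sup>2 - a) / 2 - u x)"
begin

lemma h_facts:
  shows C2_h: "C2_on \<Omega> h" and laplacian_h: "x \<in> \<Omega> \<Longrightarrow> laplacian h x = 0"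
    and partial_deriv_h: "x \<in> \<Omega> \<Longrightarrow> partial_deriv i h x = (x $ i - z $ i) - partial_deriv i u x"
proof -
  define q where "q = (\<lambda>x. (1/2) * ((norm (x - z))\<^sup>2 - a))"
  note q = C2_on_quadratic[where k="1/2" and c=z and a=a, folded q_def]
  have Cq: "C2_on \<Omega> q" by (rule C2_on_subset[OF q(1) subset_UNIV])
  have h: "h = (\<lambda>x. q x - u x)" unfolding h_def q_def by simp
  show "C2_on \<Omega> h" unfolding h by (rule C2_on_diff(1)[OF open_dom Cq C2_u])
  show "laplacian h x = 0" if "x \<in> \<Omega>"
    unfolding h using C2_on_diff(3)[OF open_dom Cq C2_u that] q(3) laplacian_u[OF that] by simp
  show "partial_deriv i h x = (x $ i - z $ i) - partial_deriv i u x" if "x \<in> \<Omega>"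
    unfolding h using partial_deriv_diff[OF C2_on_C1(1)[OF Cq] C2_on_C1(1)[OF C2_u] that] q(2)[of i x] by simp
qed

lemma partial_deriv_h_z: "partial_deriv i h z = 0"
  using partial_deriv_h[OF z, of i] arg_cong[OF critical, of "\<lambda>v. v $ i"] by (simp add: gradient_def)

lemma C2_dh: "C2_on \<Omega> (partial_deriv i h)"
  and laplacian_dh: "x \<in> \<Omega> \<Longrightarrow> laplacian (partial_deriv i h) x = 0"
  using harmonic_partial_deriv[OF open_dom C2_h laplacian_h] by auto

text \<open>The second derivatives are harmonic themselves, so the weighted mean value bound applies
  to them directly.\<close>

lemma C2_ddh: "C2_on \<Omega> (partial_deriv j (partial_deriv i h))"
  and laplacian_ddh: "x \<in> \<Omega> \<Longrightarrow> laplacian (partial_deriv j (partial_deriv i h)) x = 0"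
  using harmonic_partial_deriv[OF open_dom C2_dh laplacian_dh] by auto

lemma partial_deriv_h_bound:
  assumes "x \<in> \<Omega>"
  shows "\<bar>partial_deriv i h x\<bar> \<le> d + lipschitz_const"
proof -
  have "\<bar>x $ i - z $ i\<bar> \<le> d"
    using component_le_norm_cart[of "x - z" i] dist_le_diameter[of x z]
      closure_subset[THEN subsetD, OF assms] closure_subset[THEN subsetD, OF z]
    by (simp add: dist_norm)
  then show ?thesis using partial_deriv_h[OF assms, of i] gradient_u_bound[OF assms, of i] by linarith
qed

text \<open>In \<open>cutoff_energy_bound\<close>, the first factor N with the square bounds |grad
  h|^2, the second N bounds the negative part of the Laplacian of the cutoff of -u, and
  \<open>\<Omega>\<close> lies in a ball of radius \<open>d\<close>.\<close>

definition energy_const :: real where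
  "energy_const = real CARD('n) * (d + lipschitz_const)\<^sup>2 * real CARD('n) * measure lborel (cball (0::real^'n) d)"

definition hess2 :: "real^'n \<Rightarrow> real" where
  "hess2 x = (\<Sum>i\<in>UNIV. \<Sum>j\<in>UNIV. (partial_deriv j (partial_deriv i h) x)\<^sup>2)"

lemma hess2_nonneg: "hess2 x \<ge> 0"
  unfolding hess2_def by (intro sum_nonneg) auto

lemma u_neg: "x \<in> \<Omega> \<Longrightarrow> - u x > 0"
  using boundary_dist_le_u[of x] boundary_dist_pos[of x] radii_pos
  by (smt (verit) divide_pos_pos mult_pos_pos)

text \<open>Green's identity moves the Laplacian from w = |grad h|^2 - B to the cutoff
  \<open>\<psi>\<close> of -u. The term of that Laplacian with \<open>cutoff''\<close> need not stay
  bounded as \<open>\<epsilon>\<close> shrinks, but convexity makes it nonnegative, and w \<le> 0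
  gives it the good sign. Only the slope term, at least -N, contributes, against -B \<le> w.\<close>

lemma cutoff_energy_bound:
  assumes \<epsilon>: "\<epsilon> > 0"
  defines "F \<equiv> (\<lambda>x. if x \<in> \<Omega> then cutoff \<epsilon> (- u x) * (2 * hess2 x) else 0)"
  shows "F \<in> borel_measurable borel" "(\<integral>\<^sup>+x. ennreal (F x) \<partial>lborel) \<le> ennreal energy_const"
proof -
  define N where "N = real CARD('n)"
  define B where "B = N * (d + lipschitz_const)\<^sup>2"
  define w where "w = (\<lambda>x. (\<Sum>i\<in>UNIV. (partial_deriv i h x)\<^sup>2) - B)"
  note w = laplacian_sum_squares[where v="\<lambda>i. partial_deriv i h" and B=B, OF open_dom C2_dh laplacian_dh, folded w_def]
  define \<psi> where "\<psi> x = (if x \<in> \<Omega> then cutoff \<epsilon> (- u x) else 0)" for x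
  define K where "K = {x \<in> closure \<Omega>. u x \<le> - \<epsilon>}"
  have "closed (closure \<Omega> \<inter> u -` {..- \<epsilon>})"
    by (rule continuous_closed_preimage[OF continuous_u]) auto
  moreover have "K = closure \<Omega> \<inter> u -` {..- \<epsilon>}" unfolding K_def by auto
  ultimately have "closed K" by simp
  have cK: "compact K"
  proof -
    have "K = closure \<Omega> \<inter> K" unfolding K_def by auto
    then show ?thesis using \<open>closed K\<close> compact_closure[of \<Omega>] bounded_dom by (metis compact_Int_closed)
  qed
  have K\<Omega>: "K \<subseteq> \<Omega>"
    using u_frontier \<epsilon> open_dom unfolding K_def by (force simp: frontier_def interior_open)
  have \<psi>0: "\<psi> x = 0" if "x \<notin> K" for x
    using that closure_subset[of \<Omega>] unfolding \<psi>_def K_def cutoff_def by auto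
  note Du = C1_on_has_partial_deriv[OF C2_on_C1(1)[OF C2_u]]
  note DDu = C1_on_has_partial_deriv[OF C2_on_C1(2)[OF C2_u]]
  have mu: "has_partial_deriv (\<lambda>x. - u x) i x (- partial_deriv i u x)" if "x \<in> \<Omega>" for i x
    using has_partial_deriv_cmult[OF Du[OF that], of "-1" i] by simp
  have mmu: "has_partial_deriv (\<lambda>x. - partial_deriv i u x) j x (- partial_deriv j (partial_deriv i u) x)" if "x \<in> \<Omega>" for i j x
    using has_partial_deriv_cmult[OF DDu[OF that], of "-1" i j] by simp
  have D: "has_partial_deriv \<psi> i x (cutoff' \<epsilon> (- u x) * (- partial_deriv i u x))" if x: "x \<in> \<Omega>" for i x
    by (rule has_partial_deriv_cong[OF open_dom x _ has_partial_deriv_compose[OF cutoff_derivs(1)[OF u_neg[OF x]] mu[OF x]]])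
      (simp add: \<psi>_def)
  have DD: "has_partial_deriv (\<lambda>x. cutoff' \<epsilon> (- u x) * (- partial_deriv i u x)) j x
     ((cutoff'' \<epsilon> (- u x) * (- partial_deriv j u x)) * (- partial_deriv i u x) +
       (- partial_deriv j (partial_deriv i u) x) * cutoff' \<epsilon> (- u x))" if x: "x \<in> \<Omega>" for i j x
    by (intro has_partial_deriv_mult has_partial_deriv_compose[OF cutoff_derivs(2)[OF u_neg[OF x]] mu[OF x]] mmu[OF x])
  have contu: "continuous_on \<Omega> u" by (rule continuous_on_subset[OF continuous_u closure_subset])
  note Cu = contu C1_on_continuous_partial[OF C2_on_C1(1)[OF C2_u]] C1_on_continuous_partial[OF C2_on_C1(2)[OF C2_u]]
  have c': "continuous_on \<Omega> (\<lambda>x. cutoff' \<epsilon> (- u x))" "continuous_on \<Omega> (\<lambda>x. cutoff'' \<epsilon> (- u x))"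
    unfolding cutoff'_def cutoff''_def using u_neg by (intro continuous_intros Cu; force)+
  note \<psi>C2 = C2_onI[OF open_dom D DD]
  have C\<psi>: "C2_on \<Omega> \<psi>" by (rule \<psi>C2(1)) (intro continuous_intros Cu c' | assumption)+
  have lap\<psi>: "laplacian \<psi> x = cutoff'' \<epsilon> (- u x) * (\<Sum>i\<in>UNIV. (partial_deriv i u x)\<^sup>2) - N * cutoff' \<epsilon> (- u x)"
    if x: "x \<in> \<Omega>" for x
  proof -
    have "partial_deriv i (partial_deriv i \<psi>) x = cutoff'' \<epsilon> (- u x) * (partial_deriv i u x)\<^sup>2 -
        partial_deriv i (partial_deriv i u) x * cutoff' \<epsilon> (- u x)" for i
      by (subst \<psi>C2(2)[OF _ _ _ _ x])
        ((intro continuous_intros Cu c' | assumption)+, simp add: power2_eq_square)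
    then have "laplacian \<psi> x = cutoff'' \<epsilon> (- u x) * (\<Sum>i\<in>UNIV. (partial_deriv i u x)\<^sup>2) - laplacian u x * cutoff' \<epsilon> (- u x)"
      unfolding laplacian_def by (simp add: sum_subtractf sum_distrib_left sum_distrib_right)
    then show ?thesis using laplacian_u[OF x] unfolding N_def by simp
  qed
  note G = green_identity[OF open_dom cK K\<Omega> C\<psi> w(1) \<psi>0]
  have B: "B \<ge> 0" unfolding B_def N_def by simp
  have wb: "- B \<le> w x" "w x \<le> 0" if "x \<in> \<Omega>" for x
  proof -
    have "(\<Sum>i\<in>UNIV. (partial_deriv i h x)\<^sup>2) \<le> (\<Sum>i\<in>(UNIV::'n set). (d + lipschitz_const)\<^sup>2)"
    proof (rule sum_mono)
      fix i
      show "(partial_deriv i h x)\<^sup>2 \<le> (d + lipschitz_const)\<^sup>2"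
        using partial_deriv_h_bound[OF that, of i] by (metis power2_abs power_mono abs_ge_zero)
    qed
    then show "w x \<le> 0" unfolding w_def B_def N_def by simp
    show "- B \<le> w x" unfolding w_def by (simp add: sum_nonneg)
  qed
  have F: "F x = \<psi> x * laplacian w x" for x
    unfolding F_def \<psi>_def hess2_def using w(2)[of x] by simp
  have Fle: "F x \<le> (\<psi> x * laplacian w x - w x * laplacian \<psi> x) + B * N * indicator K x" for x
  proof (cases "x \<in> K")
    case True
    then have x: "x \<in> \<Omega>" using K\<Omega> by blast
    have "- N \<le> laplacian \<psi> x"
    proof -
      have "0 \<le> cutoff'' \<epsilon> (- u x) * (\<Sum>i\<in>UNIV. (partial_deriv i u x)\<^sup>2)"
        using cutoff_bounds(2)[OF u_neg[OF x] \<epsilon>] by (intro mult_nonneg_nonneg sum_nonneg) auto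
      moreover have "N * cutoff' \<epsilon> (- u x) \<le> N * 1"
        using cutoff_bounds(3)[OF u_neg[OF x] \<epsilon>] unfolding N_def by (intro mult_left_mono) auto
      ultimately show ?thesis unfolding lap\<psi>[OF x] by linarith
    qed
    then have "w x * laplacian \<psi> x \<le> w x * (- N)" using wb(2)[OF x] by (intro mult_left_mono_neg) auto
    also have "\<dots> \<le> B * N" using mult_right_mono[of "- w x" B N] wb(1)[OF x] unfolding N_def by simp
    finally show ?thesis unfolding F using True by simp
  next
    case False
    then show ?thesis unfolding F using \<psi>0 G(3) by simp
  qed
  have F0: "F x \<ge> 0" for x
    unfolding F_def using cutoff_bounds(1)[OF u_neg \<epsilon>] hess2_nonneg by simp
  have CF: "continuous_on \<Omega> F"
  proof (rule continuous_on_eq)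
    show "continuous_on \<Omega> (\<lambda>x. cutoff \<epsilon> (- u x) * (2 * hess2 x))"
      unfolding cutoff_def hess2_def using u_neg
      by (intro continuous_intros contu C1_on_continuous_partial[OF C2_on_C1(1)[OF C2_dh]]) force
  qed (simp add: F_def)
  have "continuous_on UNIV F"
    by (rule continuous_on_extend_zero[OF open_dom \<open>closed K\<close> K\<Omega> CF]) (simp add: F \<psi>0)
  then show Fm: "F \<in> borel_measurable borel" by (rule borel_measurable_continuous_onI)
  have Kfin: "emeasure lborel K < \<infinity>" using emeasure_compact_finite[OF cK] by simp
  have intK: "integrable lborel (\<lambda>x. B * N * indicator K x)"
    using Kfin \<open>closed K\<close> by (intro integrable_mult_right integrable_real_indicator) auto
  have int: "integrable lborel (\<lambda>x. (\<psi> x * laplacian w x - w x * laplacian \<psi> x) + B * N * indicator K x)"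
    by (rule Bochner_Integration.integrable_add[OF G(1) intK])
  have intF: "integrable lborel F"
    by (rule Bochner_Integration.integrable_bound[OF int]) (use Fm Fle F0 in \<open>auto intro!: AE_I2 order_trans[OF Fle]\<close>)
  have "integral\<^sup>L lborel F \<le> (LINT x|lborel. (\<psi> x * laplacian w x - w x * laplacian \<psi> x) + B * N * indicator K x)"
    by (rule integral_mono[OF intF int Fle])
  also have "\<dots> = B * N * measure lborel K"
    using G(1,2) intK by (subst Bochner_Integration.integral_add) (auto simp: \<open>closed K\<close>)
  also have "measure lborel K \<le> measure lborel (cball z d)"
  proof (rule measure_mono_fmeasurable)
    show "K \<subseteq> cball z d"
    proof
      fix x assume "x \<in> K"
      then show "x \<in> cball z d" using dist_le_diameter[of z x] z closure_subset[of \<Omega>] unfolding K_def by auto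
    qed
    show "K \<in> sets lborel" using \<open>closed K\<close> by simp
    show "cball z d \<in> fmeasurable lborel" by (rule fmeasurable_compact) simp
  qed
  also have "measure lborel (cball z d) = measure lborel (cball (0::real^'n) d)"
    using diameter_nonneg by (simp add: content_cball)
  finally have "integral\<^sup>L lborel F \<le> energy_const"
    unfolding energy_const_def B_def N_def by (simp add: mult_left_mono)
  then show "(\<integral>\<^sup>+x. ennreal (F x) \<partial>lborel) \<le> ennreal energy_const"
    by (subst nn_integral_eq_integral[OF intF]) (auto simp: F0 intro: ennreal_leI)
qed

end

text \<open>Collects the constants of \<open>hessian_bound\<close>, where rho = D / (2 * N) and the
  weight is at least D / 2.\<close>

definition hessian_const :: "'n::finite itself \<Rightarrow> real" where
  "hessian_const _ = sqrt (2 * (2 * real CARD('n)) ^ CARD('n) / bump_mass TYPE('n))"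

lemma hessian_const_nonneg: "hessian_const TYPE('n::finite) \<ge> 0"
  unfolding hessian_const_def using less_imp_le[OF bump_mass_pos[where ?'n='n]] by simp

context torsion_problem
begin

lemma energy_const_nonneg: "energy_const \<ge> 0"
  unfolding energy_const_def by simp

text \<open>Fatou's lemma along eps = 1/(n+1): the bounds for the cutoffs are uniform in
  eps.\<close>

lemma energy_bound:
  "(\<integral>\<^sup>+x. ennreal (if x \<in> \<Omega> then - u x * (2 * hess2 x) else 0) \<partial>lborel) \<le> ennreal energy_const"
proof -
  define F where "F n x = (if x \<in> \<Omega> then cutoff (inverse (real (Suc n))) (- u x) * (2 * hess2 x) else 0)" for n x
  have F: "F n \<in> borel_measurable borel" "(\<integral>\<^sup>+x. ennreal (F n x) \<partial>lborel) \<le> ennreal energy_const" for n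
    using cutoff_energy_bound[of "inverse (real (Suc n))"] unfolding F_def by auto
  have [measurable]: "F n \<in> borel_measurable borel" for n by (rule F(1))
  have lim: "(\<lambda>n. F n x) \<longlonglongrightarrow> (if x \<in> \<Omega> then - u x * (2 * hess2 x) else 0)" for x
    unfolding F_def using tendsto_mult_right[OF cutoff_tendsto[OF u_neg], of x "2 * hess2 x"]
    by (cases "x \<in> \<Omega>") simp_all
  have "liminf (\<lambda>n. ennreal (F n x)) = ennreal (if x \<in> \<Omega> then - u x * (2 * hess2 x) else 0)" for x
    by (rule lim_imp_Liminf[OF _ tendsto_ennrealI[OF lim]]) simp
  then have "(\<integral>\<^sup>+x. ennreal (if x \<in> \<Omega> then - u x * (2 * hess2 x) else 0) \<partial>lborel) =
      (\<integral>\<^sup>+x. liminf (\<lambda>n. ennreal (F n x)) \<partial>lborel)"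
    by simp
  also have "\<dots> \<le> liminf (\<lambda>n. \<integral>\<^sup>+x. ennreal (F n x) \<partial>lborel)"
    by (rule nn_integral_liminf) simp
  also have "\<dots> \<le> liminf (\<lambda>n. ennreal energy_const)"
    by (rule Liminf_mono) (simp add: F(2))
  finally show ?thesis by (simp add: Liminf_const)
qed

text \<open>Integrability is essential: the integral of a non-integrable function is \<open>0\<close> by convention, which
  would make the weighted norm vanish.\<close>

lemma weighted_hessian_integrable:
  defines "f \<equiv> (\<lambda>i j x. boundary_dist \<Omega> x * (partial_deriv i (partial_deriv j h) x)\<^sup>2)"
  shows "set_integrable lebesgue \<Omega> (f i j)"
    and "(LINT x:\<Omega>|lebesgue. f i j x) \<le> 2 / r\<^sub>i * energy_const"
    and "0 \<le> (LINT x:\<Omega>|lebesgue. f i j x)"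
proof -
  define g where "g = (\<lambda>x. indicator \<Omega> x *\<^sub>R f i j x)"
  have cont: "continuous_on \<Omega> (f i j)"
    unfolding f_def boundary_dist_def
    by (intro continuous_intros C1_on_continuous_partial[OF C2_on_C1(1)[OF C2_dh]])
  have [measurable]: "g \<in> borel_measurable borel"
    unfolding g_def using open_dom cont by (intro borel_measurable_continuous_on_indicator) auto
  have g0: "g x \<ge> 0" for x
    unfolding g_def f_def by (auto intro!: mult_nonneg_nonneg boundary_dist_nonneg)
  have le: "g x \<le> 2 / r\<^sub>i * (if x \<in> \<Omega> then - u x * (2 * hess2 x) else 0)" for x
  proof (cases "x \<in> \<Omega>")
    case True
    have "(partial_deriv i (partial_deriv j h) x)\<^sup>2 \<le> (\<Sum>i\<in>UNIV. (partial_deriv i (partial_deriv j h) x)\<^sup>2)"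
      by (rule member_le_sum) auto
    also have "\<dots> \<le> hess2 x"
      unfolding hess2_def
      by (rule member_le_sum[where f="\<lambda>j. \<Sum>i\<in>UNIV. (partial_deriv i (partial_deriv j h) x)\<^sup>2"]) (auto intro: sum_nonneg)
    finally have 1: "(partial_deriv i (partial_deriv j h) x)\<^sup>2 \<le> hess2 x" .
    \<comment> \<open>Linear growth of -u trades the weight for -u. The factor 4 turns into 2
      because the energy contains 2 * \<open>hess2\<close>.\<close>
    have "boundary_dist \<Omega> x \<le> 4 / r\<^sub>i * (- u x)"
      using boundary_dist_le_u[OF True] radii_pos by (simp add: field_simps)
    then have "boundary_dist \<Omega> x * (partial_deriv i (partial_deriv j h) x)\<^sup>2 \<le> (4 / r\<^sub>i * (- u x)) * hess2 x"
      using 1 radii_pos u_neg[OF True] by (intro mult_mono) (auto simp: divide_le_0_iff)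
    then show ?thesis unfolding g_def f_def using True by simp
  qed (simp add: g_def)
  have "(\<integral>\<^sup>+x. ennreal (g x) \<partial>lborel) \<le> (\<integral>\<^sup>+x. ennreal (2 / r\<^sub>i) * ennreal (if x \<in> \<Omega> then - u x * (2 * hess2 x) else 0) \<partial>lborel)"
    by (intro nn_integral_mono) (use le radii_pos in \<open>simp add: ennreal_mult'[symmetric] ennreal_leI\<close>)
  also have "\<dots> = ennreal (2 / r\<^sub>i) * (\<integral>\<^sup>+x. ennreal (if x \<in> \<Omega> then - u x * (2 * hess2 x) else 0) \<partial>lborel)"
  proof (rule nn_integral_cmult)
    have cont2: "continuous_on \<Omega> (\<lambda>x. - u x * (2 * hess2 x))"
      unfolding hess2_def
      by (intro continuous_intros continuous_on_subset[OF continuous_u closure_subset]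
        C1_on_continuous_partial[OF C2_on_C1(1)[OF C2_dh]])
    have "(\<lambda>x. indicator \<Omega> x *\<^sub>R (- u x * (2 * hess2 x))) \<in> borel_measurable borel"
      using open_dom cont2 by (intro borel_measurable_continuous_on_indicator) auto
    moreover have "(\<lambda>x. indicator \<Omega> x *\<^sub>R (- u x * (2 * hess2 x))) = (\<lambda>x. if x \<in> \<Omega> then - u x * (2 * hess2 x) else 0)"
      by (auto simp: fun_eq_iff)
    ultimately have "(\<lambda>x. if x \<in> \<Omega> then - u x * (2 * hess2 x) else 0) \<in> borel_measurable borel"
      by (simp only:)
    from measurable_compose[OF this measurable_ennreal]
    show "(\<lambda>x. ennreal (if x \<in> \<Omega> then - u x * (2 * hess2 x) else 0)) \<in> borel_measurable lborel"
      by simp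
  qed
  also have "\<dots> \<le> ennreal (2 / r\<^sub>i) * ennreal energy_const"
    by (intro mult_left_mono energy_bound) simp
  also have "\<dots> = ennreal (2 / r\<^sub>i * energy_const)"
    by (rule ennreal_mult'[symmetric]) (use radii_pos in simp)
  finally have nn: "(\<integral>\<^sup>+x. ennreal (g x) \<partial>lborel) \<le> ennreal (2 / r\<^sub>i * energy_const)" .
  have int: "integrable lborel g"
  proof (rule integrableI_bounded)
    have "(\<integral>\<^sup>+x. ennreal (norm (g x)) \<partial>lborel) = (\<integral>\<^sup>+x. ennreal (g x) \<partial>lborel)" using g0 by simp
    also have "\<dots> < \<infinity>" using nn by (metis ennreal_less_top infinity_ennreal_def order_le_less_trans)
    finally show "(\<integral>\<^sup>+x. ennreal (norm (g x)) \<partial>lborel) < \<infinity>" .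
  qed simp
  then show "set_integrable lebesgue \<Omega> (f i j)"
    unfolding set_integrable_def g_def[symmetric] by (simp add: integrable_completion)
  have eq: "(LINT x:\<Omega>|lebesgue. f i j x) = integral\<^sup>L lborel g"
    unfolding set_lebesgue_integral_def g_def[symmetric] by (simp add: integral_completion)
  show "0 \<le> (LINT x:\<Omega>|lebesgue. f i j x)" unfolding eq using g0 by simp
  have "ennreal (integral\<^sup>L lborel g) \<le> ennreal (2 / r\<^sub>i * energy_const)"
    using nn by (subst (asm) nn_integral_eq_integral[OF int]) (use g0 in auto)
  then show "(LINT x:\<Omega>|lebesgue. f i j x) \<le> 2 / r\<^sub>i * energy_const"
    unfolding eq using radii_pos energy_const_nonneg by (simp add: ennreal_le_iff)
qed

definition hess_norm :: real where "hess_norm = weighted_hessian_norm \<Omega> h"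

lemma hess_norm_square:
  "hess_norm\<^sup>2 = (\<Sum>i\<in>UNIV. \<Sum>j\<in>UNIV. (LINT x:\<Omega>|lebesgue. boundary_dist \<Omega> x * (partial_deriv i (partial_deriv j h) x)\<^sup>2))"
proof -
  have "(boundary_dist \<Omega> x powr (1/2) * hessian h x $ i $ j)\<^sup>2 =
      boundary_dist \<Omega> x * (partial_deriv i (partial_deriv j h) x)\<^sup>2" for i j x
    using boundary_dist_nonneg[of x] unfolding hessian_def power_mult_distrib
    by (simp add: powr_half_sqrt)
  then have "(L2_norm_on \<Omega> (\<lambda>x. boundary_dist \<Omega> x powr (1/2) * hessian h x $ i $ j))\<^sup>2 =
      (LINT x:\<Omega>|lebesgue. boundary_dist \<Omega> x * (partial_deriv i (partial_deriv j h) x)\<^sup>2)" for i j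
    unfolding L2_norm_on_def using weighted_hessian_integrable(3)[of i j] by simp
  then show ?thesis
    unfolding hess_norm_def weighted_hessian_norm_def
    by (simp add: real_sqrt_pow2 sum_nonneg weighted_hessian_integrable(3))
qed

lemma hess_norm_nonneg: "hess_norm \<ge> 0"
  unfolding hess_norm_def weighted_hessian_norm_def by (intro real_sqrt_ge_zero sum_nonneg) auto

text \<open>Serves the nonpositive exponents, where a positive power of the norm has to be bounded
  by a constant.\<close>

lemma hess_norm_bound: "hess_norm \<le> sqrt ((real CARD('n))\<^sup>2 * (2 / r\<^sub>i * energy_const))"
proof (rule real_le_rsqrt)
  have "hess_norm\<^sup>2 \<le> (\<Sum>i\<in>(UNIV::'n set). \<Sum>j\<in>(UNIV::'n set). 2 / r\<^sub>i * energy_const)"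
    unfolding hess_norm_square by (intro sum_mono weighted_hessian_integrable(2))
  then show "hess_norm\<^sup>2 \<le> (real CARD('n))\<^sup>2 * (2 / r\<^sub>i * energy_const)" by (simp add: power2_eq_square)
qed

lemma hessian_bound:
  assumes x: "x \<in> \<Omega>"
  shows "\<bar>partial_deriv i (partial_deriv j h) x\<bar>
    \<le> hessian_const TYPE('n) * hess_norm * boundary_dist \<Omega> x powr (- (real CARD('n) + 1) / 2)"
proof -
  define N where "N = CARD('n)"
  define D where "D = boundary_dist \<Omega> x"
  \<comment> \<open>Only half of the distance is used, so that the weight is at least D / 2
    throughout the ball.\<close>
  define \<rho> where "\<rho> = D / (2 * real N)"
  define m where "m = bump_mass TYPE('n)"
  define H where "H = (partial_deriv i (partial_deriv j h) x)\<^sup>2"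
  have N: "N > 0" unfolding N_def by simp
  have m: "m > 0" unfolding m_def by (rule bump_mass_pos)
  have D: "D > 0" unfolding D_def by (rule boundary_dist_pos[OF x])
  have \<rho>: "\<rho> > 0" "\<rho> * real CARD('n) = D / 2" unfolding \<rho>_def N_def[symmetric] using D N by auto
  have "m * \<rho> ^ N * (D / 2) * H \<le> (LINT y:\<Omega>|lebesgue. boundary_dist \<Omega> y * (partial_deriv i (partial_deriv j h) y)\<^sup>2)"
    unfolding m_def N_def H_def
  proof (rule harmonic_weighted_L2_bound[OF open_dom C2_ddh laplacian_ddh \<rho>(1)], unfold \<rho>(2))
    show "cball x (D / 2) \<subseteq> \<Omega>" by (rule cball_boundary_dist[OF x]) (use D in \<open>auto simp: D_def\<close>)
    show "D / 2 \<le> boundary_dist \<Omega> y" if "y \<in> cball x (D / 2)" for y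
      using that boundary_dist_triangle[of \<Omega> x y] unfolding D_def by simp
  qed (use D weighted_hessian_integrable(1) boundary_dist_nonneg in auto)
  also have "\<dots> \<le> hess_norm\<^sup>2"
  proof -
    have "(LINT y:\<Omega>|lebesgue. boundary_dist \<Omega> y * (partial_deriv i (partial_deriv j h) y)\<^sup>2) \<le>
      (\<Sum>j\<in>UNIV. (LINT y:\<Omega>|lebesgue. boundary_dist \<Omega> y * (partial_deriv i (partial_deriv j h) y)\<^sup>2))"
      by (rule member_le_sum[where f="\<lambda>j. LINT y:\<Omega>|lebesgue. boundary_dist \<Omega> y * (partial_deriv i (partial_deriv j h) y)\<^sup>2"])
        (auto intro: weighted_hessian_integrable(3))
    also have "\<dots> \<le> hess_norm\<^sup>2" unfolding hess_norm_square
      by (rule member_le_sum[where f="\<lambda>i. \<Sum>j\<in>UNIV. LINT y:\<Omega>|lebesgue. boundary_dist \<Omega> y * (partial_deriv i (partial_deriv j h) y)\<^sup>2"])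
        (auto intro: sum_nonneg weighted_hessian_integrable(3))
    finally show ?thesis .
  qed
  finally have le: "m * \<rho> ^ N * (D / 2) * H \<le> hess_norm\<^sup>2" .
  define P where "P = (2 * real N) ^ N"
  have eq: "m * \<rho> ^ N * (D / 2) = m * D ^ Suc N / (2 * P)"
    unfolding P_def \<rho>_def by (simp add: power_divide mult_ac)
  have "m * D ^ Suc N / (2 * P) * H \<le> hess_norm\<^sup>2" using le unfolding eq .
  moreover have "P > 0" unfolding P_def using N by simp
  ultimately have "H \<le> (2 * P / m) * hess_norm\<^sup>2 / D ^ Suc N"
    using m D by (simp add: field_simps)
  also have "\<dots> = (hessian_const TYPE('n) * hess_norm * D powr (- (real N + 1) / 2))\<^sup>2"
  proof -
    have "- (real N + 1) / 2 + - (real N + 1) / 2 = - real (Suc N)" by (simp add: field_simps)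
    then have "(D powr (- (real N + 1) / 2))\<^sup>2 = D powr (- real (Suc N))"
      by (simp only: power2_eq_square powr_add[symmetric])
    also have "\<dots> = inverse (D ^ Suc N)" using D by (simp only: powr_minus powr_realpow)
    finally have e1: "(D powr (- (real N + 1) / 2))\<^sup>2 = inverse (D ^ Suc N)" .
    have e2: "(hessian_const TYPE('n))\<^sup>2 = 2 * P / m"
      unfolding P_def hessian_const_def N_def m_def using bump_mass_pos[where ?'n='n] by simp
    show ?thesis unfolding power_mult_distrib e1 e2 by (simp only: divide_inverse)
  qed
  finally have "\<bar>partial_deriv i (partial_deriv j h) x\<bar> \<le> \<bar>hessian_const TYPE('n) * hess_norm * D powr (- (real N + 1) / 2)\<bar>"
    unfolding H_def by (simp add: abs_le_square_iff)
  then show ?thesis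
    unfolding D_def N_def using hessian_const_nonneg[where ?'n='n] hess_norm_nonneg by (simp add: abs_mult)
qed

end

section \<open>Chains of interior points\<close>

text \<open>Centering at the origin makes this a function of the dimension, \<open>R\<close> and
  \<open>e\<close>; a translation carries the cover to any other center. Compactness provides some
  finite cover, so \<open>LEAST\<close> is meaningful.\<close>

definition covering_number :: "'n::finite itself \<Rightarrow> real \<Rightarrow> real \<Rightarrow> nat" where
  "covering_number _ R e = (LEAST k. \<exists>X :: (real^'n) set.
     finite X \<and> card X = k \<and> cball 0 R \<subseteq> (\<Union>a\<in>X. ball a e))"

lemma covering_number_cball:
  fixes z :: "real^'n::finite"
  assumes "e > 0"
  obtains X where "finite X" "card X = covering_number TYPE('n) R e" "cball z R \<subseteq> (\<Union>a\<in>X. ball a e)"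
proof -
  have "\<exists>k. \<exists>X :: (real^'n) set. finite X \<and> card X = k \<and> cball 0 R \<subseteq> (\<Union>a\<in>X. ball a e)"
  proof -
    obtain X :: "(real^'n) set" where "finite X" "cball 0 R \<subseteq> (\<Union>a\<in>X. ball a e)"
      by (rule compactE_image[OF compact_cball, of "cball 0 R" "\<lambda>a. ball a e" 0 R]) (use assms in auto)
    then show ?thesis by blast
  qed
  then have "\<exists>X :: (real^'n) set. finite X \<and> card X = covering_number TYPE('n) R e \<and> cball 0 R \<subseteq> (\<Union>a\<in>X. ball a e)"
    unfolding covering_number_def by (rule LeastI_ex)
  then obtain X :: "(real^'n) set" where X: "finite X" "card X = covering_number TYPE('n) R e"
    "cball 0 R \<subseteq> (\<Union>a\<in>X. ball a e)" by blast
  show thesis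
  proof (rule that)
    show "finite ((+) z ` X)" using X(1) by simp
    show "card ((+) z ` X) = covering_number TYPE('n) R e"
      unfolding X(2)[symmetric] by (rule card_image) simp
    show "cball z R \<subseteq> (\<Union>a\<in>(+) z ` X. ball a e)"
    proof
      fix x assume "x \<in> cball z R"
      then have "x - z \<in> cball 0 R" by (simp add: dist_norm norm_minus_commute)
      then obtain a where a: "a \<in> X" "dist a (x - z) < e" using X(3) by auto
      have "dist (z + a) x = dist a (x - z)" by (simp add: dist_norm algebra_simps)
      then have "dist (z + a) x < e" using a(2) by simp
      then show "x \<in> (\<Union>a\<in>(+) z ` X. ball a e)" using a(1) by force
    qed
  qed
qed

text \<open>A set of pairs, so that \<open>rtrancl\<close> and the power operator on relations
  express reachability and chain length.\<close>

definition chain_rel :: "'a::metric_space set \<Rightarrow> real \<Rightarrow> ('a \<times> 'a) set" where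
  "chain_rel A e = {(x, y). x \<in> A \<and> y \<in> A \<and> dist x y \<le> e}"

lemma chain_rel_segment:
  fixes a b :: "'a::real_normed_vector"
  assumes seg: "closed_segment a b \<subseteq> A" and e: "e > 0"
  shows "(a, b) \<in> (chain_rel A e)\<^sup>*"
proof -
  obtain n :: nat where n: "norm (b - a) / e < real n" using reals_Archimedean2 by blast
  have n0: "n > 0" using n e by (metis norm_ge_zero divide_nonneg_pos gr0I not_less of_nat_0)
  define p where "p k = a + (real k / real n) *\<^sub>R (b - a)" for k
  have pA: "p k \<in> A" if "k \<le> n" for k
    using that n0 seg unfolding p_def closed_segment_def
    by (intro subsetD[OF seg[unfolded closed_segment_def]] CollectI exI[of _ "real k / real n"]) (auto simp: algebra_simps)
  have "(a, p k) \<in> (chain_rel A e)\<^sup>*" if "k \<le> n" for k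
    using that
  proof (induction k)
    case 0
    then show ?case by (simp add: p_def)
  next
    case (Suc k)
    have "p (Suc k) - p k = (1 / real n) *\<^sub>R (b - a)"
      unfolding p_def by (simp add: add_divide_distrib scaleR_add_left)
    then have "dist (p k) (p (Suc k)) = norm (b - a) / real n"
      using n0 by (simp add: dist_norm norm_minus_commute[of "p k"])
    also have "\<dots> \<le> e" using n n0 e by (simp add: field_simps)
    finally have "(p k, p (Suc k)) \<in> chain_rel A e"
      unfolding chain_rel_def using pA Suc.prems by auto
    then show ?case using Suc by (meson Suc_leD rtrancl.rtrancl_into_rtrancl)
  qed
  then have "(a, p n) \<in> (chain_rel A e)\<^sup>*" by simp
  then show ?thesis using n0 by (simp add: p_def)
qed

text \<open>A chain may revisit the balls of a finite cover, but passing to the graph of the balls bounds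
  the number of steps by the square of the size of the cover.\<close>

lemma chain_dist_bound:
  fixes F :: "'a::metric_space \<Rightarrow> 'b::metric_space"
  assumes X: "finite X" "A \<subseteq> (\<Union>a\<in>X. ball a (e/2))" and B: "B \<ge> 0"
    and step: "\<And>x y. x \<in> A \<Longrightarrow> y \<in> A \<Longrightarrow> dist x y \<le> e \<Longrightarrow> dist (F x) (F y) \<le> B"
    and xy: "(x, y) \<in> (chain_rel A e)\<^sup>*" "x \<in> A"
  shows "dist (F x) (F y) \<le> (2 * real ((card X)\<^sup>2) + 1) * B"
proof -
  \<comment> \<open>The graph of the balls: an edge joins two balls whenever a chain step leads from
    a point of \<open>A\<close> in the first to a point of \<open>A\<close> in the second.\<close>
  define Q where "Q = {(a, b). a \<in> X \<and> b \<in> X \<and> (\<exists>x\<in>A \<inter> ball a (e/2). \<exists>y\<in>A \<inter> ball b (e/2). (x, y) \<in> chain_rel A e)}"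
  have QX: "Q \<subseteq> X \<times> X" unfolding Q_def by auto
  then have finQ: "finite Q" and cardQ: "card Q \<le> (card X)\<^sup>2"
    using finite_subset[OF QX] card_mono[OF _ QX] X by (auto simp: power2_eq_square card_cartesian_product)
  have same: "dist (F x) (F y) \<le> B" if "x \<in> A \<inter> ball a (e/2)" "y \<in> A \<inter> ball a (e/2)" for a x y
  proof -
    have "dist x y \<le> e" using that dist_triangle3[of x y a] by auto
    then show ?thesis using step that by auto
  qed
  obtain a where a: "a \<in> X" "x \<in> ball a (e/2)" using X(2) xy(2) by blast
  from xy have "\<exists>b\<in>X. y \<in> A \<inter> ball b (e/2) \<and> (a, b) \<in> Q\<^sup>*"
  proof (induction rule: rtrancl_induct)
    case base
    then show ?case using a by blast
  next
    case (step y y')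
    then obtain b where b: "b \<in> X" "y \<in> A \<inter> ball b (e/2)" "(a, b) \<in> Q\<^sup>*" by blast
    have "y' \<in> A" using step.hyps unfolding chain_rel_def by auto
    then obtain b' where b': "b' \<in> X" "y' \<in> ball b' (e/2)" using X(2) by blast
    have "(b, b') \<in> Q" unfolding Q_def using b b' step.hyps \<open>y' \<in> A\<close> by blast
    then show ?case using b b' \<open>y' \<in> A\<close> by (meson IntI rtrancl.rtrancl_into_rtrancl)
  qed
  then obtain b where b: "b \<in> X" "y \<in> A \<inter> ball b (e/2)" "(a, b) \<in> Q\<^sup>*" by blast
  \<comment> \<open>In a finite relation, reachability needs no more steps than there are edges,
    however long the original chain is.\<close>
  then obtain n where n: "n \<le> card Q" "(a, b) \<in> Q ^^ n"
    using rtrancl_finite_eq_relpow[OF finQ] by auto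
  \<comment> \<open>An edge costs \<open>B\<close> for the step and \<open>B\<close> for the move
    inside the ball it reaches; one more \<open>B\<close> is spent in the first ball.\<close>
  have "dist (F x) (F y) \<le> (2 * real n + 1) * B"
    if "(a, b) \<in> Q ^^ n" "x \<in> A \<inter> ball a (e/2)" "y \<in> A \<inter> ball b (e/2)" for n a b x y
    using that
  proof (induction n arbitrary: b y)
    case 0
    then show ?case using same[of x a y] by simp
  next
    case (Suc n)
    then obtain c where c: "(a, c) \<in> Q ^^ n" "(c, b) \<in> Q" by auto
    then obtain x' y' where xy': "x' \<in> A \<inter> ball c (e/2)" "y' \<in> A \<inter> ball b (e/2)" "(x', y') \<in> chain_rel A e"
      unfolding Q_def by auto
    have "dist (F x) (F x') \<le> (2 * real n + 1) * B" by (rule Suc.IH[OF c(1) Suc.prems(2) xy'(1)])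
    moreover have "dist (F x') (F y') \<le> B" using step xy'(3) unfolding chain_rel_def by auto
    moreover have "dist (F y') (F y) \<le> B" by (rule same[OF xy'(2) Suc.prems(3)])
    ultimately have "dist (F x) (F y) \<le> (2 * real n + 1) * B + B + B"
      using dist_triangle[of "F x" "F y" "F x'"] dist_triangle[of "F x'" "F y" "F y'"] by linarith
    then show ?case by (simp add: algebra_simps)
  qed
  from this[OF n(2) _ b(2)] a(2) xy(2) have "dist (F x) (F y) \<le> (2 * real n + 1) * B" by blast
  also have "\<dots> \<le> (2 * real ((card X)\<^sup>2) + 1) * B"
    using n(1) cardQ B by (intro mult_right_mono) linarith+
  finally show ?thesis .
qed

lemma C1_on_segment_bound:
  fixes f :: "real^'n::finite \<Rightarrow> real"
  assumes S: "open S" and f: "C1_on S f"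
    and seg: "\<And>s. s \<in> {0..1} \<Longrightarrow> x + s *\<^sub>R v \<in> S"
    and M: "\<And>s j. s \<in> {0..1} \<Longrightarrow> \<bar>partial_deriv j f (x + s *\<^sub>R v)\<bar> \<le> M"
  shows "\<bar>f (x + v) - f x\<bar> \<le> real CARD('n) * norm v * M"
proof -
  have "\<bar>f (x + 1 *\<^sub>R v) - f (x + 0 *\<^sub>R v)\<bar> \<le> (real CARD('n) * norm v * M) * \<bar>1 - 0\<bar>"
  proof (rule field_differentiable_bound[of "{0..1}" "\<lambda>s. f (x + s *\<^sub>R v)", unfolded real_norm_def])
    fix s :: real assume s: "s \<in> {0..1}"
    show "((\<lambda>s. f (x + s *\<^sub>R v)) has_real_derivative
        (\<Sum>j\<in>UNIV. v $ j * partial_deriv j f (x + s *\<^sub>R v))) (at s within {0..1})"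
      by (rule has_field_derivative_at_within[OF C1_on_line_derivative[OF f S seg[OF s]]])
    have "\<bar>\<Sum>j\<in>UNIV. v $ j * partial_deriv j f (x + s *\<^sub>R v)\<bar>
        \<le> (\<Sum>j\<in>(UNIV::'n set). \<bar>v $ j * partial_deriv j f (x + s *\<^sub>R v)\<bar>)" by (rule sum_abs)
    also have "\<dots> \<le> (\<Sum>j\<in>(UNIV::'n set). norm v * M)"
      unfolding abs_mult by (intro sum_mono mult_mono component_le_norm_cart M[OF s]) auto
    finally show "\<bar>\<Sum>j\<in>UNIV. v $ j * partial_deriv j f (x + s *\<^sub>R v)\<bar> \<le> real CARD('n) * norm v * M" by simp
  qed auto
  then show ?thesis by simp
qed

section \<open>Linking interior balls at a uniform depth\<close>

context torsion_problem
begin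

text \<open>Small enough for a ball around \<open>z\<close> and for tangent interior balls at all
  frontier points, so that all balls of the chains share one radius.\<close>

definition radius :: real where "radius = min r\<^sub>i \<delta>"

text \<open>The solution of neck * (radius + 2 * \<open>r\<^sub>e\<close>) = 2 * radius *
  \<open>r\<^sub>e\<close>. In \<open>midpoint_boundary_dist\<close>, a midpoint at distance D <
  neck would satisfy D * (D + 2 * \<open>r\<^sub>e\<close>) < 2 * radius * \<open>r\<^sub>e\<close>,
  against the median formula.\<close>

definition neck :: real where "neck = 2 * radius * r\<^sub>e / (2 * r\<^sub>e + radius)"

definition inner_set :: "(real^'n) set" where
  "inner_set = {x \<in> \<Omega>. neck / 2 \<le> boundary_dist \<Omega> x}"

lemma radius_pos: "radius > 0" "radius \<le> r\<^sub>i"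
  unfolding radius_def using radii_pos boundary_dist_pos[OF z] dist_z by auto

lemma neck_pos: "neck > 0" and neck_le: "neck \<le> radius"
proof -
  show "neck > 0" unfolding neck_def using radius_pos radii_pos by simp
  show "neck \<le> radius" unfolding neck_def using radius_pos radii_pos by (simp add: field_simps)
qed

lemma ball_z: "ball z radius \<subseteq> \<Omega>"
  using ball_boundary_dist[OF z] dist_z unfolding radius_def by (auto simp: subset_iff)

text \<open>If two interior balls barely overlapped near a boundary point, there would be no room for the
  exterior ball at that point.\<close>

lemma midpoint_boundary_dist:
  assumes c: "ball c radius \<subseteq> \<Omega>" "ball c' radius \<subseteq> \<Omega>" "dist c c' < 2 * radius"
  shows "neck \<le> boundary_dist \<Omega> ((1/2) *\<^sub>R (c + c'))"
proof (rule ccontr)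
  define m where "m = (1/2) *\<^sub>R (c + c')"
  define D where "D = boundary_dist \<Omega> m"
  assume "\<not> neck \<le> boundary_dist \<Omega> ((1/2) *\<^sub>R (c + c'))"
  then have Dn: "D < neck" unfolding D_def m_def by simp
  have D0: "D \<ge> 0" unfolding D_def by (rule boundary_dist_nonneg)
  obtain p where p: "p \<in> frontier \<Omega>" "dist m p = D"
    unfolding D_def by (rule nearest_boundary_point)
  obtain e where e: "dist p e = r\<^sub>e" "\<And>x. x \<in> closure \<Omega> \<Longrightarrow> r\<^sub>e \<le> dist x e"
    using exterior_center[OF p(1)] by metis
  have 1: "(radius + r\<^sub>e)\<^sup>2 \<le> (norm (c - e))\<^sup>2" "(radius + r\<^sub>e)\<^sup>2 \<le> (norm (c' - e))\<^sup>2"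
    using exterior_dist_ball[OF e(2) radius_pos(1)] c radius_pos radii_pos
    by (auto intro!: power_mono simp: dist_norm)
  \<comment> \<open>The parallelogram law: m - e is a median of the triangle with vertices c, c',
    e.\<close>
  have "(norm (c - e))\<^sup>2 + (norm (c' - e))\<^sup>2 = 2 * (norm (m - e))\<^sup>2 + (norm (c - c'))\<^sup>2 / 2"
    unfolding m_def power2_norm_eq_inner
    by (simp add: inner_diff_left inner_diff_right inner_add_left inner_add_right inner_commute field_simps)
  moreover have "(norm (c - c'))\<^sup>2 \<le> (2 * radius)\<^sup>2"
    using c(3) by (intro power_mono) (auto simp: dist_norm)
  moreover have "(norm (m - e))\<^sup>2 \<le> (D + r\<^sub>e)\<^sup>2"
    using dist_triangle[of m e p] p(2) e(1) by (intro power_mono) (auto simp: dist_norm)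
  ultimately have "(radius + r\<^sub>e)\<^sup>2 \<le> (D + r\<^sub>e)\<^sup>2 + radius\<^sup>2"
    using 1 by (simp add: power2_eq_square)
  then have "2 * radius * r\<^sub>e \<le> D * (D + 2 * r\<^sub>e)" by (simp add: power2_eq_square algebra_simps)
  also have "\<dots> < neck * (radius + 2 * r\<^sub>e)"
    using Dn D0 neck_le radii_pos by (intro mult_strict_mono') auto
  also have "\<dots> = 2 * radius * r\<^sub>e" unfolding neck_def using radius_pos radii_pos by (simp add: field_simps)
  finally show False by simp
qed

text \<open>The distance to the boundary is 1-Lipschitz. The distances of \<open>x\<close> to the
  midpoint and to the nearer end sum to L / 2 < radius, so adding the lower bounds at those two
  points leaves twice the boundary distance of \<open>x\<close> above \<open>neck\<close>. This is
  the source of the 1/2 in \<open>inner_set\<close>.\<close>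

lemma overlap_segment:
  assumes c: "ball c radius \<subseteq> \<Omega>" "ball c' radius \<subseteq> \<Omega>" "dist c c' < 2 * radius"
  shows "closed_segment c c' \<subseteq> inner_set"
proof
  fix x assume "x \<in> closed_segment c c'"
  then obtain t where t: "0 \<le> t" "t \<le> 1" "x = (1 - t) *\<^sub>R c + t *\<^sub>R c'"
    unfolding closed_segment_def by blast
  define m where "m = (1/2) *\<^sub>R (c + c')"
  define L where "L = dist c c'"
  have L: "0 \<le> L" "L < 2 * radius" unfolding L_def using c by auto
  have xc: "dist x c = t * L"
  proof -
    have "x - c = t *\<^sub>R (c' - c)" unfolding t(3) by (simp add: algebra_simps)
    then show ?thesis unfolding L_def dist_norm using t by (simp add: norm_minus_commute)
  qed
  have xc': "dist x c' = (1 - t) * L"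
  proof -
    have "x - c' = (1 - t) *\<^sub>R (c - c')" unfolding t(3) by (simp add: algebra_simps)
    then show ?thesis unfolding L_def dist_norm using t by simp
  qed
  have xm: "dist x m = \<bar>t - 1/2\<bar> * L"
  proof -
    have "x - m = (t - 1/2) *\<^sub>R (c' - c)" unfolding t(3) m_def
      by (simp add: scaleR_diff_left scaleR_diff_right scaleR_add_right)
    then show ?thesis unfolding L_def dist_norm by (simp add: norm_minus_commute)
  qed
  have bm: "neck \<le> boundary_dist \<Omega> x + \<bar>t - 1/2\<bar> * L"
    using midpoint_boundary_dist[OF c] boundary_dist_triangle[of \<Omega> m x] xm unfolding m_def by (simp add: dist_commute)
  have bc: "radius \<le> boundary_dist \<Omega> x + t * L" "radius \<le> boundary_dist \<Omega> x + (1 - t) * L"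
    using boundary_dist_ge_of_ball[OF c(1)] boundary_dist_ge_of_ball[OF c(2)]
      boundary_dist_triangle[of \<Omega> c x] boundary_dist_triangle[of \<Omega> c' x] xc xc' by (auto simp: dist_commute)
  show "x \<in> inner_set"
  proof (cases "t \<le> 1/2")
    case True
    have "t * L \<le> 1/2 * L" using True L by (intro mult_right_mono) auto
    then have "x \<in> \<Omega>" using c(1) xc L by (auto simp: subset_iff dist_commute)
    moreover have "neck / 2 \<le> boundary_dist \<Omega> x" using bm bc(1) L True by (simp add: algebra_simps)
    ultimately show ?thesis unfolding inner_set_def by blast
  next
    case False
    have "(1 - t) * L \<le> 1/2 * L" using False L by (intro mult_right_mono) auto
    then have "x \<in> \<Omega>" using c(2) xc' L by (auto simp: subset_iff dist_commute)
    moreover have "neck / 2 \<le> boundary_dist \<Omega> x" using bm bc(2) L False by (simp add: algebra_simps)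
    ultimately show ?thesis unfolding inner_set_def by blast
  qed
qed

lemma centers_cover:
  assumes "x \<in> \<Omega>"
  obtains c where "ball c radius \<subseteq> \<Omega>" "x \<in> ball c radius"
proof (cases "boundary_dist \<Omega> x < radius")
  case True
  obtain c where "ball c radius \<subseteq> \<Omega>" "dist x c = radius - boundary_dist \<Omega> x"
    by (rule near_boundary_point[OF assms True radius_pos(2)])
  then show thesis using that[of c] boundary_dist_pos[OF assms] by (simp add: dist_commute)
next
  case False
  then have "ball x radius \<subseteq> \<Omega>" using ball_boundary_dist[OF assms] by (auto simp: subset_iff)
  then show thesis using that[of x] radius_pos by simp
qed

text \<open>The balls whose centers can be reached from \<open>z\<close> and the remaining ones would disconnect \<open>\<Omega>\<close>.\<close>

lemma center_reachable:
  assumes e: "e > 0" and c: "ball c radius \<subseteq> \<Omega>"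
  shows "(z, c) \<in> (chain_rel inner_set e)\<^sup>*"
proof (rule ccontr)
  assume nc: "(z, c) \<notin> (chain_rel inner_set e)\<^sup>*"
  define U where "U = (\<Union>b\<in>{b. ball b radius \<subseteq> \<Omega> \<and> (z, b) \<in> (chain_rel inner_set e)\<^sup>*}. ball b radius)"
  define V where "V = (\<Union>b\<in>{b. ball b radius \<subseteq> \<Omega> \<and> (z, b) \<notin> (chain_rel inner_set e)\<^sup>*}. ball b radius)"
  have "open U" "open V" unfolding U_def V_def by auto
  moreover have "\<Omega> \<subseteq> U \<union> V"
  proof
    fix x assume "x \<in> \<Omega>"
    then obtain b where "ball b radius \<subseteq> \<Omega>" "x \<in> ball b radius" by (rule centers_cover)
    then show "x \<in> U \<union> V" unfolding U_def V_def by blast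
  qed
  moreover have "U \<inter> V \<inter> \<Omega> = {}"
  proof (rule ccontr)
    assume "U \<inter> V \<inter> \<Omega> \<noteq> {}"
    then obtain x where "x \<in> U" "x \<in> V" by blast
    obtain b where b: "ball b radius \<subseteq> \<Omega>" "(z, b) \<in> (chain_rel inner_set e)\<^sup>*" "x \<in> ball b radius"
      using \<open>x \<in> U\<close> unfolding U_def by blast
    obtain b' where b': "ball b' radius \<subseteq> \<Omega>" "(z, b') \<notin> (chain_rel inner_set e)\<^sup>*" "x \<in> ball b' radius"
      using \<open>x \<in> V\<close> unfolding V_def by blast
    have "dist b b' < 2 * radius" using b(3) b'(3) dist_triangle2[of b b' x] by simp
    then have "(b, b') \<in> (chain_rel inner_set e)\<^sup>*"
      using overlap_segment[OF b(1) b'(1)] e by (intro chain_rel_segment) auto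
    then show False using b(2) b'(2) by (meson rtrancl_trans)
  qed
  moreover have "z \<in> U \<inter> \<Omega>" unfolding U_def using ball_z z radius_pos by auto
  moreover have "c \<in> V \<inter> \<Omega>" unfolding V_def using c nc radius_pos by auto
  ultimately show False using connectedD[OF connected_dom, of U V] by blast
qed

section \<open>Propagation from the critical point\<close>

definition step :: real where "step = neck / 8"

definition chain_const :: real where
  "chain_const = 2 * real ((covering_number TYPE('n) d (step / 2))\<^sup>2) + 1"

text \<open>The Hessian bound at depth neck / 4 times the step length; the factor N comes from the
  sum over the coordinates.\<close>

definition hess_step :: real where
  "hess_step = real CARD('n) * step * (hessian_const TYPE('n) * (neck / 4) powr (- (real CARD('n) + 1) / 2))"

definition grad_center_const :: real where "grad_center_const = chain_const * hess_step"

definition value_center_const :: real where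
  "value_center_const = chain_const * (real CARD('n) * step * (grad_center_const + hess_step))"

lemma const_nonneg:
  "step > 0" "chain_const \<ge> 0" "hess_step \<ge> 0" "grad_center_const \<ge> 0" "value_center_const \<ge> 0"
proof -
  show s: "step > 0" unfolding step_def using neck_pos by simp
  show c: "chain_const \<ge> 0" unfolding chain_const_def by simp
  show h: "hess_step \<ge> 0" unfolding hess_step_def using s hessian_const_nonneg[where ?'n='n] by simp
  show g: "grad_center_const \<ge> 0" unfolding grad_center_const_def using c h by simp
  show "value_center_const \<ge> 0" unfolding value_center_const_def using s c h g by simp
qed

text \<open>Moving by neck / 8 from depth neck / 2 stays deeper than neck / 4, which explains the
  value of \<open>step\<close>.\<close>

lemma inner_step_segment:
  assumes "x \<in> inner_set" "norm v \<le> step" "s \<in> {0..1}"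
  shows "x + s *\<^sub>R v \<in> \<Omega>" "neck / 4 \<le> boundary_dist \<Omega> (x + s *\<^sub>R v)"
proof -
  have "norm (s *\<^sub>R v) \<le> 1 * step" using assms(2,3) const_nonneg(1) unfolding norm_scaleR by (intro mult_mono) auto
  then have d: "dist x (x + s *\<^sub>R v) \<le> neck / 8" unfolding step_def by (simp add: dist_norm)
  have x: "x \<in> \<Omega>" "neck / 2 \<le> boundary_dist \<Omega> x" using assms(1) unfolding inner_set_def by auto
  show "neck / 4 \<le> boundary_dist \<Omega> (x + s *\<^sub>R v)"
    using boundary_dist_triangle[of \<Omega> x "x + s *\<^sub>R v"] d x(2) neck_pos by linarith
  show "x + s *\<^sub>R v \<in> \<Omega>"
    using ball_boundary_dist[OF x(1)] d x(2) neck_pos by (force simp: subset_iff)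
qed

lemma gradient_step:
  assumes "x \<in> inner_set" "norm v \<le> step"
  shows "\<bar>partial_deriv i h (x + v) - partial_deriv i h x\<bar> \<le> hess_step * hess_norm"
proof -
  define M where "M = hessian_const TYPE('n) * hess_norm * (neck / 4) powr (- (real CARD('n) + 1) / 2)"
  have M0: "M \<ge> 0" unfolding M_def using hessian_const_nonneg[where ?'n='n] hess_norm_nonneg by simp
  have "\<bar>partial_deriv i h (x + v) - partial_deriv i h x\<bar> \<le> real CARD('n) * norm v * M"
  proof (rule C1_on_segment_bound[OF open_dom C2_on_C1(1)[OF C2_dh] inner_step_segment(1)[OF assms]])
    fix s j assume s: "s \<in> {0..1::real}"
    note w = inner_step_segment[OF assms s]
    have "\<bar>partial_deriv j (partial_deriv i h) (x + s *\<^sub>R v)\<bar>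
        \<le> hessian_const TYPE('n) * hess_norm * boundary_dist \<Omega> (x + s *\<^sub>R v) powr (- (real CARD('n) + 1) / 2)"
      by (rule hessian_bound[OF w(1)])
    also have "\<dots> \<le> M"
      unfolding M_def using w(2) neck_pos hessian_const_nonneg[where ?'n='n] hess_norm_nonneg
      by (intro mult_left_mono powr_mono2') auto
    finally show "\<bar>partial_deriv j (partial_deriv i h) (x + s *\<^sub>R v)\<bar> \<le> M" .
  qed
  also have "\<dots> \<le> real CARD('n) * step * M" using assms(2) M0 by (intro mult_right_mono mult_left_mono) auto
  also have "\<dots> = hess_step * hess_norm" unfolding hess_step_def M_def by simp
  finally show ?thesis .
qed

text \<open>\<open>inner_set\<close> may have pieces that no chain from \<open>z\<close> reaches. On
  the reachable part the gradient is controlled, as the chain argument for the values of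
  \<open>h\<close> requires at each of its points.\<close>

definition reach_set :: "(real^'n) set" where
  "reach_set = {x \<in> inner_set. (z, x) \<in> (chain_rel inner_set step)\<^sup>*}"

lemma z_inner: "z \<in> inner_set"
  unfolding inner_set_def using z boundary_dist_ge_of_ball[OF ball_z] neck_pos neck_le by auto

text \<open>Initial parts of a chain from \<open>z\<close> are chains from \<open>z\<close>, so the
  chain never leaves \<open>reach_set\<close>.\<close>

lemma reach_chain: "x \<in> reach_set \<Longrightarrow> (z, x) \<in> (chain_rel reach_set step)\<^sup>*"
proof -
  have "(z, x) \<in> (chain_rel reach_set step)\<^sup>*" if "(z, x) \<in> (chain_rel inner_set step)\<^sup>*" for x
    using that
  proof (induction rule: rtrancl_induct)
    case (step y w)
    then have "(y, w) \<in> chain_rel reach_set step"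
      unfolding chain_rel_def reach_set_def
      by (auto intro: rtrancl_into_rtrancl simp: chain_rel_def)
    then show ?case using step by (meson rtrancl.rtrancl_into_rtrancl)
  qed simp
  then show "x \<in> reach_set \<Longrightarrow> (z, x) \<in> (chain_rel reach_set step)\<^sup>*" unfolding reach_set_def by blast
qed

lemma reach_bound:
  fixes F :: "real^'n \<Rightarrow> real"
  assumes B: "B \<ge> 0" and st: "\<And>x y. x \<in> reach_set \<Longrightarrow> y \<in> reach_set \<Longrightarrow> dist x y \<le> step \<Longrightarrow> dist (F x) (F y) \<le> B"
    and x: "x \<in> reach_set"
  shows "\<bar>F x - F z\<bar> \<le> chain_const * B"
proof -
  obtain X where X: "finite X" "card X = covering_number TYPE('n) d (step / 2)" "cball z d \<subseteq> (\<Union>a\<in>X. ball a (step / 2))"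
    using covering_number_cball[of "step / 2" d z] const_nonneg(1) by auto
  have "reach_set \<subseteq> cball z d"
  proof
    fix x assume "x \<in> reach_set"
    then have "x \<in> closure \<Omega>" using closure_subset unfolding reach_set_def inner_set_def by auto
    then show "x \<in> cball z d" using dist_le_diameter closure_subset z by auto
  qed
  moreover have "z \<in> reach_set" unfolding reach_set_def using z_inner by simp
  ultimately have "dist (F z) (F x) \<le> (2 * real ((card X)\<^sup>2) + 1) * B"
    using X by (intro chain_dist_bound[OF X(1) _ B st reach_chain[OF x]]) auto
  then show ?thesis unfolding chain_const_def X(2) by (simp add: dist_real_def)
qed

lemma gradient_reach:
  assumes "x \<in> reach_set"
  shows "\<bar>partial_deriv i h x\<bar> \<le> grad_center_const * hess_norm"
proof -
  have "\<bar>partial_deriv i h x - partial_deriv i h z\<bar> \<le> chain_const * (hess_step * hess_norm)"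
  proof (rule reach_bound[OF _ _ assms])
    fix x y assume "x \<in> reach_set" "y \<in> reach_set" "dist x y \<le> step"
    then show "dist (partial_deriv i h x) (partial_deriv i h y) \<le> hess_step * hess_norm"
      using gradient_step[of x "y - x" i] unfolding reach_set_def
      by (simp add: dist_norm norm_minus_commute abs_minus_commute)
  qed (use const_nonneg hess_norm_nonneg in simp)
  then show ?thesis unfolding grad_center_const_def partial_deriv_h_z by simp
qed

text \<open>A second pass over the chains: along one step the gradient is at most its bound at the
  starting point plus the change over the step.\<close>

lemma value_reach:
  assumes "x \<in> reach_set"
  shows "\<bar>h x - h z\<bar> \<le> value_center_const * hess_norm"
proof -
  define M where "M = (grad_center_const + hess_step) * hess_norm"
  have M0: "M \<ge> 0" unfolding M_def using const_nonneg hess_norm_nonneg by simp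
  have "\<bar>h x - h z\<bar> \<le> chain_const * (real CARD('n) * step * M)"
  proof (rule reach_bound[OF _ _ assms])
    fix x y assume xy: "x \<in> reach_set" "y \<in> reach_set" "dist x y \<le> step"
    define v where "v = y - x"
    have v: "norm v \<le> step" using xy(3) unfolding v_def by (simp add: dist_norm norm_minus_commute)
    have x: "x \<in> inner_set" using xy unfolding reach_set_def by blast
    have "\<bar>h (x + v) - h x\<bar> \<le> real CARD('n) * norm v * M"
    proof (rule C1_on_segment_bound[OF open_dom C2_on_C1(1)[OF C2_h] inner_step_segment(1)[OF x v]])
      fix s j assume s: "s \<in> {0..1::real}"
      have "norm (s *\<^sub>R v) \<le> 1 * norm v" using s unfolding norm_scaleR by (intro mult_right_mono) auto
      then show "\<bar>partial_deriv j h (x + s *\<^sub>R v)\<bar> \<le> M"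
        using gradient_step[OF x, of "s *\<^sub>R v" j] v gradient_reach[OF xy(1), of j] unfolding M_def
        by (simp add: algebra_simps)
    qed
    also have "\<dots> \<le> real CARD('n) * step * M" using v M0 by (intro mult_right_mono mult_left_mono) auto
    finally show "dist (h x) (h y) \<le> real CARD('n) * step * M" unfolding v_def by (simp add: dist_real_def)
  qed (use const_nonneg M0 in simp)
  then show ?thesis unfolding value_center_const_def M_def by (simp add: mult_ac)
qed

lemma center_in_reach: "ball c radius \<subseteq> \<Omega> \<Longrightarrow> c \<in> reach_set"
proof -
  assume c: "ball c radius \<subseteq> \<Omega>"
  have "c \<in> \<Omega>" using c radius_pos by auto
  then have "c \<in> inner_set"
    unfolding inner_set_def using boundary_dist_ge_of_ball[OF c] neck_le neck_pos by auto
  then show "c \<in> reach_set" unfolding reach_set_def using center_reachable[OF const_nonneg(1) c] by blast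
qed

end

section \<open>The stability estimate\<close>

text \<open>The two terms balance at eps = \<open>G powr (1 / a)\<close>. If this exceeds
  \<open>r\<close>, then D \<le> d \<le> (d / r) * eps suffices. For G = 0 the right side is 0,
  because \<open>0 powr (1 / a)\<close> is 0, and D \<le> 0 comes from letting eps shrink.\<close>

lemma powr_optimize:
  fixes G D C d r a :: real
  assumes a: "a > 1" and r: "r > 0" and C: "C \<ge> 0" and G: "G \<ge> 0" and d: "D \<le> d" "d \<ge> 0"
    and bound: "\<And>\<epsilon>. 0 < \<epsilon> \<Longrightarrow> \<epsilon> \<le> r \<Longrightarrow> D \<le> C * (G * \<epsilon> powr (1 - a) + \<epsilon>)"
  shows "D \<le> (2 * C + d / r) * G powr (1 / a)"
proof (cases "G = 0")
  case True
  have "D \<le> 0 + e" if "e > 0" for e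
  proof -
    define \<epsilon> where "\<epsilon> = min r (e / (C + 1))"
    have \<epsilon>: "0 < \<epsilon>" "\<epsilon> \<le> r" "\<epsilon> \<le> e / (C + 1)" unfolding \<epsilon>_def using r that C by auto
    have "D \<le> C * \<epsilon>" using bound[OF \<epsilon>(1,2)] True by simp
    also have "\<dots> \<le> (C + 1) * (e / (C + 1))" using \<epsilon> C by (intro mult_mono) auto
    finally show ?thesis using C by simp
  qed
  then have "D \<le> 0" by (rule field_le_epsilon)
  then show ?thesis using True by simp
next
  case False
  define \<epsilon> where "\<epsilon> = G powr (1 / a)"
  have \<epsilon>: "\<epsilon> > 0" unfolding \<epsilon>_def using False by simp
  show ?thesis
  proof (cases "\<epsilon> \<le> r")
    case True
    have "G * \<epsilon> powr (1 - a) = G powr 1 * G powr ((1 / a) * (1 - a))"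
      unfolding \<epsilon>_def powr_powr using G by simp
    also have "\<dots> = G powr (1 / a)"
    proof -
      have "1 + (1 / a) * (1 - a) = 1 / a" using a by (simp add: field_simps)
      then show ?thesis unfolding powr_add[symmetric] by simp
    qed
    finally have "D \<le> C * (\<epsilon> + \<epsilon>)" using bound[OF \<epsilon> True] unfolding \<epsilon>_def by simp
    also have "\<dots> \<le> (2 * C + d / r) * \<epsilon>" using d r \<epsilon> by (simp add: algebra_simps)
    finally show ?thesis unfolding \<epsilon>_def .
  next
    case False
    have "D \<le> d / r * r" using d r by simp
    also have "\<dots> \<le> d / r * \<epsilon>" using False d r by (intro mult_left_mono) auto
    also have "\<dots> \<le> (2 * C + d / r) * \<epsilon>" using C \<epsilon> by (intro mult_right_mono) auto
    finally show ?thesis unfolding \<epsilon>_def .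
  qed
qed

text \<open>Comparison with the primitive K * s^b / b. Both signs of \<open>b\<close> occur:
  -\<alpha> for the gradient, a positive or negative exponent for the values along the normal, and 1
  next to the boundary.\<close>

lemma powr_bound_integrate:
  fixes f :: "real \<Rightarrow> real"
  assumes t: "0 < t" "t \<le> r" and b: "b \<noteq> 0"
    and f: "\<And>s. t \<le> s \<Longrightarrow> s \<le> r \<Longrightarrow> (f has_real_derivative f' s) (at s)"
    and f': "\<And>s. t \<le> s \<Longrightarrow> s \<le> r \<Longrightarrow> \<bar>f' s\<bar> \<le> K * s powr (b - 1)"
  shows "\<bar>f r - f t\<bar> \<le> K * (r powr b - t powr b) / b"
proof (cases "t = r")
  case False
  define \<phi> where "\<phi> s = K * s powr b / b" for s
  have \<phi>: "(\<phi> has_real_derivative K * s powr (b - 1)) (at s)" if "s > 0" for s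
    unfolding \<phi>_def using that b by (auto intro!: derivative_eq_intros)
  have "norm (f r - f t) \<le> \<phi> r - \<phi> t"
  proof (rule differentiable_bound_general[where f'=f' and \<phi>'="\<lambda>s. K * s powr (b - 1)"])
    show "t < r" using t False by simp
    show "continuous_on {t..r} f"
      by (rule continuous_at_imp_continuous_on) (use f[THEN DERIV_isCont] in auto)
    show "continuous_on {t..r} \<phi>"
      by (rule continuous_at_imp_continuous_on) (use \<phi>[THEN DERIV_isCont] t in auto)
  qed (use f \<phi> f' t in \<open>auto simp: has_real_derivative_iff_has_vector_derivative[symmetric]\<close>)
  then show ?thesis unfolding \<phi>_def by (simp add: right_diff_distrib diff_divide_distrib)
qed simp

section \<open>Estimates along normals and the choice of depth\<close>

context torsion_problem
begin

lemma h_continuous: "continuous_on (closure \<Omega>) h"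
  unfolding h_def by (intro continuous_intros continuous_u) simp

lemma \<delta>_pos: "\<delta> > 0"
  using boundary_dist_pos[OF z] dist_z by simp

text \<open>On the frontier u = 0, so a difference of squared norms is twice a difference of
  \<open>h\<close>, and \<open>a\<close> cancels. Division by the sum of the two norms, at least 2 *
  \<delta>, makes this linear.\<close>

lemma radii_difference:
  assumes B: "\<And>p. p \<in> frontier \<Omega> \<Longrightarrow> \<bar>h p - h z\<bar> \<le> B"
  shows "outer_radius \<Omega> z - inner_radius \<Omega> z \<le> 2 * B / \<delta>"
proof -
  have diff: "norm (p - z) - norm (q - z) \<le> 2 * B / \<delta>" if pq: "p \<in> frontier \<Omega>" "q \<in> frontier \<Omega>" for p q
  proof (cases "norm (p - z) \<le> norm (q - z)")
    case True
    have "0 \<le> B" using B[OF pq(1)] by linarith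
    then have "0 \<le> 2 * B / \<delta>" using \<delta>_pos by simp
    then show ?thesis using True by linarith
  next
    case False
    have "(norm (p - z))\<^sup>2 - (norm (q - z))\<^sup>2 = 2 * (h p - h q)"
      unfolding h_def using u_frontier pq by (simp add: field_simps)
    also have "2 * (h p - h q) \<le> 4 * B"
    proof -
      have "h p - h z \<le> B" "h z - h q \<le> B"
        using B[OF pq(1)] B[OF pq(2)] by (auto simp: abs_le_iff)
      then have "(h p - h z) + (h z - h q) \<le> B + B" by (rule add_mono)
      then show ?thesis by simp
    qed
    finally have 1: "(norm (p - z) - norm (q - z)) * (norm (p - z) + norm (q - z)) \<le> 4 * B"
      by (simp add: power2_eq_square algebra_simps)
    have "\<delta> \<le> norm (p - z)" "\<delta> \<le> norm (q - z)"
      using boundary_dist_le[OF pq(1), of z] boundary_dist_le[OF pq(2), of z] dist_z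
      by (auto simp: dist_norm norm_minus_commute)
    then have "(norm (p - z) - norm (q - z)) * (2 * \<delta>) \<le> (norm (p - z) - norm (q - z)) * (norm (p - z) + norm (q - z))"
      using False by (intro mult_left_mono) auto
    with 1 have "(norm (p - z) - norm (q - z)) * (2 * \<delta>) \<le> 4 * B" by linarith
    then show ?thesis using \<delta>_pos by (simp add: field_simps)
  qed
  have "outer_radius \<Omega> z \<le> 2 * B / \<delta> + inner_radius \<Omega> z"
    unfolding outer_radius_def
  proof (rule cSUP_least[OF frontier_nonempty])
    fix p assume p: "p \<in> frontier \<Omega>"
    have "norm (p - z) - 2 * B / \<delta> \<le> inner_radius \<Omega> z"
      unfolding inner_radius_def
      by (rule cINF_greatest[OF frontier_nonempty]) (use diff[OF p] in \<open>simp add: algebra_simps\<close>)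
    then show "norm (p - z) \<le> 2 * B / \<delta> + inner_radius \<Omega> z" by simp
  qed
  then show ?thesis by simp
qed

text \<open>The trivial bound for the case of \<open>powr_optimize\<close> in which the norm is
  large.\<close>

lemma radii_difference_le_diameter: "outer_radius \<Omega> z - inner_radius \<Omega> z \<le> d"
proof -
  have "outer_radius \<Omega> z \<le> d"
    unfolding outer_radius_def
  proof (rule cSUP_least[OF frontier_nonempty])
    fix p assume "p \<in> frontier \<Omega>"
    then show "norm (p - z) \<le> d"
      using dist_le_diameter[of p z] frontier_subset_closure closure_subset[THEN subsetD, OF z] by (auto simp: dist_norm)
  qed
  moreover have "inner_radius \<Omega> z \<ge> 0"
    unfolding inner_radius_def by (rule cINF_greatest[OF frontier_nonempty]) simp
  ultimately show ?thesis by simp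
qed

definition \<alpha> :: real where "\<alpha> = (real CARD('n) - 1) / 2"

text \<open>The first summand is the gradient bound at the center, absorbed through 1 \<le> (radius
  / t)^\<alpha>; the second is the integral of the Hessian bound, of order t^(-\<alpha>-1).\<close>

definition grad_const :: real where
  "grad_const = grad_center_const * radius powr \<alpha> + real CARD('n) * hessian_const TYPE('n) / \<alpha>"

text \<open>The last factor pays for relaxing the exponent: s^(-\<alpha>) \<le> radius^(b-\<alpha>)
  * s^(-b) for s \<le> radius.\<close>

definition line_const :: "real \<Rightarrow> real" where
  "line_const b = real CARD('n) * grad_const * radius powr (b - \<alpha>)"

definition boundary_const :: real where
  "boundary_const = real CARD('n) * (d + lipschitz_const)"

lemma boundary_const_nonneg: "boundary_const \<ge> 0"
  unfolding boundary_const_def using diameter_nonneg lipschitz_const_nonneg by simp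

text \<open>\<open>b\<close> takes the place of \<alpha> in the integration along the normal. It can
  equal \<alpha> for N = 2 and N \<ge> 4, whereas N = 3 has \<alpha> = 1, for which no power is a
  primitive, and needs b > 1.\<close>

lemma boundary_value_bound:
  assumes N: "CARD('n) \<ge> 2" and p: "p \<in> frontier \<Omega>" and \<epsilon>: "0 < \<epsilon>" "\<epsilon> \<le> radius" and b: "\<alpha> \<le> b" "b \<noteq> 1"
  shows "\<bar>h p - h z\<bar> \<le> value_center_const * hess_norm +
    line_const b * hess_norm * (radius powr (1 - b) - \<epsilon> powr (1 - b)) / (1 - b) + boundary_const * \<epsilon>"
    and "grad_const \<ge> 0"
proof -
  define n where "n = real CARD('n)"
  have n: "n \<ge> 2" using N unfolding n_def by simp
  have \<alpha>: "\<alpha> > 0" unfolding \<alpha>_def using n n_def by simp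
  have hc: "hessian_const TYPE('n) \<ge> 0" by (rule hessian_const_nonneg)
  note r = radius_pos
  show g0: "grad_const \<ge> 0"
    unfolding grad_const_def using const_nonneg hc \<alpha> r by simp
  obtain \<nu> where \<nu>: "norm \<nu> = 1" "ball (p + r\<^sub>i *\<^sub>R \<nu>) r\<^sub>i \<subseteq> \<Omega>"
    using interior_normal[OF p] by metis
  define x where "x t = p + t *\<^sub>R \<nu>" for t
  have inball: "ball (x t) t \<subseteq> \<Omega>" if "0 < t" "t \<le> radius" for t
    unfolding x_def using normal_point_in_domain[OF \<nu>] that r by auto
  have in\<Omega>: "x t \<in> \<Omega>" if "0 < t" "t \<le> radius" for t
    using inball[OF that] that by auto
  have dist: "t \<le> boundary_dist \<Omega> (x t)" if "0 < t" "t \<le> radius" for t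
    using boundary_dist_ge_of_ball[OF inball[OF that]] .
  have sum_bound: "\<bar>\<Sum>j\<in>UNIV. \<nu> $ j * w j\<bar> \<le> n * K" if "\<And>j. \<bar>w j\<bar> \<le> K" for w K
  proof -
    have "\<bar>\<Sum>j\<in>UNIV. \<nu> $ j * w j\<bar> \<le> (\<Sum>j\<in>(UNIV::'n set). \<bar>\<nu> $ j * w j\<bar>)" by (rule sum_abs)
    also have "\<dots> \<le> (\<Sum>j\<in>(UNIV::'n set). norm \<nu> * K)"
      unfolding abs_mult by (intro sum_mono mult_mono component_le_norm_cart that) auto
    finally show ?thesis using \<nu>(1) unfolding n_def by simp
  qed
  have cr: "x radius \<in> reach_set" by (rule center_in_reach[OF inball]) (use r in auto)
  have grad: "\<bar>partial_deriv i h (x t)\<bar> \<le> grad_const * hess_norm * t powr (- \<alpha>)" if t: "0 < t" "t \<le> radius" for i t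
  proof -
    define K where "K = n * (hessian_const TYPE('n) * hess_norm)"
    have K0: "K \<ge> 0" unfolding K_def using hc hess_norm_nonneg n by simp
    have "\<bar>partial_deriv i h (x radius) - partial_deriv i h (x t)\<bar> \<le> K * (radius powr (- \<alpha>) - t powr (- \<alpha>)) / (- \<alpha>)"
    proof (rule powr_bound_integrate[OF t])
      fix s assume "t \<le> s" "s \<le> radius"
      then have s: "0 < s" "s \<le> radius" using t by auto
      show "((\<lambda>s. partial_deriv i h (x s)) has_real_derivative
          (\<Sum>j\<in>UNIV. \<nu> $ j * partial_deriv j (partial_deriv i h) (x s))) (at s)"
        using C1_on_line_derivative[OF C2_on_C1(1)[OF C2_dh] open_dom in\<Omega>[OF s, unfolded x_def]] unfolding x_def .
      have "\<bar>partial_deriv j (partial_deriv i h) (x s)\<bar> \<le> hessian_const TYPE('n) * hess_norm * s powr (- \<alpha> - 1)" for j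
      proof -
        have e: "- (real CARD('n) + 1) / 2 = - \<alpha> - 1" unfolding \<alpha>_def by (simp add: field_simps)
        have "\<bar>partial_deriv j (partial_deriv i h) (x s)\<bar> \<le> hessian_const TYPE('n) * hess_norm * boundary_dist \<Omega> (x s) powr (- \<alpha> - 1)"
          using hessian_bound[OF in\<Omega>[OF s]] unfolding e .
        also have "\<dots> \<le> hessian_const TYPE('n) * hess_norm * s powr (- \<alpha> - 1)"
          using dist[OF s] s \<alpha> hc hess_norm_nonneg by (intro mult_left_mono powr_mono2') auto
        finally show ?thesis .
      qed
      from sum_bound[OF this]
      show "\<bar>\<Sum>j\<in>UNIV. \<nu> $ j * partial_deriv j (partial_deriv i h) (x s)\<bar> \<le> K * s powr (- \<alpha> - 1)"
        unfolding K_def by (simp add: mult_ac)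
    qed (use \<alpha> in auto)
    also have "\<dots> = K * (t powr (- \<alpha>) - radius powr (- \<alpha>)) / \<alpha>" using \<alpha> by (simp add: field_simps)
    also have "\<dots> \<le> K * t powr (- \<alpha>) / \<alpha>"
      using K0 \<alpha> by (intro divide_right_mono mult_left_mono) auto
    finally have 1: "\<bar>partial_deriv i h (x radius) - partial_deriv i h (x t)\<bar> \<le> K * t powr (- \<alpha>) / \<alpha>" .
    have "1 \<le> radius powr \<alpha> * t powr (- \<alpha>)"
    proof -
      have "radius powr (- \<alpha>) \<le> t powr (- \<alpha>)" using t \<alpha> by (intro powr_mono2') auto
      then have "radius powr \<alpha> * radius powr (- \<alpha>) \<le> radius powr \<alpha> * t powr (- \<alpha>)" by (intro mult_left_mono) auto
      then show ?thesis using r by (simp add: powr_add[symmetric])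
    qed
    then have "grad_center_const * hess_norm * 1 \<le> grad_center_const * hess_norm * (radius powr \<alpha> * t powr (- \<alpha>))"
      using const_nonneg hess_norm_nonneg by (intro mult_left_mono) auto
    with 1 gradient_reach[OF cr, of i]
    have "\<bar>partial_deriv i h (x t)\<bar> \<le> grad_center_const * hess_norm * (radius powr \<alpha> * t powr (- \<alpha>)) + K * t powr (- \<alpha>) / \<alpha>"
      by linarith
    also have "\<dots> = grad_const * hess_norm * t powr (- \<alpha>)"
      unfolding grad_const_def K_def n_def by (simp add: algebra_simps)
    finally show ?thesis .
  qed
  have deriv: "((\<lambda>s. h (x s)) has_real_derivative (\<Sum>j\<in>UNIV. \<nu> $ j * partial_deriv j h (x s))) (at s)"
    if "0 < s" "s \<le> radius" for s
    using C1_on_line_derivative[OF C2_on_C1(1)[OF C2_h] open_dom in\<Omega>[OF that, unfolded x_def]] unfolding x_def .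
  have A: "\<bar>h (x radius) - h (x \<epsilon>)\<bar> \<le> line_const b * hess_norm * (radius powr (1 - b) - \<epsilon> powr (1 - b)) / (1 - b)"
  proof (rule powr_bound_integrate[OF \<epsilon>])
    fix s assume "\<epsilon> \<le> s" "s \<le> radius"
    then have s: "0 < s" "s \<le> radius" using \<epsilon> by auto
    show "((\<lambda>s. h (x s)) has_real_derivative (\<Sum>j\<in>UNIV. \<nu> $ j * partial_deriv j h (x s))) (at s)"
      by (rule deriv[OF s])
    have "s powr (- \<alpha>) = s powr (b - \<alpha>) * s powr (- b)" by (simp add: powr_add[symmetric])
    also have "\<dots> \<le> radius powr (b - \<alpha>) * s powr (- b)"
      using s b by (intro mult_right_mono powr_mono2) auto
    finally have 1: "n * (grad_const * hess_norm) * s powr (- \<alpha>) \<le> n * (grad_const * hess_norm) * (radius powr (b - \<alpha>) * s powr (- b))"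
      using n g0 hess_norm_nonneg by (intro mult_left_mono) auto
    have "\<bar>\<Sum>j\<in>UNIV. \<nu> $ j * partial_deriv j h (x s)\<bar> \<le> n * (grad_const * hess_norm * s powr (- \<alpha>))"
      by (rule sum_bound[OF grad[OF s]])
    also have "\<dots> \<le> line_const b * hess_norm * s powr (1 - b - 1)"
      using 1 unfolding line_const_def n_def by (simp add: mult_ac)
    finally show "\<bar>\<Sum>j\<in>UNIV. \<nu> $ j * partial_deriv j h (x s)\<bar> \<le> line_const b * hess_norm * s powr (1 - b - 1)" .
  qed (use b in auto)
  have near: "\<bar>h (x \<epsilon>) - h (x s)\<bar> \<le> boundary_const * \<epsilon>" if s: "0 < s" "s \<le> \<epsilon>" for s
  proof -
    have "\<bar>h (x \<epsilon>) - h (x s)\<bar> \<le> boundary_const * (\<epsilon> powr 1 - s powr 1) / 1"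
    proof (rule powr_bound_integrate[OF s])
      fix w assume "s \<le> w" "w \<le> \<epsilon>"
      then have w: "0 < w" "w \<le> radius" using s \<epsilon> by auto
      show "((\<lambda>s. h (x s)) has_real_derivative (\<Sum>j\<in>UNIV. \<nu> $ j * partial_deriv j h (x w))) (at w)"
        by (rule deriv[OF w])
      show "\<bar>\<Sum>j\<in>UNIV. \<nu> $ j * partial_deriv j h (x w)\<bar> \<le> boundary_const * w powr (1 - 1)"
        using sum_bound[OF partial_deriv_h_bound[OF in\<Omega>[OF w]]] w unfolding boundary_const_def n_def by simp
    qed simp
    also have "\<dots> \<le> boundary_const * \<epsilon>"
      using s \<epsilon> boundary_const_nonneg by (simp add: mult_left_mono)
    finally show ?thesis .
  qed
  \<comment> \<open>At p itself \<open>h\<close> is merely continuous from the closure, so the bound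
    at depth s is passed to the limit as s tends to 0.\<close>
  have "\<bar>h (x \<epsilon>) - h p\<bar> \<le> boundary_const * \<epsilon>"
  proof -
    have "(x \<longlongrightarrow> x 0) (at_right 0)" unfolding x_def by (intro tendsto_intros)
    moreover have "\<forall>\<^sub>F s in at_right 0. x s \<in> closure \<Omega>"
      unfolding eventually_at_right_field using in\<Omega> closure_subset r by (intro exI[of _ radius]) (force simp: less_imp_le)
    ultimately have "((\<lambda>s. h (x s)) \<longlongrightarrow> h (x 0)) (at_right 0)"
      using continuous_on_tendsto_compose[OF h_continuous] p frontier_subset_closure unfolding x_def by auto
    then have "((\<lambda>s. \<bar>h (x \<epsilon>) - h (x s)\<bar>) \<longlongrightarrow> \<bar>h (x \<epsilon>) - h (x 0)\<bar>) (at_right 0)"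
      by (intro tendsto_intros)
    moreover have "\<forall>\<^sub>F s in at_right 0. \<bar>h (x \<epsilon>) - h (x s)\<bar> \<le> boundary_const * \<epsilon>"
      unfolding eventually_at_right_field using near \<epsilon> by (intro exI[of _ \<epsilon>]) auto
    ultimately have "\<bar>h (x \<epsilon>) - h (x 0)\<bar> \<le> boundary_const * \<epsilon>"
      by (intro tendsto_upperbound) auto
    then show ?thesis unfolding x_def by simp
  qed
  then show "\<bar>h p - h z\<bar> \<le> value_center_const * hess_norm +
      line_const b * hess_norm * (radius powr (1 - b) - \<epsilon> powr (1 - b)) / (1 - b) + boundary_const * \<epsilon>"
    using A value_reach[OF cr] by linarith
qed

definition planar_const :: real where
  "planar_const = 2 / \<delta> * (value_center_const + line_const (1/2) * radius powr (1/2) * 2)"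

text \<open>With \<alpha> = 1/2 the powers of eps stay bounded, so eps may tend to 0 and the
  boundary term disappears. The trailing factor 2 in \<open>planar_const\<close> is 1 / (1 -
  1/2).\<close>

lemma planar_estimate:
  assumes N: "CARD('n) = 2"
  shows "outer_radius \<Omega> z - inner_radius \<Omega> z \<le> planar_const * hess_norm"
proof -
  define M where "M = value_center_const * hess_norm + line_const (1/2) * hess_norm * (radius powr (1/2) * 2)"
  have \<alpha>: "\<alpha> = 1/2" unfolding \<alpha>_def using N by simp
  have "\<bar>h p - h z\<bar> \<le> M" if p: "p \<in> frontier \<Omega>" for p
  proof (rule field_le_epsilon)
    fix e :: real assume e: "e > 0"
    define \<epsilon> where "\<epsilon> = min radius (e / (boundary_const + 1))"
    have \<epsilon>: "0 < \<epsilon>" "\<epsilon> \<le> radius" "\<epsilon> \<le> e / (boundary_const + 1)"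
      unfolding \<epsilon>_def using radius_pos e boundary_const_nonneg by auto
    note b = boundary_value_bound[OF _ p \<epsilon>(1,2), of "1/2"]
    have "0 \<le> line_const (1/2) * hess_norm"
      unfolding line_const_def using b(2) N \<alpha> hess_norm_nonneg by simp
    then have "line_const (1/2) * hess_norm * (radius powr (1/2) - \<epsilon> powr (1/2)) \<le> line_const (1/2) * hess_norm * radius powr (1/2)"
      by (intro mult_left_mono) auto
    moreover have "x / (1/2) \<le> c * (R * 2)" if "x \<le> c * R" for x c R :: real
      using that by simp
    ultimately have "line_const (1/2) * hess_norm * (radius powr (1/2) - \<epsilon> powr (1/2)) / (1/2) \<le> line_const (1/2) * hess_norm * (radius powr (1/2) * 2)"
      by blast
    moreover have "boundary_const * \<epsilon> \<le> (boundary_const + 1) * (e / (boundary_const + 1))"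
      using \<epsilon> boundary_const_nonneg by (intro mult_mono) auto
    moreover have "(boundary_const + 1) * (e / (boundary_const + 1)) = e"
      using boundary_const_nonneg by simp
    moreover have "\<bar>h p - h z\<bar> \<le> value_center_const * hess_norm +
        line_const (1/2) * hess_norm * (radius powr (1/2) - \<epsilon> powr (1/2)) / (1/2) + boundary_const * \<epsilon>"
      using b(1) N \<alpha> by simp
    ultimately show "\<bar>h p - h z\<bar> \<le> M + e" unfolding M_def by linarith
  qed
  then have "outer_radius \<Omega> z - inner_radius \<Omega> z \<le> 2 * M / \<delta>" by (rule radii_difference)
  then show ?thesis unfolding M_def planar_const_def by (simp add: algebra_simps add_divide_distrib)
qed

text \<open>The factor 2 / \<delta> stems from \<open>radii_difference\<close>. The contribution
  without eps is brought to the form eps^(1-b) through 1 \<le> (radius / eps)^(b-1).\<close>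

definition stability_pre_const :: "real \<Rightarrow> real" where
  "stability_pre_const b = 2 / \<delta> *
     (value_center_const * radius powr (b - 1) + line_const b / (b - 1) + boundary_const)"

definition stability_const :: "real \<Rightarrow> real" where
  "stability_const b = 2 * stability_pre_const b + d / radius"

lemma power_estimate:
  assumes N: "CARD('n) \<ge> 2" and b: "\<alpha> \<le> b" "1 < b"
  shows "outer_radius \<Omega> z - inner_radius \<Omega> z \<le> stability_const b * hess_norm powr (1 / b)"
    and "stability_const b \<ge> 0"
proof -
  obtain p0 where p0: "p0 \<in> frontier \<Omega>" using frontier_nonempty by blast
  have "grad_const \<ge> 0"
    using boundary_value_bound(2)[OF N p0 radius_pos(1) order_refl b(1)] b by simp
  then have l0: "line_const b \<ge> 0" unfolding line_const_def by simp
  have C0: "stability_pre_const b \<ge> 0"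
    unfolding stability_pre_const_def using \<delta>_pos const_nonneg l0 b boundary_const_nonneg by simp
  then show "stability_const b \<ge> 0" unfolding stability_const_def using diameter_nonneg radius_pos by simp
  show "outer_radius \<Omega> z - inner_radius \<Omega> z \<le> stability_const b * hess_norm powr (1 / b)"
    unfolding stability_const_def
  proof (rule powr_optimize[OF b(2) radius_pos(1) C0 hess_norm_nonneg radii_difference_le_diameter diameter_nonneg])
    fix \<epsilon> assume \<epsilon>: "0 < \<epsilon>" "\<epsilon> \<le> radius"
    define T where "T = \<epsilon> powr (1 - b)"
    have T: "T > 0" unfolding T_def using \<epsilon> by simp
    have "1 \<le> radius powr (b - 1) * T"
    proof -
      have "radius powr (1 - b) \<le> T" unfolding T_def using \<epsilon> b by (intro powr_mono2') auto
      then have "radius powr (b - 1) * radius powr (1 - b) \<le> radius powr (b - 1) * T" by (intro mult_left_mono) auto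
      then show ?thesis using radius_pos by (simp add: powr_add[symmetric])
    qed
    then have 1: "value_center_const * hess_norm * 1 \<le> value_center_const * hess_norm * (radius powr (b - 1) * T)"
      using const_nonneg hess_norm_nonneg by (intro mult_left_mono) auto
    have 2: "line_const b * hess_norm * (radius powr (1 - b) - T) / (1 - b) \<le> line_const b / (b - 1) * (hess_norm * T)"
    proof -
      have "line_const b * hess_norm * (radius powr (1 - b) - T) / (1 - b) = line_const b * hess_norm * (T - radius powr (1 - b)) / (b - 1)"
        using b by (simp add: field_simps)
      also have "\<dots> \<le> line_const b * hess_norm * T / (b - 1)"
        using l0 hess_norm_nonneg b by (intro divide_right_mono mult_left_mono) auto
      finally show ?thesis by simp
    qed
    define M where "M = value_center_const * radius powr (b - 1) * (hess_norm * T) + line_const b / (b - 1) * (hess_norm * T) + boundary_const * \<epsilon>"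
    have "\<bar>h p - h z\<bar> \<le> M" if p: "p \<in> frontier \<Omega>" for p
      using boundary_value_bound(1)[OF N p \<epsilon> b(1)] 1 2 b unfolding M_def T_def by (simp add: mult_ac)
    then have "outer_radius \<Omega> z - inner_radius \<Omega> z \<le> 2 * M / \<delta>" by (rule radii_difference)
    also have "\<dots> \<le> stability_pre_const b * (hess_norm * T + \<epsilon>)"
    proof -
      define X where "X = value_center_const * radius powr (b - 1)"
      define Y where "Y = line_const b / (b - 1)"
      have X: "X \<ge> 0" "Y \<ge> 0" unfolding X_def Y_def using const_nonneg l0 b by auto
      have "M \<le> (X + Y + boundary_const) * (hess_norm * T + \<epsilon>)"
      proof -
        have "0 \<le> (X + Y) * \<epsilon>" "0 \<le> boundary_const * (hess_norm * T)"
          using X \<epsilon> boundary_const_nonneg hess_norm_nonneg T by simp_all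
        then show ?thesis unfolding M_def X_def[symmetric] Y_def[symmetric] by (simp add: algebra_simps)
      qed
      then have "2 / \<delta> * M \<le> 2 / \<delta> * ((X + Y + boundary_const) * (hess_norm * T + \<epsilon>))"
        using \<delta>_pos by (intro mult_left_mono) auto
      then have "2 / \<delta> * M \<le> 2 / \<delta> * (X + Y + boundary_const) * (hess_norm * T + \<epsilon>)" by (simp only: mult.assoc)
      then show ?thesis unfolding stability_pre_const_def X_def[symmetric] Y_def[symmetric] by simp
    qed
    finally show "outer_radius \<Omega> z - inner_radius \<Omega> z \<le> stability_pre_const b * (hess_norm * \<epsilon> powr (1 - b) + \<epsilon>)"
      unfolding T_def .
  qed
qed

text \<open>\<^const>\<open>stability_exponent\<close> allows \<open>\<theta> \<ge> 1\<close>, hence nonpositive exponents; these need the a priori upper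
  bound for the weighted norm.\<close>

definition nonpos_power_const :: "real \<Rightarrow> real" where
  "nonpos_power_const \<tau> = stability_const 2 *
     sqrt ((real CARD('n))\<^sup>2 * (2 / r\<^sub>i * energy_const)) powr (1/2 - \<tau>)"

lemma nonpos_power_estimate:
  assumes N: "CARD('n) = 3" and \<tau>: "\<tau> \<le> 0"
  shows "outer_radius \<Omega> z - inner_radius \<Omega> z \<le> nonpos_power_const \<tau> * hess_norm powr \<tau>"
proof -
  have "\<alpha> \<le> 2" unfolding \<alpha>_def using N by simp
  note P = power_estimate[OF _ this]
  \<comment> \<open>The estimate with b = 2 is split so that the a priori bound absorbs the positive
    power 1/2 - \<tau>. If the norm is 0, both sides are 0, since \<open>0 powr\<close> is 0 for
    every exponent.\<close>
  have "hess_norm powr (1/2) = hess_norm powr (1/2 - \<tau>) * hess_norm powr \<tau>" by (simp add: powr_add[symmetric])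
  also have "\<dots> \<le> sqrt ((real CARD('n))\<^sup>2 * (2 / r\<^sub>i * energy_const)) powr (1/2 - \<tau>) * hess_norm powr \<tau>"
    using hess_norm_bound hess_norm_nonneg \<tau> by (intro mult_right_mono powr_mono2) auto
  finally have "stability_const 2 * hess_norm powr (1/2) \<le> nonpos_power_const \<tau> * hess_norm powr \<tau>"
    unfolding nonpos_power_const_def using P(2) N by (simp add: mult.assoc mult_left_mono)
  then show ?thesis using P(1) N by simp
qed

end

section \<open>Assembly with a uniform constant\<close>

theorem theorem3p18:
  fixes r\<^sub>i r\<^sub>e d \<delta> \<tau> :: real
  assumes "CARD('n::finite) \<ge> 2"
    and "stability_exponent CARD('n) \<tau>"
  shows "\<exists>C>0. \<forall>(\<Omega> :: (real^'n) set) u z a.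
     open \<Omega> \<and> connected \<Omega> \<and> bounded \<Omega> \<and> C2_boundary \<Omega> \<and>
     interior_sphere_condition \<Omega> r\<^sub>i \<and> exterior_sphere_condition \<Omega> r\<^sub>e \<and>
     diameter \<Omega> = d \<and>
     torsion_solution \<Omega> u \<and>
     z \<in> \<Omega> \<and> gradient u z = 0 \<and> boundary_dist \<Omega> z = \<delta> \<longrightarrow>
     (let q = (\<lambda>x. ((norm (x - z))\<^sup>2 - a) / 2);
          h = (\<lambda>x. q x - u x)
      in outer_radius \<Omega> z - inner_radius \<Omega> z
           \<le> C * weighted_hessian_norm \<Omega> h powr \<tau>)"
proof -
  define P where "P \<Omega> u z \<longleftrightarrow> open \<Omega> \<and> connected \<Omega> \<and> bounded \<Omega> \<and> C2_boundary \<Omega> \<and>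
     interior_sphere_condition \<Omega> r\<^sub>i \<and> exterior_sphere_condition \<Omega> r\<^sub>e \<and> diameter \<Omega> = d \<and>
     torsion_solution \<Omega> u \<and> z \<in> \<Omega> \<and> gradient u z = 0 \<and> boundary_dist \<Omega> z = \<delta>"
    for \<Omega> :: "(real^'n) set" and u z
  define h where "h u z a = (\<lambda>x. ((norm (x - z))\<^sup>2 - a) / 2 - u x)" for u :: "real^'n \<Rightarrow> real" and z a
  have problem: "torsion_problem \<Omega> r\<^sub>i r\<^sub>e d u z \<delta> a (h u z a)" if "P \<Omega> u z" for \<Omega> u z a
    using that unfolding P_def h_def by unfold_locales auto
  have \<alpha>: "torsion_problem.\<alpha> TYPE('n) = (real CARD('n) - 1) / 2"
    if "P \<Omega> u z" for \<Omega> u z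
    using torsion_problem.\<alpha>_def[OF problem[OF that]] .
  have "\<exists>C. \<forall>\<Omega> u z a. P \<Omega> u z \<longrightarrow>
      outer_radius \<Omega> z - inner_radius \<Omega> z \<le> C * weighted_hessian_norm \<Omega> (h u z a) powr \<tau>"
  proof -
    \<comment> \<open>Apart from the plane and from N = 3 with \<theta> \<ge> 1, every exponent is 1
      / b with b > 1 and b \<ge> \<alpha>: b = 1 / (1 - \<theta>) for N = 3, and b = \<alpha> for N
      \<ge> 4.\<close>
    consider (planar) "CARD('n) = 2" "\<tau> = 1" | (nonpos) "CARD('n) = 3" "\<tau> \<le> 0"
      | (power) b where "1 < b" "(real CARD('n) - 1) / 2 \<le> b" "\<tau> = 1 / b"
    proof -
      from assms(2) consider "CARD('n) = 2 \<and> \<tau> = 1" | \<theta> where "CARD('n) = 3" "\<theta> > 0" "\<tau> = 1 - \<theta>"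
        | "CARD('n) \<ge> 4" "\<tau> = 2 / (real CARD('n) - 1)"
        unfolding stability_exponent_def by blast
      then show thesis
      proof cases
        case 1
        then show ?thesis using planar by blast
      next
        case 2
        show ?thesis
        proof (cases "\<theta> < 1")
          case True
          then show ?thesis using 2 by (intro power[of "1 / (1 - \<theta>)"]) (auto simp: field_simps)
        next
          case False
          then show ?thesis using 2 nonpos by simp
        qed
      next
        case 3
        then show ?thesis by (intro power[of "(real CARD('n) - 1) / 2"]) auto
      qed
    qed
    then show ?thesis
    proof cases
      case planar
      \<comment> \<open>The arguments of the exported constant show that it can be fixed before the
        domain, \<open>u\<close>, \<open>z\<close> and \<open>a\<close> are chosen.\<close>
      have "outer_radius \<Omega> z - inner_radius \<Omega> z \<le>
          torsion_problem.planar_const TYPE('n) r\<^sub>i r\<^sub>e d \<delta> * weighted_hessian_norm \<Omega> (h u z a) powr \<tau>"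
        if "P \<Omega> u z" for \<Omega> u z a
      proof -
        interpret torsion_problem \<Omega> r\<^sub>i r\<^sub>e d u z \<delta> a "h u z a" by (rule problem[OF that])
        show ?thesis using planar_estimate[OF planar(1)] hess_norm_nonneg planar(2) unfolding hess_norm_def by simp
      qed
      then show ?thesis by blast
    next
      case nonpos
      have "outer_radius \<Omega> z - inner_radius \<Omega> z \<le>
          torsion_problem.nonpos_power_const TYPE('n) r\<^sub>i r\<^sub>e d \<delta> \<tau> * weighted_hessian_norm \<Omega> (h u z a) powr \<tau>"
        if "P \<Omega> u z" for \<Omega> u z a
        using torsion_problem.nonpos_power_estimate[OF problem[OF that, of a] nonpos]
        unfolding torsion_problem.hess_norm_def[OF problem[OF that, of a]] .
      then show ?thesis by blast
    next
      case power
      have "outer_radius \<Omega> z - inner_radius \<Omega> z \<le>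
          torsion_problem.stability_const TYPE('n) r\<^sub>i r\<^sub>e d \<delta> b * weighted_hessian_norm \<Omega> (h u z a) powr \<tau>"
        if "P \<Omega> u z" for \<Omega> u z a
        using torsion_problem.power_estimate(1)[OF problem[OF that, of a] assms(1) _ power(1)] power(2) \<alpha>[OF that]
        unfolding torsion_problem.hess_norm_def[OF problem[OF that, of a]] power(3) by simp
      then show ?thesis by blast
    qed
  qed
  then obtain C where C: "\<And>\<Omega> u z a. P \<Omega> u z \<Longrightarrow>
      outer_radius \<Omega> z - inner_radius \<Omega> z \<le> C * weighted_hessian_norm \<Omega> (h u z a) powr \<tau>"
    by blast
  \<comment> \<open>\<open>\<bar>C\<bar> + 1\<close> is positive whatever the sign of
    \<open>C\<close>, and enlarging the constant is harmless because powers are nonnegative.\<close>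
  have "outer_radius \<Omega> z - inner_radius \<Omega> z \<le> (\<bar>C\<bar> + 1) * weighted_hessian_norm \<Omega> (h u z a) powr \<tau>"
    if "P \<Omega> u z" for \<Omega> u z a
    by (rule order_trans[OF C[OF that, of a] mult_right_mono]) auto
  then show ?thesis
    unfolding P_def h_def Let_def by (intro exI[of _ "\<bar>C\<bar> + 1"]) auto
qed

end
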